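(* Let $V$ be a complex vector space of dimension $2n$ equipped with a non-degenerate skew-symmetric bilinear form, let $\mathrm{Sp}(V)$ be the corresponding symplectic group, and let $W$ be a complex vector space of dimension $g$. Let $\mathrm{Sp}(V)$ act on the exterior algebra $\Lambda(V\otimes W)$ through its natural action on $V$ (and trivially on $W$), and let $\mathcal{I}=\Lambda(V\otimes W)^{\mathrm{Sp}(V)}$ be the (commutative) algebra of invariants. Let $S(S^2W)$ be the symmetric algebra of $S^2W$, and let $P_{n+1}:S^{2n+2}W\to S^{n+1}(S^2W)\subset S(S^2W)$ be the natural embedding. Then $\mathcal{I}$ is isomorphic, as an algebra, to the quotient of $S(S^2W)$ by the ideal generated by $P_{n+1}(S^{2n+2}W)$.
   Context: Explicitly, fix a basis $e_1,\dots,e_g$ of $W$ and write $L_{ij}=e_ie_j=L_{ji}\in S^2W$. For $k\ge 1$ the map $P_k:S^{2k}W\to S^k(S^2W)$ sends a monomial $e_{i_1}e_{i_2}\cdots e_{i_{2k}}$ (with $i_j\in\{1,\dots,g\}$) to the sum, over all partitions of the positions $\{1,\dots,2k\}$ into $k$ unordered pairs $\{a_1,b_1\},\dots,\{a_k,b_k\}$, of the products $L_{i_{a_1}i_{b_1}}\cdots L_{i_{a_k}i_{b_k}}$. *)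

theory Defs
  imports Complex_Main "HOL-Library.Poly_Mapping" "HOL-Library.Product_Lexorder"
begin

text \<open>Vectors of V are functions nat => complex, only coordinates a < 2n matter.
  A bilinear form is given by its Gram matrix Om (entries a,b < 2n).\<close>

definition bilin :: "nat \<Rightarrow> (nat \<Rightarrow> nat \<Rightarrow> complex) \<Rightarrow> (nat \<Rightarrow> complex) \<Rightarrow> (nat \<Rightarrow> complex) \<Rightarrow> complex" where
  "bilin n Om u v = (\<Sum>a<2*n. \<Sum>b<2*n. u a * Om a b * v b)"

definition skew_form :: "nat \<Rightarrow> (nat \<Rightarrow> nat \<Rightarrow> complex) \<Rightarrow> bool" where
  "skew_form n Om \<longleftrightarrow> (\<forall>a<2*n. \<forall>b<2*n. Om a b = - Om b a)"

definition nondeg_form :: "nat \<Rightarrow> (nat \<Rightarrow> nat \<Rightarrow> complex) \<Rightarrow> bool" where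
  "nondeg_form n Om \<longleftrightarrow> (\<forall>u. (\<forall>v. bilin n Om u v = 0) \<longrightarrow> (\<forall>a<2*n. u a = 0))"

definition mat_app :: "nat \<Rightarrow> (nat \<Rightarrow> nat \<Rightarrow> complex) \<Rightarrow> (nat \<Rightarrow> complex) \<Rightarrow> (nat \<Rightarrow> complex)" where
  "mat_app n M u = (\<lambda>b. if b < 2*n then (\<Sum>a<2*n. M b a * u a) else 0)"

definition Sp :: "nat \<Rightarrow> (nat \<Rightarrow> nat \<Rightarrow> complex) \<Rightarrow> (nat \<Rightarrow> nat \<Rightarrow> complex) set" where
  "Sp n Om = {M. \<forall>u v. bilin n Om (mat_app n M u) (mat_app n M v) = bilin n Om u v}"

text \<open>V (x) W has basis e_a (x) f_i, indexed by pairs (a,i), a < 2n, i < g.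
  An element of the exterior algebra is a coefficient function on finite sets of
  basis indices (the basis monomial e_S is the wedge of the elements of S in
  increasing lexicographic order); coefficients vanish outside subsets of gens.\<close>

type_synonym ext = "(nat \<times> nat) set \<Rightarrow> complex"

definition gens :: "nat \<Rightarrow> nat \<Rightarrow> (nat \<times> nat) set" where
  "gens n g = {0..<2*n} \<times> {0..<g}"

definition ext_carrier :: "nat \<Rightarrow> nat \<Rightarrow> ext set" where
  "ext_carrier n g = {f. \<forall>S. f S \<noteq> 0 \<longrightarrow> S \<subseteq> gens n g}"

definition ext_zero :: ext where "ext_zero = (\<lambda>S. 0)"

definition ext_const :: "complex \<Rightarrow> ext" where
  "ext_const c = (\<lambda>S. if S = {} then c else 0)"

definition ext_add :: "ext \<Rightarrow> ext \<Rightarrow> ext" where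
  "ext_add f h = (\<lambda>S. f S + h S)"

definition ext_scale :: "complex \<Rightarrow> ext \<Rightarrow> ext" where
  "ext_scale c f = (\<lambda>S. c * f S)"

text \<open>Sign of e_S wedge e_T = sign * e_(S union T) for disjoint S, T.\<close>
definition wsign :: "(nat \<times> nat) set \<Rightarrow> (nat \<times> nat) set \<Rightarrow> complex" where
  "wsign S T = (-1) ^ card {(s,t). s \<in> S \<and> t \<in> T \<and> t < s}"

definition ext_mul :: "(nat \<times> nat) set \<Rightarrow> ext \<Rightarrow> ext \<Rightarrow> ext" where
  "ext_mul B f h = (\<lambda>U. \<Sum>S\<in>Pow B. \<Sum>T\<in>Pow B.
      if S \<inter> T = {} \<and> S \<union> T = U then wsign S T * f S * h T else 0)"

definition ext_vec :: "((nat \<times> nat) \<Rightarrow> complex) \<Rightarrow> ext" where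
  "ext_vec v = (\<lambda>S. if card S = 1 then v (the_elem S) else 0)"

definition gen_image :: "nat \<Rightarrow> (nat \<Rightarrow> nat \<Rightarrow> complex) \<Rightarrow> nat \<times> nat \<Rightarrow> ext" where
  "gen_image n M x = ext_vec (\<lambda>(b,j). if b < 2*n \<and> j = snd x then M b (fst x) else 0)"

text \<open>Natural action of M on Lambda(V (x) W): the algebra endomorphism induced by
  M (x) id_W, i.e. e_S = x_1 wedge ... wedge x_k maps to (M x_1) wedge ... wedge (M x_k).\<close>
definition ext_act :: "nat \<Rightarrow> nat \<Rightarrow> (nat \<Rightarrow> nat \<Rightarrow> complex) \<Rightarrow> ext \<Rightarrow> ext" where
  "ext_act n g M f = (\<lambda>U. \<Sum>S\<in>Pow (gens n g).
       f S * foldr (ext_mul (gens n g)) (map (gen_image n M) (sorted_list_of_set S))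
                   (ext_const 1) U)"

definition invariants :: "nat \<Rightarrow> nat \<Rightarrow> (nat \<Rightarrow> nat \<Rightarrow> complex) \<Rightarrow> ext set" where
  "invariants n g Om = {f \<in> ext_carrier n g. \<forall>M\<in>Sp n Om. ext_act n g M f = f}"

text \<open>S(S^2 W) is the polynomial ring over C in the variables L_ij = L_ji, i,j < g,
  represented by the pairs (i,j) with i <= j < g.\<close>

type_synonym spoly = "((nat \<times> nat) \<Rightarrow>\<^sub>0 nat) \<Rightarrow>\<^sub>0 complex"

definition Lvars :: "nat \<Rightarrow> (nat \<times> nat) set" where
  "Lvars g = {(i,j). i \<le> j \<and> j < g}"

definition sym_alg :: "nat \<Rightarrow> spoly set" where
  "sym_alg g = {p :: spoly. \<forall>m \<in> Poly_Mapping.keys p. Poly_Mapping.keys m \<subseteq> Lvars g}"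

definition Lvar :: "nat \<Rightarrow> nat \<Rightarrow> spoly" where
  "Lvar i j = Poly_Mapping.single (Poly_Mapping.single (min i j, max i j) 1) 1"

definition spconst :: "complex \<Rightarrow> spoly" where
  "spconst c = Poly_Mapping.single 0 c"

definition pairings :: "nat \<Rightarrow> nat set set set" where
  "pairings k = {M. \<Union>M = {0..<2*k} \<and> (\<forall>p\<in>M. card p = 2)
                    \<and> (\<forall>p\<in>M. \<forall>q\<in>M. p \<noteq> q \<longrightarrow> p \<inter> q = {})}"

text \<open>P_k applied to the monomial e_(xs!0) ... e_(xs!(2k-1)) of S^(2k) W.\<close>
definition Pk :: "nat \<Rightarrow> nat list \<Rightarrow> spoly" where
  "Pk k xs = (\<Sum>M\<in>pairings k. \<Prod>p\<in>M. Lvar (xs ! Min p) (xs ! Max p))"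

definition ideal_gen :: "spoly set \<Rightarrow> spoly set \<Rightarrow> spoly set" where
  "ideal_gen R G = {\<Sum>i<m. a i * q i | (m :: nat) (a :: nat \<Rightarrow> spoly) (q :: nat \<Rightarrow> spoly).
                      \<forall>i<m. a i \<in> R \<and> q i \<in> G}"

text \<open>The ideal generated by P_(n+1)(S^(2n+2) W); S^(2n+2) W is spanned by monomials.\<close>
definition P_ideal :: "nat \<Rightarrow> nat \<Rightarrow> spoly set" where
  "P_ideal n g = ideal_gen (sym_alg g)
     (Pk (n+1) ` {xs. length xs = 2*n+2 \<and> set xs \<subseteq> {..<g}})"

end

(* Let J be the inverse of the Gram matrix Om. On the exterior algebra we have creation and
   annihilation operators c_x, a_x for x = (a,i). The algebra homomorphism phi sends L_ij to
   w_ij = sum J_ab c_ai c_bj; dual to it are the contractions d_ij = sum Om_ab a_ai a_bj, and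
   e_ij = sum c_ai a_aj are the matrix units of gl(W), a derivation of S(S^2 W) as well.
   Everything rests on one Casimir identity: on vectors annihilated by sp(V), and in particular on
   the Sp(V)-invariants,
     sum_ij w_ij d_ij = (2n+g+1) sum_i e_ii - sum_ij e_ji e_ij,
   and for a vector of gl(W)-weight w the right-hand side equals
     c(w) - 2 sum_(i<j) e_ji e_ij,   c(w) = sum_i w_i (2n+2+2i-w_i)   (i = 0,...,g-1).
   Here c(w) > 0 when w is nonzero and all w_i <= 2n, which always holds in the exterior algebra.
   As d_ij and e_ij (i<j) lower sum_i (i+1) w_i and preserve invariance, induction on this number
   shows that every invariant lies in the image of phi.
   The d_ij lift to S(S^2 W), and the same identity holds there. So the same induction shows that
   an element of ker phi of weight w lies in the ideal P generated by P_(n+1)(S^(2n+2) W) if all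
   w_i <= 2n. If some w_t > 2n, it lies in P anyway: applying e_jt repeatedly to
   L_tt^(n+1) in P gives elements of P with leading terms L_tt^b L_tj1 ... L_tjk, b + k = n+1, that
   allow one to raise the exponent of L_tt in any monomial of t-weight > 2n until it exceeds n.
   Conversely P_(n+1)(t,...,t) is a multiple of L_tt^(n+1), which phi kills for weight reasons, and
   the other generators of P are obtained from it by the derivations e_jt. *)
theory Submission
  imports Defs "HOL-Library.Function_Algebras" "Jordan_Normal_Form.Determinant"
begin

section \<open>Matrices and the symplectic group\<close>

text \<open>Signs are the obstacle in the exterior algebra. They are confined to the ring
  \<open>lop\<close>: once the canonical anticommutation relations hold there, every further
  identity is ring algebra, and an element is recovered from its operator by applying that operator
  to the vacuum.

  The Casimir identity is an instance of skew Howe duality: the w_ij, d_ij and e_ij span a copy of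
  sp(2g) that commutes with sp(V), and the Casimir operators of the two algebras agree up to sign
  and a constant. On invariants the one of sp(V) vanishes.

  The factor 2n+2+2i-w_i of c(w) is positive for w_i \<le> 2n. For i = 0 it first vanishes at w_0 =
  2n+2, the weight of L_00^(n+1), so the Casimir argument stops exactly where the relations begin.
  Weights in the exterior algebra never get there; polynomial weights do, which forces the separate
  treatment of large weights.

  Passing from the group to its Lie algebra needs no exponential: transvections depend affinely on
  their parameter, so only finite sums and products are differentiated.\<close>

lemma sum_mult_delta:
  fixes F :: "nat \<Rightarrow> complex"
  assumes "c < m"
  shows "(\<Sum>b<m. F b * (if b = c then 1 else 0)) = F c"
    and "(\<Sum>b<m. (if c = b then 1 else 0) * F b) = F c"
proof -
  have "(\<Sum>b<m. F b * (if b = c then 1 else 0)) = (\<Sum>b<m. if b = c then F c else 0)"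
    and "(\<Sum>b<m. (if c = b then 1 else 0) * F b) = (\<Sum>b<m. if b = c then F c else 0)"
    by (intro sum.cong; auto)+
  then show "(\<Sum>b<m. F b * (if b = c then 1 else 0)) = F c"
    and "(\<Sum>b<m. (if c = b then 1 else 0) * F b) = F c" using assms by simp_all
qed

lemma mat_fun_mult:
  fixes A B :: "nat \<Rightarrow> nat \<Rightarrow> complex"
  shows "mat m m (\<lambda>(i,j). A i j) * mat m m (\<lambda>(i,j). B i j) = mat m m (\<lambda>(i,j). \<Sum>b<m. A i b * B b j)"
  by (rule eq_matI) (auto simp: scalar_prod_def atLeast0LessThan)

lemma left_inverse_imp_right_inverse:
  fixes A B :: "nat \<Rightarrow> nat \<Rightarrow> complex"
  assumes "\<And>a c. a < m \<Longrightarrow> c < m \<Longrightarrow> (\<Sum>b<m. A a b * B b c) = (if a = c then 1 else 0)"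
    and "a < m" "c < m"
  shows "(\<Sum>b<m. B a b * A b c) = (if a = c then 1 else 0)"
proof -
  have "mat m m (\<lambda>(i,j). A i j) * mat m m (\<lambda>(i,j). B i j) = 1\<^sub>m m"
    unfolding mat_fun_mult by (rule eq_matI) (auto simp: assms)
  then have "mat m m (\<lambda>(i,j). B i j) * mat m m (\<lambda>(i,j). A i j) = 1\<^sub>m m"
    by (rule mat_mult_left_right_inverse[OF mat_carrier mat_carrier])
  then have "mat m m (\<lambda>(i,j). \<Sum>b<m. B i b * A b j) $$ (a,c) = 1\<^sub>m m $$ (a,c)"
    unfolding mat_fun_mult by simp
  then show ?thesis using assms by simp
qed

lemma inverse_fun_unique:
  fixes A B C :: "nat \<Rightarrow> nat \<Rightarrow> complex"
  assumes "\<And>a c. a < m \<Longrightarrow> c < m \<Longrightarrow> (\<Sum>b<m. B a b * A b c) = (if a = c then 1 else 0)"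
    and "\<And>a c. a < m \<Longrightarrow> c < m \<Longrightarrow> (\<Sum>b<m. A a b * C b c) = (if a = c then 1 else 0)"
    and "a < m" "c < m"
  shows "B a c = C a c"
proof -
  have "B a c = (\<Sum>b<m. B a b * (\<Sum>d<m. A b d * C d c))"
    using assms by (simp add: sum_mult_delta)
  also have "\<dots> = (\<Sum>d<m. (\<Sum>b<m. B a b * A b d) * C d c)"
    unfolding sum_distrib_left sum_distrib_right by (subst sum.swap) (simp add: mult.assoc)
  also have "\<dots> = C a c"
    using assms by (simp add: sum_mult_delta)
  finally show ?thesis .
qed

text \<open>Non-degeneracy forbids a nonzero vector in the left kernel, and skewness turns a right
  kernel vector into a left one, so the determinant is nonzero. The inverse is skew because its
  negative transpose is also a right inverse of \<open>Om\<close>.\<close>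

lemma skew_nondeg_inverse:
  assumes "skew_form n Om" "nondeg_form n Om"
  obtains J where
    "\<And>a c. a < 2*n \<Longrightarrow> c < 2*n \<Longrightarrow> (\<Sum>b<2*n. J a b * Om b c) = (if a = c then 1 else 0)"
    "\<And>a c. a < 2*n \<Longrightarrow> c < 2*n \<Longrightarrow> (\<Sum>b<2*n. Om a b * J b c) = (if a = c then 1 else 0)"
    "\<And>a b. a < 2*n \<Longrightarrow> b < 2*n \<Longrightarrow> J a b = - J b a"
proof -
  let ?m = "2*n"
  let ?A = "mat ?m ?m (\<lambda>(i,j). Om i j)"
  have skew: "Om a b = - Om b a" if "a < ?m" "b < ?m" for a b
    using assms(1) that unfolding skew_form_def by blast
  have "det ?A \<noteq> 0"
  proof
    assume "det ?A = 0"
    then obtain v where v: "v \<in> carrier_vec ?m" "v \<noteq> 0\<^sub>v ?m" "?A *\<^sub>v v = 0\<^sub>v ?m"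
      using det_0_iff_vec_prod_zero_field[of ?A ?m] by auto
    have row: "(\<Sum>a<?m. Om b a * v $ a) = 0" if "b < ?m" for b
    proof -
      have "(?A *\<^sub>v v) $ b = 0" using v(3) that by simp
      then show ?thesis using that v(1) by (auto simp: scalar_prod_def atLeast0LessThan)
    qed
    have "bilin n Om (\<lambda>a. v $ a) w = 0" for w
    proof -
      have "bilin n Om (\<lambda>a. v $ a) w = (\<Sum>b<?m. \<Sum>a<?m. v $ a * Om a b * w b)"
        unfolding bilin_def by (rule sum.swap)
      also have "\<dots> = (\<Sum>b<?m. - (\<Sum>a<?m. Om b a * v $ a) * w b)"
        unfolding sum_distrib_right sum_negf[symmetric]
        by (intro sum.cong refl) (subst skew, auto)
      finally show ?thesis by (simp add: row)
    qed
    then have "\<forall>a<?m. v $ a = 0"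
      using assms(2) unfolding nondeg_form_def by blast
    then show False using v(1,2) by auto
  qed
  then have "?A \<in> Units (ring_mat TYPE(complex) ?m ())"
    by (rule det_non_zero_imp_unit[OF mat_carrier])
  then obtain Bm where Bm: "Bm \<in> carrier_mat ?m ?m" "Bm * ?A = 1\<^sub>m ?m"
    unfolding Units_def ring_mat_def by auto
  define J where "J = (\<lambda>a b. Bm $$ (a,b))"
  have "Bm = mat ?m ?m (\<lambda>(i,j). J i j)"
    using Bm(1) by (intro eq_matI) (auto simp: J_def)
  then have J1: "(\<Sum>b<?m. J a b * Om b c) = (if a = c then 1 else 0)" if "a < ?m" "c < ?m" for a c
  proof -
    have "mat ?m ?m (\<lambda>(i,j). \<Sum>b<?m. J i b * Om b j) = 1\<^sub>m ?m"
      using Bm(2) \<open>Bm = _\<close> mat_fun_mult[of ?m J Om] by simp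
    then have "mat ?m ?m (\<lambda>(i,j). \<Sum>b<?m. J i b * Om b j) $$ (a,c) = 1\<^sub>m ?m $$ (a,c)" by simp
    then show ?thesis using that by simp
  qed
  have J2: "(\<Sum>b<?m. Om a b * J b c) = (if a = c then 1 else 0)" if "a < ?m" "c < ?m" for a c
    using left_inverse_imp_right_inverse[of ?m J Om, OF J1] that by blast
  have J3: "J a b = - J b a" if "a < ?m" "b < ?m" for a b
  proof (rule inverse_fun_unique[OF J1 _ that])
    fix a c assume ac: "a < ?m" "c < ?m"
    have "(\<Sum>b<?m. Om a b * - J c b) = (\<Sum>b<?m. J c b * Om b a)"
      by (intro sum.cong refl) (subst skew, auto simp: ac)
    then show "(\<Sum>b<?m. Om a b * - J c b) = (if a = c then 1 else 0)"
      using J1 ac by auto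
  qed
  show thesis by (rule that[OF J1 J2 J3])
qed

lemma Sp_preserves_form:
  assumes "M \<in> Sp n Om" "a < 2*n" "b < 2*n"
  shows "(\<Sum>p<2*n. \<Sum>q<2*n. M p a * Om p q * M q b) = Om a b"
proof -
  let ?e = "\<lambda>a x. if x = a then 1 else (0::complex)"
  have "bilin n Om (mat_app n M (?e a)) (mat_app n M (?e b)) = bilin n Om (?e a) (?e b)"
    using assms by (auto simp: Sp_def)
  moreover have "bilin n Om (mat_app n M (?e a)) (mat_app n M (?e b)) = (\<Sum>p<2*n. \<Sum>q<2*n. M p a * Om p q * M q b)"
    unfolding bilin_def mat_app_def using assms by (intro sum.cong refl) (simp add: sum_mult_delta)
  moreover have "bilin n Om (?e a) (?e b) = Om a b"
  proof -
    have "bilin n Om (?e a) (?e b) = (\<Sum>p<2*n. Om p b * (if p = a then 1 else 0))"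
      unfolding bilin_def sum_mult_delta(1)[OF assms(3)] by (simp only: mult.commute)
    then show ?thesis using assms by (simp only: sum_mult_delta)
  qed
  ultimately show ?thesis by simp
qed

text \<open>In matrix form, M^T Om M = Om makes L = J M^T Om a left inverse of M, hence a right
  inverse. Then M J M^T is a left inverse of Om and must be J.\<close>

lemma Sp_preserves_inverse_form:
  assumes M: "M \<in> Sp n Om"
    and J1: "\<And>a c. a < 2*n \<Longrightarrow> c < 2*n \<Longrightarrow> (\<Sum>b<2*n. J a b * Om b c) = (if a = c then 1 else 0)"
    and J2: "\<And>a c. a < 2*n \<Longrightarrow> c < 2*n \<Longrightarrow> (\<Sum>b<2*n. Om a b * J b c) = (if a = c then 1 else 0)"
    and ab: "a < 2*n" "b < 2*n"
  shows "(\<Sum>c<2*n. \<Sum>d<2*n. M a c * J c d * M b d) = J a b"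
proof -
  let ?m = "2*n"
  define L where "L = (\<lambda>a q. \<Sum>c<?m. J a c * (\<Sum>p<?m. M p c * Om p q))"
  have "(\<Sum>q<?m. L a q * M q b) = (if a = b then 1 else 0)" if "a < ?m" "b < ?m" for a b
  proof -
    have "(\<Sum>q<?m. L a q * M q b) = (\<Sum>q<?m. \<Sum>c<?m. J a c * ((\<Sum>p<?m. M p c * Om p q) * M q b))"
      by (simp add: L_def sum_distrib_right mult.assoc)
    also have "\<dots> = (\<Sum>c<?m. J a c * (\<Sum>q<?m. (\<Sum>p<?m. M p c * Om p q * M q b)))"
      unfolding sum_distrib_left sum_distrib_right by (subst sum.swap) (simp add: mult.assoc)
    also have "\<dots> = (\<Sum>c<?m. J a c * Om c b)"
    proof (intro sum.cong refl)
      fix c assume "c \<in> {..<?m}"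
      then have "(\<Sum>q<?m. \<Sum>p<?m. M p c * Om p q * M q b) = Om c b"
        using Sp_preserves_form[OF M _ that(2), of c] by (subst sum.swap) simp
      then show "J a c * (\<Sum>q<?m. \<Sum>p<?m. M p c * Om p q * M q b) = J a c * Om c b" by simp
    qed
    finally show ?thesis using J1 that by simp
  qed
  then have rinv: "(\<Sum>q<?m. M a q * L q b) = (if a = b then 1 else 0)" if "a < ?m" "b < ?m" for a b
    using left_inverse_imp_right_inverse[of ?m L M] that by blast
  define N where "N = (\<lambda>a p. \<Sum>q<?m. \<Sum>c<?m. M a q * J q c * M p c)"
  have "(\<Sum>p<?m. N a p * Om p b) = (if a = b then 1 else 0)" if "a < ?m" "b < ?m" for a b
  proof -
    have "(\<Sum>p<?m. N a p * Om p b) = (\<Sum>p<?m. \<Sum>q<?m. M a q * (\<Sum>c<?m. J q c * (M p c * Om p b)))"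
      by (simp add: N_def sum_distrib_left sum_distrib_right mult.assoc)
    also have "\<dots> = (\<Sum>q<?m. \<Sum>p<?m. M a q * (\<Sum>c<?m. J q c * (M p c * Om p b)))"
      by (rule sum.swap)
    also have "\<dots> = (\<Sum>q<?m. M a q * (\<Sum>p<?m. \<Sum>c<?m. J q c * (M p c * Om p b)))"
      by (simp only: sum_distrib_left)
    also have "\<dots> = (\<Sum>q<?m. M a q * L q b)"
    proof -
      have "(\<Sum>p<?m. \<Sum>c<?m. J q c * (M p c * Om p b)) = L q b" for q
        unfolding L_def sum_distrib_left by (rule sum.swap)
      then show ?thesis by simp
    qed
    finally show ?thesis using rinv that by simp
  qed
  from inverse_fun_unique[OF this J2 ab] show ?thesis
    by (simp add: N_def)
qed

section \<open>Derivations of the polynomial ring\<close>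

abbreviation "lookup \<equiv> Poly_Mapping.lookup"
abbreviation "keys \<equiv> Poly_Mapping.keys"
abbreviation "single \<equiv> Poly_Mapping.single"

abbreviation mono :: "((nat \<times> nat) \<Rightarrow>\<^sub>0 nat) \<Rightarrow> spoly" where
  "mono m \<equiv> single m 1"

section \<open>Linear extension from monomials, and derivations with prescribed values on the
  variables\<close>

lemma poly_mapping_expand:
  "p = (\<Sum>m\<in>keys p. single m (lookup p m))"
  by (rule poly_mapping_eqI)
     (auto simp: lookup_sum lookup_single when_def sum.delta' in_keys_iff)

lemma poly_mapping_induct_add [case_names zero single add]:
  fixes p :: "'a \<Rightarrow>\<^sub>0 'b::comm_monoid_add"
  assumes "P 0" and "\<And>m c. m \<in> keys p \<Longrightarrow> P (single m c)"
    and "\<And>p q. P p \<Longrightarrow> P q \<Longrightarrow> P (p + q)"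
  shows "P p"
proof -
  have "P (\<Sum>m\<in>A. single m (lookup p m))"
    if "finite A" "A \<subseteq> keys p" for A
    using that by (induction A) (use assms in auto)
  from this[of "keys p"] show ?thesis
    using poly_mapping_expand[of p] by simp
qed

text \<open>The scalar action is a parameter because the target is the polynomial ring for
  derivations and the operator ring \<open>lop\<close> for \<open>Phi\<close>.\<close>

definition linext :: "(complex \<Rightarrow> 'v \<Rightarrow> 'v) \<Rightarrow> ('a \<Rightarrow> 'v) \<Rightarrow> ('a \<Rightarrow>\<^sub>0 complex) \<Rightarrow> 'v::ab_group_add" where
  "linext s F p = (\<Sum>m\<in>keys p. s (lookup p m) (F m))"

lemma linext_superset:
  assumes "Modules.module s" "finite A" "keys p \<subseteq> A"
  shows "linext s F p = (\<Sum>m\<in>A. s (lookup p m) (F m))"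
  unfolding linext_def
  by (rule sum.mono_neutral_left) (use assms in \<open>auto simp: in_keys_iff Modules.module.scale_zero_left\<close>)

lemma linext_add:
  assumes "Modules.module s"
  shows "linext s F (p + q) = linext s F p + linext s F q"
proof -
  let ?A = "keys p \<union> keys q"
  note sup = linext_superset[OF assms, of ?A]
  show ?thesis
    using keys_add[of p q]
    by (simp add: sup lookup_add Modules.module.scale_left_distrib[OF assms] sum.distrib)
qed

lemma linext_zero [simp]: "linext s F 0 = 0"
  by (simp add: linext_def)

lemma linext_single:
  assumes "Modules.module s"
  shows "linext s F (single m c) = s c (F m)"
  using assms by (simp add: linext_def Modules.module.scale_zero_left)

lemma spconst_add: "spconst (a + b) = spconst a + spconst b"
  by (simp add: spconst_def single_add)

lemma spconst_mult: "spconst (a * b) = spconst a * spconst b"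
  by (simp add: spconst_def mult_single)

lemma spconst_0 [simp]: "spconst 0 = 0" and spconst_1 [simp]: "spconst 1 = 1"
  by (simp_all add: spconst_def)

lemma spconst_of_nat: "spconst (of_nat k) = of_nat k"
  by (simp add: spconst_def)

lemma module_spconst: "Modules.module (\<lambda>c p. spconst c * p)"
  by standard (auto simp: spconst_add spconst_mult algebra_simps)

lemma single_eq_spconst: "single m c = spconst c * mono m"
  by (simp add: spconst_def mult_single)

text \<open>The Leibniz formula on monomials: partial derivatives weighted by the values
  \<open>d v\<close>. The truncated subtraction is exact since \<open>v\<close> occurs in
  \<open>m\<close>.\<close>

definition deriv_on :: "((nat \<times> nat) \<Rightarrow> spoly) \<Rightarrow> spoly \<Rightarrow> spoly" where
  "deriv_on d = linext (\<lambda>c p. spconst c * p)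
     (\<lambda>m. \<Sum>v\<in>keys m.
        of_nat (lookup m v) * (mono (m - single v 1) * d v))"

lemma deriv_on_add: "deriv_on d (p + q) = deriv_on d p + deriv_on d q"
  unfolding deriv_on_def by (rule linext_add[OF module_spconst])

lemma deriv_on_0 [simp]: "deriv_on d 0 = 0"
  by (simp add: deriv_on_def)

lemma deriv_on_single: "deriv_on d (single m c) = spconst c *
   (\<Sum>v\<in>keys m. of_nat (lookup m v) * (mono (m - single v 1) * d v))"
  unfolding deriv_on_def by (rule linext_single[OF module_spconst])

lemma deriv_on_var: "deriv_on d (mono (single v 1)) = d v"
  by (simp add: deriv_on_single)

text \<open>The numerical factor makes truncated subtraction harmless: where the exponent of
  \<open>v\<close> in \<open>m\<close> is zero, both sides vanish.\<close>

lemma mono_minus_single_mult: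
  fixes m m' :: "(nat \<times> nat) \<Rightarrow>\<^sub>0 nat"
  shows "of_nat (lookup m v) * mono (m + m' - single v 1)
    = of_nat (lookup m v) * (mono (m - single v 1) * mono m')"
proof (cases "lookup m v = 0")
  case False
  then have "m + m' - single v 1 = m - single v 1 + m'"
    by (intro poly_mapping_eqI) (auto simp: lookup_add lookup_minus lookup_single when_def)
  then show ?thesis by (simp add: mult_single)
qed simp

lemma deriv_on_mult: "deriv_on d (p * q) = deriv_on d p * q + p * deriv_on d q"
proof (induction p rule: poly_mapping_induct_add)
  case (single m c)
  show ?case
  proof (induction q rule: poly_mapping_induct_add)
    case (single m' c')
    let ?F = "\<lambda>m v. of_nat (lookup m v) * (mono (m - single v 1) * d v)"
    \<comment> \<open>Summing over the variables of both monomials gives the three sums a common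
      index set, so the product rule can be checked termwise.\<close>
    have sup: "(\<Sum>v\<in>keys k. ?F k v)
        = (\<Sum>v\<in>keys m \<union> keys m'. ?F k v)"
      if "keys k \<subseteq> keys m \<union> keys m'" for k
      by (rule sum.mono_neutral_left) (use that in \<open>auto simp: in_keys_iff\<close>)
    have pt: "?F (m + m') v = ?F m v * mono m' + mono m * ?F m' v" for v
    proof -
      have "?F (m + m') v = (of_nat (lookup m v) * mono (m + m' - single v 1)) * d v
          + (of_nat (lookup m' v) * mono (m' + m - single v 1)) * d v"
        by (simp only: lookup_add of_nat_add add.commute[of m' m] distrib_right mult.assoc)
      also have "\<dots> = ?F m v * mono m' + mono m * ?F m' v"
        unfolding mono_minus_single_mult
        by (simp only: mult.assoc mult.commute mult.left_commute)
      finally show ?thesis .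
    qed
    have "(\<Sum>v\<in>keys (m + m'). ?F (m + m') v) =
      (\<Sum>v\<in>keys m. ?F m v) * mono m' + mono m * (\<Sum>v\<in>keys m'. ?F m' v)"
      unfolding sup[OF keys_add] sup[of m, OF Un_upper1] sup[of m', OF Un_upper2]
      by (simp only: pt sum.distrib sum_distrib_left sum_distrib_right)
    then show ?case
      unfolding mult_single deriv_on_single spconst_mult
      by (simp only: single_eq_spconst[of m c] single_eq_spconst[of m' c']
          distrib_left mult.assoc mult.commute mult.left_commute)
  qed (simp_all add: algebra_simps deriv_on_add)
qed (simp_all add: algebra_simps deriv_on_add)

lemma deriv_on_spconst [simp]: "deriv_on d (spconst c) = 0"
  by (simp add: spconst_def deriv_on_single)

lemma deriv_on_1 [simp]: "deriv_on d 1 = 0"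
  using deriv_on_spconst[of d 1] by simp

lemma deriv_on_spconst_mult: "deriv_on d (spconst c * p) = spconst c * deriv_on d p"
  by (simp add: deriv_on_mult)

lemma deriv_on_sum: "deriv_on d (sum f A) = (\<Sum>x\<in>A. deriv_on d (f x))"
  by (induction A rule: infinite_finite_induct) (simp_all add: deriv_on_add)

lemma deriv_on_power: "deriv_on d (p ^ Suc k) = of_nat (Suc k) * p ^ k * deriv_on d p"
  by (induction k) (simp_all add: deriv_on_mult algebra_simps)

text \<open>The derivation of \<open>S(S\<^sup>2W)\<close> induced by the matrix unit \<open>e\<^sub>j \<mapsto> e\<^sub>i\<close> of \<open>gl(W)\<close>.\<close>
definition gl_der :: "nat \<Rightarrow> nat \<Rightarrow> spoly \<Rightarrow> spoly" where
  "gl_der i j = deriv_on (\<lambda>(k,l). (if k = j then Lvar i l else 0) + (if l = j then Lvar k i else 0))"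

lemma Lvar_commute: "Lvar i j = Lvar j i"
  by (simp add: Lvar_def min.commute max.commute)

lemma Lvar_eq_mono: "Lvar i j = mono (single (min i j, max i j) 1)"
  by (simp add: Lvar_def)

text \<open>The formula is symmetric in \<open>k\<close> and \<open>l\<close>, so sorting the index
  pair does no harm. For \<open>k = l = j\<close> both summands occur, which produces the factor
  2.\<close>

lemma gl_der_Lvar:
  "gl_der i j (Lvar k l) = (if k = j then Lvar i l else 0) + (if l = j then Lvar k i else 0)"
  unfolding gl_der_def Lvar_eq_mono[of k l] deriv_on_var
  by (cases "k \<le> l") (simp_all add: min_def max_def add.commute Lvar_commute)

lemma gl_der_add: "gl_der i j (p + q) = gl_der i j p + gl_der i j q"
  and gl_der_mult: "gl_der i j (p * q) = gl_der i j p * q + p * gl_der i j q"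
  and gl_der_0 [simp]: "gl_der i j 0 = 0"
  and gl_der_1 [simp]: "gl_der i j 1 = 0"
  and gl_der_spconst [simp]: "gl_der i j (spconst c) = 0"
  and gl_der_spconst_mult: "gl_der i j (spconst c * p) = spconst c * gl_der i j p"
  and gl_der_sum: "gl_der i j (sum f A) = (\<Sum>x\<in>A. gl_der i j (f x))"
  and gl_der_power: "gl_der i j (p ^ Suc k) = of_nat (Suc k) * p ^ k * gl_der i j p"
  unfolding gl_der_def
  by (rule deriv_on_add deriv_on_mult deriv_on_0 deriv_on_1 deriv_on_spconst
      deriv_on_spconst_mult deriv_on_sum deriv_on_power)+

section \<open>The subring of polynomials in the variables L_ij with i, j < g\<close>

lemma sym_alg_0 [simp]: "0 \<in> sym_alg g"
  by (simp add: sym_alg_def)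

lemma sym_alg_add: "p \<in> sym_alg g \<Longrightarrow> q \<in> sym_alg g \<Longrightarrow> p + q \<in> sym_alg g"
  using keys_add[of p q] by (auto simp: sym_alg_def)

lemma sym_alg_sum: "(\<And>x. x \<in> A \<Longrightarrow> f x \<in> sym_alg g) \<Longrightarrow> sum f A \<in> sym_alg g"
  by (induction A rule: infinite_finite_induct) (auto intro: sym_alg_add)

lemma sym_alg_mult: "p \<in> sym_alg g \<Longrightarrow> q \<in> sym_alg g \<Longrightarrow> p * q \<in> sym_alg g"
  using keys_mult[of p q] unfolding sym_alg_def by clarsimp (blast dest: subsetD[OF keys_add])

lemma sym_alg_spconst [simp]: "spconst c \<in> sym_alg g"
  by (auto simp: sym_alg_def spconst_def)

lemma sym_alg_1 [simp]: "1 \<in> sym_alg g"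
  using sym_alg_spconst[of 1] by simp

lemma sym_alg_of_nat [simp]: "of_nat k \<in> sym_alg g"
  using sym_alg_spconst[of "of_nat k"] by (simp add: spconst_of_nat)

lemma sym_alg_power: "p \<in> sym_alg g \<Longrightarrow> p ^ k \<in> sym_alg g"
  by (induction k) (auto intro: sym_alg_mult)

lemma sym_alg_prod: "(\<And>x. x \<in> A \<Longrightarrow> f x \<in> sym_alg g) \<Longrightarrow> prod f A \<in> sym_alg g"
  by (induction A rule: infinite_finite_induct) (auto intro: sym_alg_mult)

lemma sym_alg_uminus: "p \<in> sym_alg g \<Longrightarrow> - p \<in> sym_alg g"
  using sym_alg_mult[OF sym_alg_spconst[of "-1"], of p g] by (simp add: spconst_def single_uminus)

lemma sym_alg_diff: "p \<in> sym_alg g \<Longrightarrow> q \<in> sym_alg g \<Longrightarrow> p - q \<in> sym_alg g"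
  using sym_alg_add[of p g "-q"] sym_alg_uminus[of q g] by simp

lemma Lvar_sym_alg [simp]: "i < g \<Longrightarrow> j < g \<Longrightarrow> Lvar i j \<in> sym_alg g"
  by (auto simp: sym_alg_def Lvar_def Lvars_def)

lemma finite_Lvars [simp]: "finite (Lvars g)"
  by (rule finite_subset[of _ "{..<g} \<times> {..<g}"]) (auto simp: Lvars_def)

lemma mono_sym_alg_iff: "mono m \<in> sym_alg g \<longleftrightarrow> keys m \<subseteq> Lvars g"
  by (simp add: sym_alg_def)

text \<open>Strips one variable at a time, with the total degree as measure.\<close>

lemma nat_poly_mapping_induct [consumes 1, case_names zero add]:
  fixes m :: "'a \<Rightarrow>\<^sub>0 nat"
  assumes "keys m \<subseteq> V" and "P 0"
    and "\<And>m v. v \<in> V \<Longrightarrow> keys m \<subseteq> V \<Longrightarrow> P m \<Longrightarrow> P (single v 1 + m)"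
  shows "P m"
  using assms(1)
proof (induction "\<Sum>v\<in>keys m. lookup m v" arbitrary: m rule: less_induct)
  case less
  show ?case
  proof (cases "m = 0")
    case False
    then obtain v where v: "v \<in> keys m"
      by (metis in_keys_iff lookup_zero poly_mapping_eqI)
    define m' where "m' = m - single v 1"
    have m: "m = single v 1 + m'"
      using v unfolding m'_def
      by (intro poly_mapping_eqI) (auto simp: lookup_add lookup_minus lookup_single when_def in_keys_iff)
    have sub: "keys m' \<subseteq> keys m"
      by (auto simp: m'_def in_keys_iff lookup_minus)
    have "(\<Sum>v\<in>keys m'. lookup m' v)
        = (\<Sum>v\<in>keys m. lookup m' v)"
      by (rule sum.mono_neutral_left) (use sub in \<open>auto simp: in_keys_iff\<close>)
    also have "\<dots> < (\<Sum>v\<in>keys m. lookup m v)"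
      by (rule sum_strict_mono_ex1)
        (use v in \<open>auto simp: m'_def lookup_minus lookup_single in_keys_iff intro!: bexI[of _ v]\<close>)
    finally have "P m'" using less sub by auto
    then show ?thesis using assms(3)[of v m'] less.prems v sub m by auto
  qed (use assms in auto)
qed

lemma sym_alg_mono_induct [consumes 1, case_names one var]:
  fixes m :: "(nat \<times> nat) \<Rightarrow>\<^sub>0 nat"
  assumes "keys m \<subseteq> Lvars g" and "P 0"
    and "\<And>k l m. k \<le> l \<Longrightarrow> l < g \<Longrightarrow> keys m \<subseteq> Lvars g \<Longrightarrow> P m \<Longrightarrow> P (single (k,l) 1 + m)"
  shows "P m"
  using assms(1) by (induction rule: nat_poly_mapping_induct) (use assms in \<open>auto simp: Lvars_def\<close>)

lemma mono_var_add: "k \<le> l \<Longrightarrow> mono (single (k,l) 1 + m) = Lvar k l * mono m"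
  by (simp add: Lvar_def mult_single min_absorb1 max_absorb2)

lemma sym_alg_induct [consumes 1, case_names const add var]:
  assumes "p \<in> sym_alg g" and "\<And>c. P (spconst c)"
    and add: "\<And>p q. p \<in> sym_alg g \<Longrightarrow> q \<in> sym_alg g \<Longrightarrow> P p \<Longrightarrow> P q \<Longrightarrow> P (p + q)"
    and var: "\<And>k l p. k < g \<Longrightarrow> l < g \<Longrightarrow> p \<in> sym_alg g \<Longrightarrow> P p \<Longrightarrow> P (Lvar k l * p)"
  shows "P p"
proof -
  have mon: "P (spconst c * mono m)" if "keys m \<subseteq> Lvars g" for m c
    using that
  proof (induction m rule: sym_alg_mono_induct)
    case (var k l m)
    then have "spconst c * mono m \<in> sym_alg g" by (auto intro: sym_alg_mult simp: mono_sym_alg_iff)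
    from assms(4)[OF _ _ this var(4)] var(1,2) show ?case
      by (simp add: mono_var_add mult.left_commute del: One_nat_def)
  qed (use assms(2)[of c] in simp)
  \<comment> \<open>Membership is carried along because the premise \<open>add\<close> asks for it
    on both summands.\<close>
  have "P p \<and> p \<in> sym_alg g"
  proof (induction p rule: poly_mapping_induct_add)
    case zero
    then show ?case using assms(2)[of 0] by simp
  next
    case (single m c)
    then have "keys m \<subseteq> Lvars g" using assms(1) by (auto simp: sym_alg_def)
    then show ?case using mon[of m c]
      by (auto simp: single_eq_spconst[of m c] mono_sym_alg_iff intro: sym_alg_mult)
  next
    case (add p q)
    then show ?case using assms(3)
      by (auto intro: sym_alg_add)
  qed
  then show ?thesis ..
qed

lemma gl_der_sym_alg:
  assumes "p \<in> sym_alg g" "i < g"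
  shows "gl_der i j p \<in> sym_alg g"
  using assms(1)
  by (induction rule: sym_alg_induct)
    (use assms(2) in \<open>auto simp: gl_der_add gl_der_mult gl_der_Lvar intro!: sym_alg_add sym_alg_mult\<close>)

text \<open>A commutator of derivations is a derivation, so the two sides need only be compared on
  the variables.\<close>

lemma gl_der_commutator:
  assumes "p \<in> sym_alg g"
  shows "gl_der i j (gl_der j i p) = gl_der j i (gl_der i j p) + gl_der i i p - gl_der j j p"
  using assms
proof (induction rule: sym_alg_induct)
  case (var k l p)
  have "gl_der i j (gl_der j i (Lvar k l)) = gl_der j i (gl_der i j (Lvar k l)) + gl_der i i (Lvar k l) - gl_der j j (Lvar k l)"
    by (auto simp: gl_der_Lvar gl_der_add Lvar_commute)
  then show ?case
    by (simp only: gl_der_mult gl_der_add var.IH ring_distribs) (simp add: algebra_simps)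
qed (simp_all add: gl_der_add)

section \<open>Operators on the exterior algebra\<close>

definition fin_part :: "ext \<Rightarrow> ext" where
  "fin_part f = (\<lambda>U. if finite U then f U else 0)"

lemma fin_part_0: "fin_part 0 = 0"
  and fin_part_add: "fin_part (f + h) = fin_part f + fin_part h"
  and fin_part_diff: "fin_part (f - h) = fin_part f - fin_part h"
  and fin_part_uminus: "fin_part (- f) = - fin_part f"
  and fin_part_scale: "fin_part (ext_scale k f) = ext_scale k (fin_part f)"
  and fin_part_fin_part: "fin_part (fin_part f) = fin_part f"
  by (auto simp: fin_part_def fun_eq_iff ext_scale_def)

lemma ext_scale_right_distrib: "ext_scale k (f + h) = ext_scale k f + ext_scale k h"
  and ext_scale_right_diff_distrib: "ext_scale k (f - h) = ext_scale k f - ext_scale k h"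
  and ext_scale_uminus: "ext_scale k (- f) = - ext_scale k f"
  and ext_scale_left_commute: "ext_scale k (ext_scale l f) = ext_scale l (ext_scale k f)"
  and ext_scale_0_right: "ext_scale k 0 = 0"
  by (auto simp: fun_eq_iff ext_scale_def algebra_simps)

lemmas fin_part_simps = fin_part_0 fin_part_add fin_part_diff fin_part_uminus fin_part_scale
  fin_part_fin_part ext_scale_right_distrib ext_scale_right_diff_distrib ext_scale_uminus
  ext_scale_0_right

text \<open>Linear operators on the functions supported on finite sets; the unit of this ring is the
  projection onto those functions. Dropping the values at infinite sets, where signs would be junk,
  makes the anticommutation relations below hold for all indices.\<close>
typedef lop = "{F :: ext \<Rightarrow> ext. (\<forall>f h. F (f + h) = F f + F h) \<and>
    (\<forall>k f. F (ext_scale k f) = ext_scale k (F f)) \<and>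
    (\<forall>f. F (fin_part f) = F f) \<and> (\<forall>f. fin_part (F f) = F f)}"
  morphisms app Abs_lop
  by (rule exI[of _ "\<lambda>f. 0"]) (auto simp: ext_scale_def fin_part_def)

setup_lifting type_definition_lop

lemma app_add_right: "app F (f + h) = app F f + app F h"
  and app_scale_right: "app F (ext_scale k f) = ext_scale k (app F f)"
  and fin_part_app [simp]: "fin_part (app F f) = app F f"
  using app[of F] by auto

instantiation lop :: ring_1
begin

lift_definition zero_lop :: lop is "\<lambda>f. 0"
  by (simp add: fin_part_simps)
lift_definition one_lop :: lop is fin_part
  by (simp add: fin_part_simps)
lift_definition plus_lop :: "lop \<Rightarrow> lop \<Rightarrow> lop" is "\<lambda>F G f. F f + G f"
  by (simp add: fin_part_simps algebra_simps)
lift_definition minus_lop :: "lop \<Rightarrow> lop \<Rightarrow> lop" is "\<lambda>F G f. F f - G f"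
  by (simp add: fin_part_simps algebra_simps)
lift_definition uminus_lop :: "lop \<Rightarrow> lop" is "\<lambda>F f. - F f"
  by (simp add: fin_part_simps algebra_simps)
lift_definition times_lop :: "lop \<Rightarrow> lop \<Rightarrow> lop" is "\<lambda>F G f. F (G f)"
  by auto

instance
proof
  show "(0::lop) \<noteq> 1"
  proof
    assume "(0::lop) = 1"
    then have "(\<lambda>f. 0) = fin_part" by transfer
    then have "fin_part (\<lambda>_. 1) {} = 0" by (metis zero_fun_apply)
    then show False by (simp add: fin_part_def)
  qed
qed (transfer; auto simp: fun_eq_iff)+

end

lemma app_0 [simp]: "app 0 f = 0"
  by transfer simp

lemma app_1: "app 1 f = fin_part f"
  by transfer simp

lemma app_add: "app (F + G) f = app F f + app G f"
  by transfer simp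

lemma app_diff: "app (F - G) f = app F f - app G f"
  by transfer simp

lemma app_uminus: "app (- F) f = - app F f"
  by transfer simp

lemma app_mult: "app (F * G) f = app F (app G f)"
  by transfer simp

lemma app_sum: "app (sum F A) f = (\<Sum>x\<in>A. app (F x) f)"
  by (induction A rule: infinite_finite_induct) (simp_all add: app_add)

lemma app_0_right [simp]: "app F 0 = 0"
  using app_add_right[of F 0 0] by simp

lemma app_sum_right: "app F (sum f A) = (\<Sum>x\<in>A. app F (f x))" for f :: "'a \<Rightarrow> ext"
proof (induction A rule: infinite_finite_induct)
  case (insert x A)
  then show ?case by (metis (no_types, lifting) app_add_right sum.insert)
qed (metis app_0_right sum.infinite sum.empty)+

lemma lop_eqI: "(\<And>f. app F f = app G f) \<Longrightarrow> F = G"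
  by (simp add: app_inject[symmetric] fun_eq_iff)

lift_definition lscale :: "complex \<Rightarrow> lop \<Rightarrow> lop" (infixr \<open>*\<^sub>L\<close> 75) is "\<lambda>k F f. ext_scale k (F f)"
  by (simp add: fin_part_simps ext_scale_left_commute)

lemma app_lscale: "app (k *\<^sub>L F) f = ext_scale k (app F f)"
  by transfer simp

lemma module_lscale: "Modules.module lscale"
  by standard (transfer; simp add: ext_scale_def fun_eq_iff algebra_simps)+

interpretation lscale: Modules.module lscale
  by (rule module_lscale)

lemma lscale_mult_left [simp]: "(k *\<^sub>L F) * G = k *\<^sub>L (F * G)"
  by transfer (simp add: fun_eq_iff)

lemma lscale_mult_right [simp]: "F * (k *\<^sub>L G) = k *\<^sub>L (F * G)"
  by transfer (simp add: fun_eq_iff)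

lemma sum_ext_apply: "(sum f A) U = (\<Sum>x\<in>A. f x U)" for f :: "'a \<Rightarrow> ext"
  by (induction A rule: infinite_finite_induct) simp_all

lemma ext_scale_apply: "ext_scale k f U = k * f U"
  by (simp add: ext_scale_def)

lemma ext_scale_simps [simp]: "ext_scale 0 f = 0" "ext_scale 1 f = f" "ext_scale k 0 = 0"
  by (simp_all add: ext_scale_def fun_eq_iff)

section \<open>Creation and annihilation operators\<close>

text \<open>The sign of moving e_x from the front to its place in the increasing order. Only smaller
  elements count, so it is the same whether or not \<open>x\<close> lies in
  \<open>U\<close>.\<close>

definition sgn_at :: "nat \<times> nat \<Rightarrow> (nat \<times> nat) set \<Rightarrow> complex" where
  "sgn_at x U = (-1) ^ card {y \<in> U. y < x}"

lemma sgn_at_insert: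
  assumes "finite U" "x \<notin> U"
  shows "sgn_at y (insert x U) = (if x < y then - sgn_at y U else sgn_at y U)"
proof -
  have "{z \<in> insert x U. z < y} = (if x < y then insert x {z \<in> U. z < y} else {z \<in> U. z < y})"
    by auto
  then show ?thesis using assms by (simp add: sgn_at_def)
qed

lemma sgn_at_remove:
  assumes "finite U" "x \<in> U"
  shows "sgn_at y (U - {x}) = (if x < y then - sgn_at y U else sgn_at y U)"
  using sgn_at_insert[of "U - {x}" x y] assms by (auto simp: insert_absorb split: if_splits)

lemma sgn_at_sq [simp]: "sgn_at x U * sgn_at x U = 1" "sgn_at x U * (sgn_at x U * z) = z"
  by (simp_all add: sgn_at_def flip: mult.assoc power_add)

text \<open>Left wedge multiplication by the basis vector \<open>x\<close>, written on coefficients: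
  the coefficient at \<open>U\<close> comes from \<open>U - {x}\<close>.\<close>

lift_definition cre :: "nat \<times> nat \<Rightarrow> lop" is
  "\<lambda>x f U. if finite U \<and> x \<in> U then sgn_at x U * f (U - {x}) else 0"
  by (auto simp: fin_part_def ext_scale_def fun_eq_iff algebra_simps)

text \<open>Contraction with the dual basis vector of \<open>x\<close>, the transpose of
  \<open>cre x\<close>.\<close>

lift_definition ann :: "nat \<times> nat \<Rightarrow> lop" is
  "\<lambda>x f U. if finite U \<and> x \<notin> U then sgn_at x U * f (insert x U) else 0"
  by (auto simp: fin_part_def ext_scale_def fun_eq_iff algebra_simps)

lemma app_cre: "app (cre x) f U = (if finite U \<and> x \<in> U then sgn_at x U * f (U - {x}) else 0)"
  by transfer simp

lemma app_ann: "app (ann x) f U = (if finite U \<and> x \<notin> U then sgn_at x U * f (insert x U) else 0)"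
  by transfer simp

lemma lop_eqI2: "(\<And>f U. finite U \<Longrightarrow> app F f U = app G f U) \<Longrightarrow> F = G"
proof (rule lop_eqI, rule ext)
  fix f U
  assume "\<And>f U. finite U \<Longrightarrow> app F f U = app G f U"
  then show "app F f U = app G f U"
    by (metis fin_part_app fin_part_def)
qed

lemma cre_cre: "cre x * cre y = - (cre y * cre x)"
proof (rule lop_eqI2)
  fix f U assume "finite (U :: (nat \<times> nat) set)"
  then show "app (cre x * cre y) f U = app (- (cre y * cre x)) f U"
    by (cases x y rule: linorder_cases)
      (auto simp: app_mult app_uminus app_cre sgn_at_remove Diff_insert2[symmetric] insert_commute)
qed

lemma ann_ann: "ann x * ann y = - (ann y * ann x)"
proof (rule lop_eqI2)
  fix f U assume "finite (U :: (nat \<times> nat) set)"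
  then show "app (ann x * ann y) f U = app (- (ann y * ann x)) f U"
    by (cases x y rule: linorder_cases)
      (auto simp: app_mult app_uminus app_ann sgn_at_insert insert_commute)
qed

text \<open>For \<open>x = y\<close>, at each finite \<open>U\<close> exactly one of the two orders
  contributes, and it returns the coefficient unchanged. For \<open>x \<noteq> y\<close> the larger
  index counts the smaller one in exactly one of the two orders, whence the minus sign.\<close>

lemma ann_cre: "ann x * cre y = (if x = y then 1 else 0) - cre y * ann x"
proof (rule lop_eqI2)
  fix f U assume U: "finite (U :: (nat \<times> nat) set)"
  show "app (ann x * cre y) f U = app ((if x = y then 1 else 0) - cre y * ann x) f U"
  proof (cases "x = y")
    case True
    have "app (ann x * cre x) f U = app (1 - cre x * ann x) f U"
    proof (cases "x \<in> U")
      case True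
      with U show ?thesis
        by (simp add: app_mult app_diff app_1 fin_part_def app_ann app_cre sgn_at_remove insert_absorb)
    next
      case False
      with U show ?thesis
        by (simp add: app_mult app_diff app_1 fin_part_def app_ann app_cre sgn_at_insert)
    qed
    with True show ?thesis by simp
  next
    case False
    then have eq: "insert x U - {y} = insert x (U - {y})" by auto
    show ?thesis
    proof (cases "x \<notin> U \<and> y \<in> U")
      case True
      with False U show ?thesis
        by (cases x y rule: linorder_cases)
           (auto simp: app_mult app_diff app_uminus app_ann app_cre sgn_at_remove sgn_at_insert eq dest: less_asym)
    next
      case nin: False
      with False U show ?thesis by (auto simp: app_mult app_diff app_uminus app_ann app_cre)
    qed
  qed
qed

lemma cre_sq [simp]: "cre x * cre x = 0"
  by (rule lop_eqI2) (auto simp: app_mult app_cre)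

definition vac :: ext where "vac = ext_const 1"

lemma ann_vac [simp]: "app (ann x) vac = 0"
  by (auto simp: fun_eq_iff app_ann vac_def ext_const_def)

lemma fin_part_vac [simp]: "fin_part vac = vac"
  by (auto simp: fun_eq_iff vac_def ext_const_def fin_part_def)

text \<open>\<open>cre x * ann y\<close> is a matrix unit of gl(V \<otimes> W): although its factors
  anticommute with generators, the product acts on them by an ordinary commutator.\<close>

lemma cre_ann_cre: "(cre x * ann y) * cre z = cre z * (cre x * ann y) + (if y = z then cre x else 0)"
proof -
  have "(cre x * ann y) * cre z = cre x * (ann y * cre z)" by (simp add: mult.assoc)
  also have "\<dots> = (if y = z then cre x else 0) - cre x * cre z * ann y"
    by (simp add: ann_cre algebra_simps)
  finally show ?thesis by (simp add: cre_cre[of x z] mult.assoc)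
qed

lemma cre_ann_ann: "(cre x * ann y) * ann z = ann z * (cre x * ann y) - (if x = z then ann y else 0)"
proof -
  have "ann z * (cre x * ann y) = (if x = z then ann y else 0) - cre x * (ann z * ann y)"
    by (simp add: ann_cre algebra_simps flip: mult.assoc)
  then show ?thesis by (simp add: ann_ann[of z y] mult.assoc)
qed

section \<open>Casimir operators\<close>

lemmas lscale_simps = lscale.scale_left_distrib lscale.scale_right_distrib
  lscale.scale_left_diff_distrib lscale.scale_right_diff_distrib lscale.scale_sum_right

definition gl_op :: "nat \<Rightarrow> nat \<Rightarrow> nat \<Rightarrow> lop" where
  "gl_op n i j = (\<Sum>a<2*n. cre (a,i) * ann (a,j))"

text \<open>The matrix unit of gl(V) sending e_a to e_b, the counterpart of \<open>gl_op\<close> on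
  the other tensor factor.\<close>

definition glV_op :: "nat \<Rightarrow> nat \<Rightarrow> nat \<Rightarrow> lop" where
  "glV_op g b a = (\<Sum>i<g. cre (b,i) * ann (a,i))"

lemma sum_swap_pairs:
  "(\<Sum>i\<in>I. \<Sum>j\<in>K. \<Sum>b\<in>B. \<Sum>a\<in>A. f i j b a) = (\<Sum>b\<in>B. \<Sum>a\<in>A. \<Sum>i\<in>I. \<Sum>j\<in>K. f i j b a)"
  by (simp only: sum.swap[where A = K and B = B] sum.swap[where A = K and B = A]
      sum.swap[where A = I and B = B] sum.swap[where A = I and B = A])

text \<open>Taking the commutator with \<open>F\<close> is a derivation.\<close>

lemma derivation_mult:
  fixes F :: "'a::ring"
  assumes "F * x = x * F + x'" "F * y = y * F + y'"
  shows "F * (x * y) = (x * y) * F + (x' * y + x * y')"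
proof -
  have "F * (x * y) = (F * x) * y" by (simp add: mult.assoc)
  also have "\<dots> = x * (F * y) + x' * y" by (simp add: assms(1) algebra_simps)
  finally show ?thesis by (simp add: assms(2) algebra_simps)
qed

lemma gl_op_cre:
  assumes "a < 2*n"
  shows "gl_op n i j * cre (a,k) = cre (a,k) * gl_op n i j + (if j = k then cre (a,i) else 0)"
proof -
  have "gl_op n i j * cre (a,k) = cre (a,k) * gl_op n i j + (\<Sum>b<2*n. if b = a then (if j = k then cre (a,i) else 0) else 0)"
    unfolding gl_op_def sum_distrib_left sum_distrib_right sum.distrib[symmetric]
    by (intro sum.cong) (auto simp: cre_ann_cre)
  then show ?thesis using assms by simp
qed

lemma gl_op_ann:
  assumes "a < 2*n"
  shows "gl_op n i j * ann (a,k) = ann (a,k) * gl_op n i j + (if i = k then - ann (a,j) else 0)"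
proof -
  have "gl_op n i j * ann (a,k) = ann (a,k) * gl_op n i j + (\<Sum>b<2*n. if b = a then (if i = k then - ann (a,j) else 0) else 0)"
    unfolding gl_op_def sum_distrib_left sum_distrib_right sum.distrib[symmetric]
    by (intro sum.cong) (auto simp: cre_ann_ann)
  then show ?thesis using assms by simp
qed

lemma glV_op_ann:
  assumes "i < g"
  shows "glV_op g b a * ann (x,i) = ann (x,i) * glV_op g b a + (if b = x then - ann (a,i) else 0)"
proof -
  have "glV_op g b a * ann (x,i) = ann (x,i) * glV_op g b a + (\<Sum>k<g. if k = i then (if b = x then - ann (a,i) else 0) else 0)"
    unfolding glV_op_def sum_distrib_left sum_distrib_right sum.distrib[symmetric]
    by (intro sum.cong) (auto simp: cre_ann_ann)
  then show ?thesis using assms by simp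
qed

lemma gl_op_commutator: "gl_op n i j * gl_op n j i = gl_op n j i * gl_op n i j + gl_op n i i - gl_op n j j"
proof -
  have "gl_op n i j * (cre (a,j) * ann (a,i)) = (cre (a,j) * ann (a,i)) * gl_op n i j
      + cre (a,i) * ann (a,i) - cre (a,j) * ann (a,j)" if "a < 2*n" for a
    by (subst derivation_mult[OF gl_op_cre[OF that] gl_op_ann[OF that]]) simp
  then have "(\<Sum>a<2*n. gl_op n i j * (cre (a,j) * ann (a,i))) = (\<Sum>a<2*n. (cre (a,j) * ann (a,i)) * gl_op n i j
      + cre (a,i) * ann (a,i) - cre (a,j) * ann (a,j))"
    by (intro sum.cong) auto
  then show ?thesis
    unfolding gl_op_def[of n j i] gl_op_def[of n i i] gl_op_def[of n j j]
    by (simp only: sum_distrib_left sum_distrib_right sum.distrib sum_subtractf)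
qed

text \<open>gl(V) and gl(W) act on different tensor factors. The commutator picks up the same
  operator at \<open>k = j\<close> and, with opposite sign, at \<open>k = i\<close>; both indices
  lie in the range of summation.\<close>

lemma gl_op_glV_op_commute:
  assumes "i < g" "j < g" "a < 2*n" "b < 2*n"
  shows "gl_op n i j * glV_op g b a = glV_op g b a * gl_op n i j"
proof -
  have "gl_op n i j * (cre (b,k) * ann (a,k)) = (cre (b,k) * ann (a,k)) * gl_op n i j
      + ((if k = j then cre (b,i) * ann (a,j) else 0) - (if k = i then cre (b,i) * ann (a,j) else 0))" for k
    by (subst derivation_mult[OF gl_op_cre[OF assms(4)] gl_op_ann[OF assms(3)]]) auto
  then have "gl_op n i j * glV_op g b a = glV_op g b a * gl_op n i j +
     ((\<Sum>k<g. if k = j then cre (b,i) * ann (a,j) else 0) - (\<Sum>k<g. if k = i then cre (b,i) * ann (a,j) else 0))"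
    unfolding glV_op_def by (simp only: sum_distrib_left sum_distrib_right sum.distrib sum_subtractf)
  then show ?thesis using assms by simp
qed

text \<open>Both Casimir operators have the same quartic part up to sign.\<close>
lemma casimir_duality:
  "(\<Sum>b<2*n. \<Sum>a<2*n. glV_op g b a * glV_op g a b) + (\<Sum>i<g. \<Sum>j<g. gl_op n j i * gl_op n i j)
    = of_nat (2*n + g) * (\<Sum>i<g. gl_op n i i)"
proof -
  let ?X = "\<lambda>b a i j. (cre (b,i) * ann (a,i)) * (cre (a,j) * ann (b,j))"
  let ?Y = "\<lambda>b a i j. (cre (a,j) * ann (a,i)) * (cre (b,i) * ann (b,j))"
  have key: "?X b a i j + ?Y b a i j =
     (if i = j then cre (b,i) * ann (b,i) else 0) + (if a = b then cre (a,j) * ann (a,j) else 0)" for a b i j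
  proof -
    have X: "?X b a i j = (if i = j then cre (b,i) * ann (b,i) else 0)
        - cre (b,i) * cre (a,j) * ann (a,i) * ann (b,j)"
    proof -
      have "?X b a i j = cre (b,i) * (ann (a,i) * cre (a,j)) * ann (b,j)" by (simp add: mult.assoc)
      then show ?thesis by (simp add: ann_cre algebra_simps)
    qed
    have Y: "?Y b a i j = (if a = b then cre (a,j) * ann (a,j) else 0)
        - cre (a,j) * cre (b,i) * ann (a,i) * ann (b,j)"
    proof -
      have "?Y b a i j = cre (a,j) * (ann (a,i) * cre (b,i)) * ann (b,j)" by (simp add: mult.assoc)
      then show ?thesis by (simp add: ann_cre algebra_simps)
    qed
    show ?thesis unfolding X Y using cre_cre[of "(a,j)" "(b,i)"] by simp
  qed
  have "(\<Sum>b<2*n. \<Sum>a<2*n. glV_op g b a * glV_op g a b)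
      = (\<Sum>b<2*n. \<Sum>a<2*n. \<Sum>i<g. \<Sum>j<g. ?X b a i j)"
    by (simp only: glV_op_def sum_product)
  moreover have "(\<Sum>i<g. \<Sum>j<g. gl_op n j i * gl_op n i j)
      = (\<Sum>b<2*n. \<Sum>a<2*n. \<Sum>i<g. \<Sum>j<g. ?Y b a i j)"
  proof -
    have "(\<Sum>i<g. \<Sum>j<g. gl_op n j i * gl_op n i j) = (\<Sum>i<g. \<Sum>j<g. \<Sum>a<2*n. \<Sum>b<2*n. ?Y b a i j)"
      by (simp only: gl_op_def sum_product)
    also have "\<dots> = (\<Sum>a<2*n. \<Sum>b<2*n. \<Sum>i<g. \<Sum>j<g. ?Y b a i j)"
      by (rule sum_swap_pairs)
    also have "\<dots> = (\<Sum>b<2*n. \<Sum>a<2*n. \<Sum>i<g. \<Sum>j<g. ?Y b a i j)"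
      by (rule sum.swap)
    finally show ?thesis .
  qed
  ultimately have "(\<Sum>b<2*n. \<Sum>a<2*n. glV_op g b a * glV_op g a b) + (\<Sum>i<g. \<Sum>j<g. gl_op n j i * gl_op n i j)
    = (\<Sum>b<2*n. \<Sum>a<2*n. \<Sum>i<g. \<Sum>j<g. ?X b a i j + ?Y b a i j)"
    by (simp only: sum.distrib)
  also have "\<dots> = (\<Sum>b<2*n. \<Sum>a<2*n. \<Sum>i<g. \<Sum>j<g. if i = j then cre (b,i) * ann (b,i) else 0)
     + (\<Sum>b<2*n. \<Sum>a<2*n. \<Sum>i<g. \<Sum>j<g. if a = b then cre (a,j) * ann (a,j) else 0)"
    by (simp only: key sum.distrib)
  also have "(\<Sum>b<2*n. \<Sum>a<2*n. \<Sum>i<g. \<Sum>j<g. if i = j then cre (b,i) * ann (b,i) else 0)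
      = of_nat (2*n) * (\<Sum>i<g. gl_op n i i)"
  proof -
    have "(\<Sum>i<g. \<Sum>j<g. if i = j then cre (b,i) * ann (b,i) else 0) = (\<Sum>i<g. cre (b,i) * ann (b,i))" for b
      by (intro sum.cong) auto
    moreover have "(\<Sum>i<g. gl_op n i i) = (\<Sum>b<2*n. \<Sum>i<g. cre (b,i) * ann (b,i))"
      unfolding gl_op_def by (rule sum.swap)
    ultimately show ?thesis by (simp add: sum_distrib_left)
  qed
  also have "(\<Sum>b<2*n. \<Sum>a<2*n. \<Sum>i<g. \<Sum>j<g. if a = b then cre (a,j) * ann (a,j) else 0)
      = of_nat g * (\<Sum>i<g. gl_op n i i)"
  proof -
    have "(\<Sum>a<2*n. \<Sum>i<g. \<Sum>j<g. if a = b then cre (a,j) * ann (a,j) else 0) = of_nat g * (\<Sum>j<g. cre (b,j) * ann (b,j))"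
      if "b < 2*n" for b
    proof -
      have "(\<Sum>a<2*n. \<Sum>i<g. \<Sum>j<g. if a = b then cre (a,j) * ann (a,j) else 0)
        = (\<Sum>a<2*n. if a = b then \<Sum>i<g. \<Sum>j<g. cre (b,j) * ann (b,j) else 0)"
        by (intro sum.cong) auto
      then show ?thesis using that by simp
    qed
    moreover have "(\<Sum>i<g. gl_op n i i) = (\<Sum>b<2*n. \<Sum>i<g. cre (b,i) * ann (b,i))"
      unfolding gl_op_def by (rule sum.swap)
    ultimately show ?thesis by (simp add: sum_distrib_left)
  qed
  finally show ?thesis by (simp add: algebra_simps)
qed

section \<open>The symplectic form, the dual Lie algebra sp(2g) and the Casimir identity\<close>

locale sp_form =
  fixes n g :: nat and Om J :: "nat \<Rightarrow> nat \<Rightarrow> complex"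
  assumes Om_skew: "a < 2*n \<Longrightarrow> b < 2*n \<Longrightarrow> Om a b = - Om b a"
    and J_skew: "a < 2*n \<Longrightarrow> b < 2*n \<Longrightarrow> J a b = - J b a"
    and J_Om: "a < 2*n \<Longrightarrow> c < 2*n \<Longrightarrow> (\<Sum>b<2*n. J a b * Om b c) = (if a = c then 1 else 0)"
    and Om_J: "a < 2*n \<Longrightarrow> c < 2*n \<Longrightarrow> (\<Sum>b<2*n. Om a b * J b c) = (if a = c then 1 else 0)"
begin

text \<open>\<open>om i j\<close> multiplies by the invariant \<open>\<Sum> J a b \<cdot> (e\<^sub>a \<otimes> f\<^sub>i) \<and> (e\<^sub>b \<otimes> f\<^sub>j)\<close>, the image of \<open>L\<^sub>i\<^sub>j\<close>; \<open>dl i j\<close> is the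
  dual contraction. The operators \<open>sp_op b c\<close> span the Lie algebra of the symplectic group.\<close>
definition up :: "nat \<Rightarrow> nat \<Rightarrow> lop" where
  "up i a = (\<Sum>b<2*n. J a b *\<^sub>L cre (b,i))"

definition low :: "nat \<Rightarrow> nat \<Rightarrow> lop" where
  "low i a = (\<Sum>b<2*n. Om a b *\<^sub>L ann (b,i))"

definition om :: "nat \<Rightarrow> nat \<Rightarrow> lop" where
  "om i j = (\<Sum>a<2*n. cre (a,i) * up j a)"

definition dl :: "nat \<Rightarrow> nat \<Rightarrow> lop" where
  "dl i j = (\<Sum>a<2*n. ann (a,i) * low j a)"

text \<open>The operator of the endomorphism u \<mapsto> Om(e_c, u) e_b. In this way
  \<open>Om\<close> identifies gl(V) with V \<otimes> V, and sp(V) becomes the space of symmetric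
  tensors; hence the symmetrization in \<open>sp_op\<close>.\<close>

definition lowE :: "nat \<Rightarrow> nat \<Rightarrow> lop" where
  "lowE b c = (\<Sum>a<2*n. Om c a *\<^sub>L glV_op g b a)"

definition sp_op :: "nat \<Rightarrow> nat \<Rightarrow> lop" where
  "sp_op b c = lowE b c + lowE c b"

lemma contract:
  assumes "a < 2*n" and "\<And>c. c < 2*n \<Longrightarrow> (\<Sum>b<2*n. A a b * B b c) = (if a = c then 1 else 0)"
  shows "(\<Sum>b<2*n. A a b *\<^sub>L (\<Sum>c<2*n. B b c *\<^sub>L F c)) = F a"
proof -
  have "(\<Sum>b<2*n. A a b *\<^sub>L (\<Sum>c<2*n. B b c *\<^sub>L F c)) = (\<Sum>c<2*n. \<Sum>b<2*n. (A a b * B b c) *\<^sub>L F c)"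
    by (simp add: lscale.scale_sum_right) (rule sum.swap)
  also have "\<dots> = (\<Sum>c<2*n. if c = a then F a else 0)"
    by (intro sum.cong) (auto simp: assms lscale.scale_sum_left[symmetric])
  finally show ?thesis using assms(1) by simp
qed

lemma up_commute: "up i a * cre x = - (cre x * up i a)"
  unfolding up_def by (simp add: sum_distrib_left sum_distrib_right cre_cre[of _ x] sum_negf)

lemma up_ann: "a < 2*n \<Longrightarrow> up j b * ann (a,i) = (if i = j then J b a *\<^sub>L 1 else 0) - ann (a,i) * up j b"
proof -
  assume a: "a < 2*n"
  have "ann (a,i) * up j b = (\<Sum>d<2*n. J b d *\<^sub>L (if (a,i) = (d,j) then 1 else 0)) - up j b * ann (a,i)"
    unfolding up_def by (simp add: sum_distrib_left sum_distrib_right ann_cre lscale_simps sum_subtractf)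
  also have "(\<Sum>d<2*n. J b d *\<^sub>L (if (a,i) = (d,j) then 1 else 0)) = (\<Sum>d<2*n. if d = a then (if i = j then J b a *\<^sub>L 1 else 0) else 0)"
    by (intro sum.cong) auto
  also have "\<dots> = (if i = j then J b a *\<^sub>L 1 else 0)" using a by simp
  finally show ?thesis by simp
qed

lemma ann_up: "a < 2*n \<Longrightarrow> ann (a,i) * up j b = (if i = j then J b a *\<^sub>L 1 else 0) - up j b * ann (a,i)"
  using up_ann[of a j b i] by simp

lemma sum_J_low: "a < 2*n \<Longrightarrow> (\<Sum>b<2*n. J a b *\<^sub>L low j b) = ann (a,j)"
  unfolding low_def by (rule contract) (auto simp: J_Om)

lemma sum_Om_up: "a < 2*n \<Longrightarrow> (\<Sum>b<2*n. Om a b *\<^sub>L up j b) = cre (a,j)"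
  unfolding up_def by (rule contract) (auto simp: Om_J)

lemma sum_J_lowE: "b < 2*n \<Longrightarrow> (\<Sum>d<2*n. J b d *\<^sub>L lowE a d) = glV_op g a b"
  unfolding lowE_def by (rule contract) (auto simp: J_Om)

text \<open>The skewness of \<open>J\<close> cancels the sign from exchanging two creation
  operators; this matches L_ij = L_ji.\<close>

lemma om_commute_sym: "om i j = om j i"
proof -
  have "om i j = (\<Sum>a<2*n. \<Sum>b<2*n. J a b *\<^sub>L (cre (a,i) * cre (b,j)))"
    by (simp add: om_def up_def sum_distrib_left)
  also have "\<dots> = (\<Sum>b<2*n. \<Sum>a<2*n. J a b *\<^sub>L (cre (a,i) * cre (b,j)))"
    by (rule sum.swap)
  also have "\<dots> = (\<Sum>b<2*n. \<Sum>a<2*n. J b a *\<^sub>L (cre (b,j) * cre (a,i)))"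
    by (intro sum.cong refl) (subst J_skew, auto simp: cre_cre[of "(_,i)"])
  also have "\<dots> = om j i"
    by (simp add: om_def up_def sum_distrib_left)
  finally show ?thesis .
qed

lemma om_cre: "om i j * cre x = cre x * om i j"
  unfolding om_def sum_distrib_left sum_distrib_right
proof (rule sum.cong)
  fix a
  have "cre (a,i) * up j a * cre x = cre (a,i) * (up j a * cre x)" by (simp add: mult.assoc)
  also have "\<dots> = - (cre (a,i) * cre x) * up j a" by (simp add: up_commute mult.assoc)
  also have "\<dots> = cre x * (cre (a,i) * up j a)" by (subst cre_cre) (simp add: mult.assoc)
  finally show "cre (a,i) * up j a * cre x = cre x * (cre (a,i) * up j a)" .
qed simp

lemma om_up: "om i j * up k a = up k a * om i j"
  unfolding up_def by (simp add: sum_distrib_left sum_distrib_right om_cre)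

text \<open>Elements of even degree commute. This is what allows a commutative polynomial ring to
  act through the \<open>om i j\<close>.\<close>

lemma om_om: "om i j * om k l = om k l * om i j"
  unfolding om_def[of k l] sum_distrib_left sum_distrib_right
  by (intro sum.cong refl) (metis mult.assoc om_cre om_up)

lemma gl_op_up:
  assumes "a < 2*n"
  shows "gl_op n i j * up k a = up k a * gl_op n i j + (if j = k then up i a else 0)"
proof -
  have "gl_op n i j * up k a = (\<Sum>b<2*n. J a b *\<^sub>L (gl_op n i j * cre (b,k)))"
    by (simp add: up_def sum_distrib_left)
  also have "\<dots> = (\<Sum>b<2*n. J a b *\<^sub>L (cre (b,k) * gl_op n i j + (if j = k then cre (b,i) else 0)))"
    by (intro sum.cong) (auto simp: gl_op_cre)
  also have "\<dots> = up k a * gl_op n i j + (if j = k then up i a else 0)"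
    by (simp add: up_def sum_distrib_right sum.distrib lscale_simps)
  finally show ?thesis .
qed

text \<open>The correction term has the shape of \<open>gl_der_Lvar\<close>, so \<open>gl_op\<close>
  and \<open>gl_der\<close> correspond under the homomorphism.\<close>

lemma gl_op_om:
  "gl_op n i j * om k l = om k l * gl_op n i j + ((if k = j then om i l else 0) + (if l = j then om k i else 0))"
proof -
  have "gl_op n i j * (cre (a,k) * up l a) = (cre (a,k) * up l a) * gl_op n i j
     + ((if k = j then cre (a,i) * up l a else 0) + (if l = j then cre (a,k) * up i a else 0))" if "a < 2*n" for a
    by (subst derivation_mult[OF gl_op_cre[OF that] gl_op_up[OF that]]) auto
  then have "gl_op n i j * om k l = (\<Sum>a<2*n. (cre (a,k) * up l a) * gl_op n i j
     + ((if k = j then cre (a,i) * up l a else 0) + (if l = j then cre (a,k) * up i a else 0)))"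
    unfolding om_def sum_distrib_left by (intro sum.cong) auto
  then show ?thesis
    by (simp add: om_def sum.distrib sum_distrib_right)
qed

lemma ann_om:
  assumes a: "a < 2*n"
  shows "ann (a,j) * om k l = om k l * ann (a,j) + ((if j = k then up l a else 0) + (if j = l then up k a else 0))"
proof -
  have "ann (a,j) * (cre (b,k) * up l b) = (cre (b,k) * up l b) * ann (a,j)
    + ((if b = a then (if j = k then up l a else 0) else 0) - (if j = l then J b a *\<^sub>L cre (b,k) else 0))" for b
  proof -
    have "ann (a,j) * (cre (b,k) * up l b) = (ann (a,j) * cre (b,k)) * up l b" by (simp add: mult.assoc)
    also have "\<dots> = (if (a,j) = (b,k) then up l b else 0) - cre (b,k) * (ann (a,j) * up l b)"
      by (simp add: ann_cre algebra_simps)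
    also have "\<dots> = (if (a,j) = (b,k) then up l b else 0) - (if j = l then J b a *\<^sub>L cre (b,k) else 0) + cre (b,k) * up l b * ann (a,j)"
      by (simp add: ann_up[OF a] algebra_simps)
    finally show ?thesis by auto
  qed
  then have "ann (a,j) * om k l = om k l * ann (a,j) + ((\<Sum>b<2*n. if b = a then (if j = k then up l a else 0) else 0)
     - (\<Sum>b<2*n. if j = l then J b a *\<^sub>L cre (b,k) else 0))"
    by (simp only: om_def sum_distrib_left sum_distrib_right sum.distrib sum_subtractf)
  also have "(\<Sum>b<2*n. if j = l then J b a *\<^sub>L cre (b,k) else 0) = - (if j = l then up k a else 0)"
    unfolding up_def using J_skew[OF _ a] by (simp add: sum_negf[symmetric])
  also have "(\<Sum>b<2*n. if b = a then (if j = k then up l a else 0) else 0) = (if j = k then up l a else 0)"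
    using a by simp
  finally show ?thesis by simp
qed

lemma low_om:
  assumes a: "a < 2*n"
  shows "low j a * om k l = om k l * low j a + ((if j = k then cre (a,l) else 0) + (if j = l then cre (a,k) else 0))"
proof -
  have "low j a * om k l = (\<Sum>b<2*n. Om a b *\<^sub>L (om k l * ann (b,j) + ((if j = k then up l b else 0) + (if j = l then up k b else 0))))"
    unfolding low_def sum_distrib_right by (intro sum.cong) (auto simp: ann_om)
  also have "\<dots> = om k l * low j a + ((if j = k then \<Sum>b<2*n. Om a b *\<^sub>L up l b else 0) + (if j = l then \<Sum>b<2*n. Om a b *\<^sub>L up k b else 0))"
    by (simp add: low_def lscale_simps sum.distrib sum_distrib_left)
  finally show ?thesis by (simp add: sum_Om_up a)
qed

lemma sum_up_low: "(\<Sum>a<2*n. up l a * low j a) = - gl_op n l j"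
proof -
  have "(\<Sum>a<2*n. up l a * low j a) = (\<Sum>a<2*n. \<Sum>d<2*n. J a d *\<^sub>L (cre (d,l) * low j a))"
    by (simp add: up_def sum_distrib_right)
  also have "\<dots> = (\<Sum>d<2*n. \<Sum>a<2*n. J a d *\<^sub>L (cre (d,l) * low j a))" by (rule sum.swap)
  also have "\<dots> = (\<Sum>d<2*n. - (cre (d,l) * (\<Sum>a<2*n. J d a *\<^sub>L low j a)))"
    unfolding sum_distrib_left sum_negf[symmetric]
    by (intro sum.cong refl) (subst J_skew, auto)
  finally show ?thesis by (simp add: sum_J_low gl_op_def sum_negf)
qed

lemma sum_ann_cre: "(\<Sum>a<2*n. ann (a,i) * cre (a,l)) = (if i = l then of_nat (2*n) else 0) - gl_op n l i"
  by (simp add: ann_cre sum_subtractf gl_op_def)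

text \<open>The bracket of S^2 W and its dual inside sp(2g): it lies in gl(W) up to a scalar. The
  scalar 2n = dim V arises from normal ordering in \<open>sum_ann_cre\<close>.\<close>

lemma dl_om:
  "dl i j * om k l = om k l * dl i j
    - (if i = k then gl_op n l j else 0) - (if i = l then gl_op n k j else 0)
    + (if j = k then (if i = l then of_nat (2*n) else 0) - gl_op n l i else 0)
    + (if j = l then (if i = k then of_nat (2*n) else 0) - gl_op n k i else 0)"
proof -
  have "ann (a,i) * low j a * om k l = om k l * (ann (a,i) * low j a)
      + (if i = k then up l a * low j a else 0) + (if i = l then up k a * low j a else 0)
      + (if j = k then ann (a,i) * cre (a,l) else 0) + (if j = l then ann (a,i) * cre (a,k) else 0)"
    if a: "a < 2*n" for a
  proof -
    have "ann (a,i) * low j a * om k l = ann (a,i) * (low j a * om k l)" by (simp add: mult.assoc)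
    also have "\<dots> = (ann (a,i) * om k l) * low j a
      + (if j = k then ann (a,i) * cre (a,l) else 0) + (if j = l then ann (a,i) * cre (a,k) else 0)"
      by (simp add: low_om[OF a] algebra_simps)
    also have "(ann (a,i) * om k l) * low j a = om k l * (ann (a,i) * low j a)
      + (if i = k then up l a * low j a else 0) + (if i = l then up k a * low j a else 0)"
      by (simp add: ann_om[OF a] algebra_simps)
    finally show ?thesis .
  qed
  then have "dl i j * om k l = (\<Sum>a<2*n. om k l * (ann (a,i) * low j a)
      + (if i = k then up l a * low j a else 0) + (if i = l then up k a * low j a else 0)
      + (if j = k then ann (a,i) * cre (a,l) else 0) + (if j = l then ann (a,i) * cre (a,k) else 0))"
    unfolding dl_def sum_distrib_right by (intro sum.cong) auto
  also have "\<dots> = om k l * dl i j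
      + (if i = k then \<Sum>a<2*n. up l a * low j a else 0) + (if i = l then \<Sum>a<2*n. up k a * low j a else 0)
      + (if j = k then \<Sum>a<2*n. ann (a,i) * cre (a,l) else 0) + (if j = l then \<Sum>a<2*n. ann (a,i) * cre (a,k) else 0)"
    by (simp add: dl_def sum.distrib sum_distrib_left)
  finally show ?thesis
    by (simp only: sum_up_low sum_ann_cre) simp
qed

lemma lowE_ann:
  assumes "i < g"
  shows "lowE b c * ann (x,i) = ann (x,i) * lowE b c + (if b = x then - low i c else 0)"
proof -
  have "lowE b c * ann (x,i) = (\<Sum>a<2*n. Om c a *\<^sub>L (ann (x,i) * glV_op g b a + (if b = x then - ann (a,i) else 0)))"
    unfolding lowE_def sum_distrib_right by (intro sum.cong) (auto simp: glV_op_ann assms)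
  then show ?thesis
    by (simp add: lowE_def low_def lscale_simps sum.distrib sum_distrib_left sum_negf)
qed

lemma lowE_low:
  assumes "i < g" "b < 2*n"
  shows "lowE b c * low i a = low i a * lowE b c - Om a b *\<^sub>L low i c"
proof -
  have "lowE b c * low i a = (\<Sum>x<2*n. Om a x *\<^sub>L (ann (x,i) * lowE b c + (if b = x then - low i c else 0)))"
    unfolding low_def[of i a] sum_distrib_left by (intro sum.cong) (auto simp: lowE_ann assms)
  also have "\<dots> = low i a * lowE b c + (\<Sum>x<2*n. if x = b then - (Om a b *\<^sub>L low i c) else 0)"
    unfolding low_def[of i a] sum_distrib_right sum.distrib[symmetric]
    by (intro sum.cong) (auto simp: lscale_simps)
  finally show ?thesis using assms by simp
qed

text \<open>The correction term is antisymmetric in \<open>b\<close> and \<open>c\<close>, so it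
  disappears in the symmetrized \<open>sp_op\<close>: contractions commute with sp(V).\<close>

lemma lowE_dl:
  assumes "i < g" "j < g" "b < 2*n"
  shows "lowE b c * dl i j = dl i j * lowE b c + (low i b * low j c - low i c * low j b)"
proof -
  have "lowE b c * (ann (a,i) * low j a) = (ann (a,i) * low j a) * lowE b c
     + ((if a = b then - (low i c * low j b) else 0) - Om a b *\<^sub>L (ann (a,i) * low j c))" for a
  proof -
    have "lowE b c * (ann (a,i) * low j a) = (lowE b c * ann (a,i)) * low j a" by (simp add: mult.assoc)
    also have "\<dots> = ann (a,i) * (lowE b c * low j a) + (if a = b then - (low i c * low j b) else 0)"
      by (auto simp: lowE_ann[OF assms(1)] algebra_simps)
    finally show ?thesis by (simp add: lowE_low[OF assms(2,3)] algebra_simps)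
  qed
  then have "lowE b c * dl i j = dl i j * lowE b c + ((\<Sum>a<2*n. if a = b then - (low i c * low j b) else 0)
       - (\<Sum>a<2*n. Om a b *\<^sub>L (ann (a,i) * low j c)))"
    by (simp only: dl_def sum_distrib_left sum_distrib_right sum.distrib sum_subtractf)
  also have "(\<Sum>a<2*n. Om a b *\<^sub>L (ann (a,i) * low j c)) = - (low i b * low j c)"
    unfolding low_def[of i b] sum_distrib_right sum_negf[symmetric]
    by (intro sum.cong refl) (subst Om_skew, auto simp: assms)
  finally show ?thesis using assms by simp
qed

lemma sp_op_dl:
  assumes "i < g" "j < g" "b < 2*n" "c < 2*n"
  shows "sp_op b c * dl i j = dl i j * sp_op b c"
  by (simp add: sp_op_def distrib_left distrib_right lowE_dl assms)

lemma sp_op_gl_op: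
  assumes "i < g" "j < g" "b < 2*n" "c < 2*n"
  shows "sp_op b c * gl_op n i j = gl_op n i j * sp_op b c"
  using gl_op_glV_op_commute[OF assms(1,2)] assms(3,4)
  by (simp add: sp_op_def lowE_def sum_distrib_left sum_distrib_right distrib_left distrib_right)

text \<open>After reordering, the quartic sum becomes the Casimir operator of gl(V) plus terms
  ending in some \<open>sp_op\<close>, which die on vectors annihilated by sp(V).
  \<open>casimir_duality\<close> then trades gl(V) for gl(W). It contributes 2n+g to the constant,
  and the reordering contributes the remaining 1.\<close>

lemma om_dl_casimir:
  "(\<Sum>i<g. \<Sum>j<g. om i j * dl i j) =
     of_nat (2*n + g + 1) * (\<Sum>i<g. gl_op n i i) - (\<Sum>i<g. \<Sum>j<g. gl_op n j i * gl_op n i j)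
     - (\<Sum>b<2*n. \<Sum>a<2*n. glV_op g b a * (\<Sum>d<2*n. J b d *\<^sub>L sp_op d a))"
proof -
  \<comment> \<open>Summing over the W-index gives \<open>lowE d a\<close>, which is
    \<open>sp_op d a\<close> minus \<open>lowE a d\<close>; contracting the latter with
    \<open>J\<close> restores \<open>glV_op g a b\<close>.\<close>
  have U: "(\<Sum>j<g. up j b * low j a) = (\<Sum>d<2*n. J b d *\<^sub>L sp_op d a) - glV_op g a b" if "b < 2*n" for a b
  proof -
    have "(\<Sum>j<g. up j b * low j a) = (\<Sum>j<g. \<Sum>d<2*n. J b d *\<^sub>L (cre (d,j) * low j a))"
      by (simp add: up_def sum_distrib_right)
    also have "\<dots> = (\<Sum>d<2*n. J b d *\<^sub>L (\<Sum>j<g. cre (d,j) * low j a))"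
      unfolding lscale.scale_sum_right by (rule sum.swap)
    also have "\<dots> = (\<Sum>d<2*n. J b d *\<^sub>L lowE d a)"
    proof -
      have "(\<Sum>j<g. cre (d,j) * low j a) = lowE d a" for d
        unfolding low_def lowE_def glV_op_def lscale.scale_sum_right sum_distrib_left lscale_mult_right
        by (rule sum.swap)
      then show ?thesis by simp
    qed
    finally show ?thesis using sum_J_lowE[OF that, of a]
      by (simp add: sp_op_def lscale_simps sum.distrib)
  qed
  \<comment> \<open>Moving \<open>ann\<close> to the left of \<open>up\<close> costs a scalar
    \<open>J b a\<close>, nonzero only for \<open>i = j\<close>. Contracted with \<open>low\<close>
    it yields \<open>gl_op n i i\<close>.\<close>
  have om_dl: "om i j * dl i j = (if i = j then gl_op n i i else 0)
     - (\<Sum>b<2*n. \<Sum>a<2*n. (cre (b,i) * ann (a,i)) * (up j b * low j a))" for i j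
  proof -
    have "om i j * dl i j = (\<Sum>b<2*n. \<Sum>a<2*n. cre (b,i) * (up j b * ann (a,i)) * low j a)"
      by (simp add: om_def dl_def sum_product mult.assoc)
    also have "\<dots> = (\<Sum>b<2*n. \<Sum>a<2*n. (if i = j then J b a *\<^sub>L (cre (b,i) * low j a) else 0)
        - (cre (b,i) * ann (a,i)) * (up j b * low j a))"
      by (intro sum.cong refl) (auto simp: up_ann algebra_simps)
    also have "\<dots> = (if i = j then (\<Sum>b<2*n. cre (b,i) * (\<Sum>a<2*n. J b a *\<^sub>L low i a)) else 0)
       - (\<Sum>b<2*n. \<Sum>a<2*n. (cre (b,i) * ann (a,i)) * (up j b * low j a))"
      by (simp add: sum_subtractf sum_distrib_left)
    finally show ?thesis by (simp add: sum_J_low gl_op_def)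
  qed
  have "(\<Sum>i<g. \<Sum>j<g. om i j * dl i j) = (\<Sum>i<g. gl_op n i i)
     - (\<Sum>i<g. \<Sum>j<g. \<Sum>b<2*n. \<Sum>a<2*n. (cre (b,i) * ann (a,i)) * (up j b * low j a))"
    by (simp add: om_dl sum_subtractf)
  also have "(\<Sum>i<g. \<Sum>j<g. \<Sum>b<2*n. \<Sum>a<2*n. (cre (b,i) * ann (a,i)) * (up j b * low j a))
    = (\<Sum>b<2*n. \<Sum>a<2*n. \<Sum>i<g. \<Sum>j<g. (cre (b,i) * ann (a,i)) * (up j b * low j a))"
    by (rule sum_swap_pairs)
  also have "\<dots> = (\<Sum>b<2*n. \<Sum>a<2*n. glV_op g b a * (\<Sum>j<g. up j b * low j a))"
    unfolding glV_op_def sum_product ..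
  also have "\<dots> = (\<Sum>b<2*n. \<Sum>a<2*n. glV_op g b a * (\<Sum>d<2*n. J b d *\<^sub>L sp_op d a) - glV_op g b a * glV_op g a b)"
    by (intro sum.cong refl) (simp add: U right_diff_distrib)
  also have "\<dots> = (\<Sum>b<2*n. \<Sum>a<2*n. glV_op g b a * (\<Sum>d<2*n. J b d *\<^sub>L sp_op d a))
      - (\<Sum>b<2*n. \<Sum>a<2*n. glV_op g b a * glV_op g a b)"
    by (simp only: sum_subtractf)
  finally show ?thesis
    using casimir_duality[of g n] by (simp add: algebra_simps)
qed

end

text \<open>Reordering the Casimir operator of \<open>gl\<^sub>g\<close> so that the raising operators act first.\<close>
lemma sum_commutator_reorder:
  fixes G :: "nat \<Rightarrow> nat \<Rightarrow> 'a::ring_1"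
  assumes "\<And>i j. i < g \<Longrightarrow> j < g \<Longrightarrow> G j i = G i j + h i - h j"
  shows "(\<Sum>i<g. \<Sum>j<g. G i j) + (\<Sum>i<g. of_nat (2*i+1) * h i)
    = (\<Sum>i<g. G i i) + 2 * (\<Sum>i<g. \<Sum>j\<in>{i<..<g}. G i j) + of_nat g * (\<Sum>i<g. h i)"
  using assms
proof (induction g)
  case (Suc g)
  have IH: "(\<Sum>i<g. \<Sum>j<g. G i j) + (\<Sum>i<g. of_nat (2*i+1) * h i)
    = (\<Sum>i<g. G i i) + 2 * (\<Sum>i<g. \<Sum>j\<in>{i<..<g}. G i j) + of_nat g * (\<Sum>i<g. h i)"
    by (rule Suc.IH, rule Suc.prems) auto
  have 1: "(\<Sum>i<Suc g. \<Sum>j<Suc g. G i j) = (\<Sum>i<g. \<Sum>j<g. G i j) + (\<Sum>i<g. G i g) + (\<Sum>i<g. G g i) + G g g"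
    by (simp add: sum.distrib add.assoc)
  have 2: "(\<Sum>i<g. G g i) = (\<Sum>i<g. G i g) + (\<Sum>i<g. h i) - of_nat g * h g"
  proof -
    have "(\<Sum>i<g. G g i) = (\<Sum>i<g. G i g + h i - h g)"
      by (intro sum.cong refl Suc.prems) auto
    then show ?thesis by (simp add: sum.distrib sum_subtractf)
  qed
  have 3: "(\<Sum>i<Suc g. \<Sum>j\<in>{i<..<Suc g}. G i j) = (\<Sum>i<g. \<Sum>j\<in>{i<..<g}. G i j) + (\<Sum>i<g. G i g)"
  proof -
    have "{i<..<Suc g} = insert g {i<..<g}" if "i < g" for i using that by auto
    then have "(\<Sum>i<g. \<Sum>j\<in>{i<..<Suc g}. G i j) = (\<Sum>i<g. (\<Sum>j\<in>{i<..<g}. G i j) + G i g)"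
      by (intro sum.cong) (auto simp: add.commute)
    moreover have "{g<..<Suc g} = {}" by auto
    ultimately show ?thesis by (simp add: sum.distrib)
  qed
  show ?case
  proof -
    have "(\<Sum>i<Suc g. \<Sum>j<Suc g. G i j) + (\<Sum>i<Suc g. of_nat (2*i+1) * h i)
      = ((\<Sum>i<g. \<Sum>j<g. G i j) + (\<Sum>i<g. of_nat (2*i+1) * h i))
        + (2 * (\<Sum>i<g. G i g) + (\<Sum>i<g. h i) + of_nat (g + 1) * h g + G g g)"
      unfolding 1 2 by (simp add: mult_2 distrib_right add_ac)
    then show ?thesis
      unfolding IH 3 by (simp add: distrib_right distrib_left add_ac)
  qed
qed simp

section \<open>The homomorphism to the exterior algebra\<close>

(* As simp rules these eta-expand sums of elements of the exterior algebra. *)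
declare plus_fun_apply [simp del] zero_fun_apply [simp del]

definition word :: "(nat \<times> nat \<Rightarrow> lop) \<Rightarrow> (nat \<times> nat) set \<Rightarrow> lop" where
  "word K S = prod_list (map K (sorted_list_of_set S))"

lemma word_empty [simp]: "word K {} = 1"
  by (simp add: word_def)

lemma word_insert_min:
  assumes "finite S" "\<And>y. y \<in> S \<Longrightarrow> x < y"
  shows "word K (insert x S) = K x * word K S"
proof -
  have "x \<notin> S" using assms(2) by blast
  then have "sorted_list_of_set (insert x S) = x # sorted_list_of_set S"
    using assms by (subst sorted_list_of_set_insert) (auto simp: less_imp_le intro!: insort_is_Cons)
  then show ?thesis by (simp add: word_def)
qed

text \<open>The relations that images of the generators must satisfy. Two families are used:
  \<open>cre\<close>, giving wedge multiplication, and \<open>mat_cre n M\<close>, giving the action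
  of a matrix.\<close>

locale anticommuting =
  fixes K :: "nat \<times> nat \<Rightarrow> lop" and B :: "(nat \<times> nat) set"
  assumes anticommute: "x \<in> B \<Longrightarrow> y \<in> B \<Longrightarrow> K x * K y = - (K y * K x)"
    and square_zero: "x \<in> B \<Longrightarrow> K x * K x = 0"
    and finite_B: "finite B"
begin

lemma mult_word:
  assumes "finite S" "S \<subseteq> B" "x \<in> B" "x \<notin> S"
  shows "K x * word K S = sgn_at x S *\<^sub>L word K (insert x S)"
  using assms
proof (induction S rule: finite_linorder_min_induct)
  case empty
  then show ?case by (simp add: word_def sgn_at_def)
next
  case (insert b A)
  have bA: "b \<notin> A" using insert by auto
  show ?case
  proof (cases "x < b")
    case True
    have "{y \<in> insert b A. y < x} = {}" using True insert(2) by (auto dest: less_trans)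
    then have "sgn_at x (insert b A) = 1" unfolding sgn_at_def by (metis card.empty power_0)
    moreover have "word K (insert x (insert b A)) = K x * word K (insert b A)"
      using True insert by (intro word_insert_min) (auto dest: less_trans)
    ultimately show ?thesis by simp
  next
    case False
    then have bx: "b < x" using insert.prems by auto
    have "K x * word K (insert b A) = K x * K b * word K A"
      using insert by (subst word_insert_min) (auto simp: mult.assoc)
    also have "\<dots> = - (K b * (K x * word K A))"
      using insert.prems by (subst anticommute) (auto simp: mult.assoc)
    also have "\<dots> = - (sgn_at x A *\<^sub>L (K b * word K (insert x A)))"
      using insert by simp
    also have "K b * word K (insert x A) = word K (insert b (insert x A))"
      using insert bx by (intro word_insert_min[symmetric]) auto
    finally show ?thesis
      using bx insert(1) bA by (simp add: sgn_at_insert insert_commute)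
  qed
qed

text \<open>The factor \<open>K x\<close> of the word can be pulled to the front, where it meets the
  other \<open>K x\<close>.\<close>

lemma mult_word_mem:
  assumes "S \<subseteq> B" "x \<in> S"
  shows "K x * word K S = 0"
proof -
  have "x \<in> B" "finite (S - {x})" using assms finite_B by (auto intro: finite_subset)
  from mult_word[of "S - {x}" x] this assms
  have "K x * word K (S - {x}) = sgn_at x (S - {x}) *\<^sub>L word K S"
    by (auto simp: insert_absorb)
  then have "word K S = sgn_at x (S - {x}) *\<^sub>L (K x * word K (S - {x}))"
    by simp
  then have "K x * word K S = sgn_at x (S - {x}) *\<^sub>L (K x * K x * word K (S - {x}))"
    by (simp add: mult.assoc)
  then show ?thesis using square_zero \<open>x \<in> B\<close> by simp
qed

text \<open>The algebra homomorphism from the exterior algebra that sends the generator \<open>x\<close> to \<open>K x\<close>.\<close>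
definition subst_op :: "ext \<Rightarrow> lop" where
  "subst_op f = (\<Sum>S\<in>Pow B. f S *\<^sub>L word K S)"

lemma subst_op_add: "subst_op (f + h) = subst_op f + subst_op h"
  by (simp add: subst_op_def lscale_simps sum.distrib plus_fun_apply)

lemma subst_op_0: "subst_op 0 = 0"
  by (simp add: subst_op_def zero_fun_apply)

lemma subst_op_sum: "subst_op (sum f A) = (\<Sum>x\<in>A. subst_op (f x))" for f :: "'a \<Rightarrow> ext"
proof (induction A rule: infinite_finite_induct)
  case (insert x A)
  then show ?case by (metis (no_types, lifting) subst_op_add sum.insert)
qed (metis subst_op_0 sum.infinite sum.empty)+

lemma subst_op_scale: "subst_op (ext_scale k f) = k *\<^sub>L subst_op f"
  by (simp add: subst_op_def ext_scale_def lscale.scale_sum_right)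

lemma subst_op_vac: "subst_op vac = 1"
proof -
  have "subst_op vac = (\<Sum>S\<in>Pow B. if S = {} then 1 else 0)"
    unfolding subst_op_def vac_def ext_const_def by (intro sum.cong) auto
  then show ?thesis using finite_B by simp
qed

text \<open>Words containing \<open>x\<close> are killed, and the others are in bijection with the
  sets containing \<open>x\<close>. With \<open>subst_op_vac\<close> this computes
  \<open>subst_op\<close> on everything built from the vacuum by creation operators.\<close>

lemma subst_op_cre:
  assumes x: "x \<in> B"
  shows "subst_op (app (cre x) f) = K x * subst_op f"
proof -
  have "K x * subst_op f = (\<Sum>S\<in>Pow B. f S *\<^sub>L (K x * word K S))"
    by (simp add: subst_op_def sum_distrib_left)
  also have "\<dots> = (\<Sum>S\<in>Pow B. if x \<notin> S then (f S * sgn_at x S) *\<^sub>L word K (insert x S) else 0)"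
    using x finite_B by (intro sum.cong) (auto simp: mult_word mult_word_mem finite_subset)
  also have "\<dots> = (\<Sum>S\<in>{S\<in>Pow B. x \<notin> S}. (f S * sgn_at x S) *\<^sub>L word K (insert x S))"
    by (rule sum.inter_filter[symmetric]) (simp add: finite_B)
  also have "\<dots> = (\<Sum>S\<in>{S\<in>Pow B. x \<in> S}. (f (S - {x}) * sgn_at x S) *\<^sub>L word K S)"
    using x finite_B
    by (intro sum.reindex_bij_witness[of _ "\<lambda>S. S - {x}" "insert x"])
       (auto simp: insert_absorb sgn_at_insert finite_subset)
  also have "\<dots> = (\<Sum>S\<in>Pow B. if x \<in> S then (f (S - {x}) * sgn_at x S) *\<^sub>L word K S else 0)"
    by (rule sum.inter_filter) (simp add: finite_B)
  also have "\<dots> = subst_op (app (cre x) f)"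
    unfolding subst_op_def using finite_B
    by (intro sum.cong) (auto simp: app_cre finite_subset mult.commute)
  finally show ?thesis by simp
qed

end

section \<open>The wedge product and the group action as substitutions\<close>

lemma anticommuting_cre: "finite B \<Longrightarrow> anticommuting cre B"
  by standard (auto intro: cre_cre)

lemma wsign_insert:
  assumes "finite S" "finite T" "\<And>y. y \<in> S \<Longrightarrow> x < y" "x \<notin> T"
  shows "wsign (insert x S) T = sgn_at x T * wsign S T"
proof -
  have "{(s,t). s \<in> insert x S \<and> t \<in> T \<and> t < s}
     = Pair x ` {t \<in> T. t < x} \<union> {(s,t). s \<in> S \<and> t \<in> T \<and> t < s}" by auto
  moreover have "finite {(s,t). s \<in> S \<and> t \<in> T \<and> t < s}"
    by (rule finite_subset[of _ "S \<times> T"]) (use assms in auto)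
  moreover have "Pair x ` {t \<in> T. t < x} \<inter> {(s,t). s \<in> S \<and> t \<in> T \<and> t < s} = {}"
    using assms by fastforce
  ultimately have "card {(s,t). s \<in> insert x S \<and> t \<in> T \<and> t < s}
    = card {t \<in> T. t < x} + card {(s,t). s \<in> S \<and> t \<in> T \<and> t < s}"
    using assms by (simp add: card_Un_disjoint card_image inj_on_def)
  then show ?thesis by (simp add: wsign_def sgn_at_def power_add)
qed

text \<open>An ordered product of creation operators is left multiplication by e_S with the sign
  \<open>wsign\<close>. Splitting off the least \<open>x\<close> of \<open>S\<close> works because
  no other element of \<open>S\<close> is below \<open>x\<close>, so \<open>sgn_at\<close> counts
  only elements outside \<open>S\<close>.\<close>

lemma app_word_cre:
  assumes "finite S"
  shows "app (word cre S) h U = (if finite U \<and> S \<subseteq> U then wsign S (U - S) * h (U - S) else 0)"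
  using assms
proof (induction S arbitrary: U rule: finite_linorder_min_induct)
  case empty
  then show ?case by (simp add: app_1 fin_part_def wsign_def)
next
  case (insert x S)
  have xS: "x \<notin> S" using insert by auto
  show ?case
  proof (cases "finite U \<and> insert x S \<subseteq> U")
    case True
    have "{y \<in> U. y < x} = {y \<in> U - insert x S. y < x}" using insert(2) by force
    then have "sgn_at x U = sgn_at x (U - insert x S)" by (simp add: sgn_at_def)
    moreover have "U - {x} - S = U - insert x S" by auto
    moreover have "wsign (insert x S) (U - insert x S) = sgn_at x (U - insert x S) * wsign S (U - insert x S)"
      using True insert by (intro wsign_insert) auto
    ultimately show ?thesis using True xS insert
      by (simp add: word_insert_min app_mult app_cre insert.IH subset_Diff_insert)
  next
    case False
    then show ?thesis using xS insert
      by (auto simp: word_insert_min app_mult app_cre insert.IH)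
  qed
qed

lemma app_word_cre_vac:
  assumes "finite S"
  shows "app (word cre S) vac U = (if U = S then 1 else 0)"
  using assms by (auto simp: app_word_cre vac_def ext_const_def wsign_def)

lemma finite_gens [simp]: "finite (gens n g)"
  by (simp add: gens_def)

lemma in_gens [simp]: "(a,i) \<in> gens n g \<longleftrightarrow> a < 2*n \<and> i < g"
  by (auto simp: gens_def)

lemma ext_carrierD: "f \<in> ext_carrier n g \<Longrightarrow> f S \<noteq> 0 \<Longrightarrow> S \<subseteq> gens n g"
  by (auto simp: ext_carrier_def)

lemma ext_carrier_add: "f \<in> ext_carrier n g \<Longrightarrow> h \<in> ext_carrier n g \<Longrightarrow> f + h \<in> ext_carrier n g"
proof -
  assume "f \<in> ext_carrier n g" "h \<in> ext_carrier n g"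
  moreover have "f S \<noteq> 0 \<or> h S \<noteq> 0" if "(f + h) S \<noteq> 0" for S
    using that by (auto simp: plus_fun_apply)
  ultimately show ?thesis unfolding ext_carrier_def by blast
qed

lemma ext_carrier_0 [simp]: "0 \<in> ext_carrier n g"
  by (auto simp: ext_carrier_def zero_fun_apply)

lemma ext_carrier_sum: "(\<And>x. x \<in> A \<Longrightarrow> f x \<in> ext_carrier n g) \<Longrightarrow> sum f A \<in> ext_carrier n g"
proof (induction A rule: infinite_finite_induct)
  case (insert x A)
  then show ?case by (metis ext_carrier_add insertI1 insertI2 sum.insert)
qed (metis ext_carrier_0 sum.infinite sum.empty)+

lemma ext_carrier_scale: "f \<in> ext_carrier n g \<Longrightarrow> ext_scale k f \<in> ext_carrier n g"
  by (auto simp: ext_carrier_def ext_scale_def)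

lemma vac_carrier [simp]: "vac \<in> ext_carrier n g"
  by (auto simp: ext_carrier_def vac_def ext_const_def)

lemma cre_carrier: "x \<in> gens n g \<Longrightarrow> f \<in> ext_carrier n g \<Longrightarrow> app (cre x) f \<in> ext_carrier n g"
  unfolding ext_carrier_def by (auto simp: app_cre split: if_splits)

lemma ann_carrier: "f \<in> ext_carrier n g \<Longrightarrow> app (ann x) f \<in> ext_carrier n g"
  unfolding ext_carrier_def by (auto simp: app_ann split: if_splits)

lemma fin_part_carrier: "f \<in> ext_carrier n g \<Longrightarrow> fin_part f = f"
  unfolding fin_part_def by (rule ext) (metis ext_carrierD finite_gens finite_subset)

abbreviation ext_op :: "nat \<Rightarrow> nat \<Rightarrow> (nat \<times> nat \<Rightarrow> lop) \<Rightarrow> ext \<Rightarrow> lop" where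
  "ext_op n g K \<equiv> anticommuting.subst_op K (gens n g)"

text \<open>\<open>ext_mul\<close> reads its right factor only on subsets of
  \<open>gens n g\<close>, while the operator reads it everywhere; the carrier hypothesis reconciles
  the two.\<close>

lemma ext_mul_eq_app:
  assumes "h \<in> ext_carrier n g"
  shows "ext_mul (gens n g) f h = app (ext_op n g cre f) h"
proof
  fix U
  interpret anticommuting cre "gens n g" by (rule anticommuting_cre) simp
  have "(\<Sum>T\<in>Pow (gens n g). if S \<inter> T = {} \<and> S \<union> T = U then wsign S T * f S * h T else 0)
     = f S * app (word cre S) h U" if S: "S \<subseteq> gens n g" for S
  proof -
    have "(\<Sum>T\<in>Pow (gens n g). if S \<inter> T = {} \<and> S \<union> T = U then wsign S T * f S * h T else 0)
       = (\<Sum>T\<in>Pow (gens n g). if T = U - S then (if S \<subseteq> U then wsign S (U - S) * f S * h (U - S) else 0) else 0)"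
      by (intro sum.cong refl) auto
    also have "\<dots> = (if U - S \<subseteq> gens n g then (if S \<subseteq> U then wsign S (U - S) * f S * h (U - S) else 0) else 0)"
      by simp
    also have "\<dots> = f S * app (word cre S) h U"
    proof (cases "U - S \<subseteq> gens n g \<and> S \<subseteq> U")
      case True
      then have "finite U" using S by (intro finite_subset[OF _ finite_gens[of n g]]) auto
      then show ?thesis using True S by (simp add: app_word_cre finite_subset)
    next
      case False
      then show ?thesis using S ext_carrierD[OF assms, of "U - S"]
        by (auto simp: app_word_cre finite_subset)
    qed
    finally show ?thesis .
  qed
  then show "ext_mul (gens n g) f h U = app (ext_op n g cre f) h U"
    by (simp add: ext_mul_def subst_op_def app_sum app_lscale sum_ext_apply ext_scale_apply)
qed

lemma ext_op_cre_vac: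
  assumes "f \<in> ext_carrier n g"
  shows "app (ext_op n g cre f) vac = f"
proof
  fix U
  interpret anticommuting cre "gens n g" by (rule anticommuting_cre) simp
  have "app (subst_op f) vac U = (\<Sum>S\<in>Pow (gens n g). if S = U then f U else 0)"
    unfolding subst_op_def app_sum app_lscale sum_ext_apply ext_scale_apply
    by (intro sum.cong) (auto simp: app_word_cre_vac finite_subset[OF _ finite_gens])
  also have "\<dots> = f U" using ext_carrierD[OF assms, of U] by auto
  finally show "app (subst_op f) vac U = f U" .
qed

text \<open>The creation operator of the vector (M \<otimes> id) x.\<close>

definition mat_cre :: "nat \<Rightarrow> (nat \<Rightarrow> nat \<Rightarrow> complex) \<Rightarrow> nat \<times> nat \<Rightarrow> lop" where
  "mat_cre n M x = (\<Sum>b<2*n. M b (fst x) *\<^sub>L cre (b, snd x))"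

lemma mat_cre_anticommute: "mat_cre n M x * mat_cre n M y = - (mat_cre n M y * mat_cre n M x)"
proof -
  have "mat_cre n M x * mat_cre n M y
     = (\<Sum>b<2*n. \<Sum>c<2*n. (M b (fst x) * M c (fst y)) *\<^sub>L (cre (b, snd x) * cre (c, snd y)))"
    by (simp add: mat_cre_def sum_product mult.commute)
  also have "\<dots> = (\<Sum>c<2*n. \<Sum>b<2*n. (M b (fst x) * M c (fst y)) *\<^sub>L (cre (b, snd x) * cre (c, snd y)))"
    by (rule sum.swap)
  also have "\<dots> = - (\<Sum>c<2*n. \<Sum>b<2*n. (M c (fst y) * M b (fst x)) *\<^sub>L (cre (c, snd y) * cre (b, snd x)))"
    unfolding sum_negf[symmetric]
    by (intro sum.cong refl) (subst cre_cre, simp add: mult.commute)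
  also have "\<dots> = - (mat_cre n M y * mat_cre n M x)"
    by (simp add: mat_cre_def sum_product mult.commute)
  finally show ?thesis .
qed

lemma mat_cre_sq: "mat_cre n M x * mat_cre n M x = 0"
proof -
  have "mat_cre n M x * mat_cre n M x + mat_cre n M x * mat_cre n M x = 0"
    using mat_cre_anticommute[of n M x x] by (simp add: eq_neg_iff_add_eq_0)
  \<comment> \<open>Anticommuting with itself gives only that twice the square is zero; the scalars
    allow division by 2.\<close>
  then have "(1/2) *\<^sub>L ((1+1) *\<^sub>L (mat_cre n M x * mat_cre n M x)) = 0"
    unfolding lscale.scale_left_distrib lscale.scale_one by simp
  then show ?thesis unfolding lscale.scale_scale by simp
qed

lemma anticommuting_mat_cre: "anticommuting (mat_cre n M) (gens n g)"
  by standard (auto intro: mat_cre_anticommute mat_cre_sq)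

lemma ext_op_gen_image:
  assumes "x \<in> gens n g"
  shows "ext_op n g cre (gen_image n M x) = mat_cre n M x"
proof -
  interpret anticommuting cre "gens n g" by (rule anticommuting_cre) simp
  define v where "v = (\<lambda>(b,j). if b < 2*n \<and> j = snd x then M b (fst x) else 0)"
  have "subst_op (ext_vec v) = (\<Sum>S\<in>(\<lambda>y. {y}) ` gens n g. ext_vec v S *\<^sub>L word cre S)"
    unfolding subst_op_def
    by (rule sum.mono_neutral_right) (auto simp: ext_vec_def card_1_singleton_iff)
  also have "\<dots> = (\<Sum>y\<in>gens n g. v y *\<^sub>L cre y)"
    by (subst sum.reindex) (auto simp: ext_vec_def word_def)
  also have "\<dots> = (\<Sum>b<2*n. \<Sum>j<g. v (b,j) *\<^sub>L cre (b,j))"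
    by (simp add: gens_def sum.cartesian_product atLeast0LessThan split_def)
  also have "\<dots> = (\<Sum>b<2*n. \<Sum>j<g. if j = snd x then M b (fst x) *\<^sub>L cre (b, snd x) else 0)"
    by (intro sum.cong) (auto simp: v_def)
  also have "\<dots> = mat_cre n M x"
    using assms by (cases x) (simp add: mat_cre_def)
  finally show ?thesis by (simp add: gen_image_def v_def)
qed

lemma mat_cre_carrier:
  assumes "snd x < g" "f \<in> ext_carrier n g"
  shows "app (mat_cre n M x) f \<in> ext_carrier n g"
  unfolding mat_cre_def app_sum app_lscale using assms
  by (intro ext_carrier_sum ext_carrier_scale cre_carrier) auto

text \<open>The second conjunct feeds \<open>ext_mul_eq_app\<close>, which needs the right factor of
  each product in the carrier.\<close>

lemma foldr_gen_image:
  assumes "set xs \<subseteq> gens n g"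
  shows "foldr (ext_mul (gens n g)) (map (gen_image n M) xs) (ext_const 1) = app (prod_list (map (mat_cre n M) xs)) vac
    \<and> app (prod_list (map (mat_cre n M) xs)) vac \<in> ext_carrier n g"
  using assms
proof (induction xs)
  case (Cons x xs)
  then show ?case
    by (cases x) (auto simp: ext_mul_eq_app ext_op_gen_image app_mult intro: mat_cre_carrier)
qed (simp_all add: app_1 flip: vac_def)

text \<open>The action of \<open>M\<close> is substitution of \<open>mat_cre n M\<close> for the
  generators, read off at the vacuum.\<close>

lemma ext_act_eq: "ext_act n g M f = app (ext_op n g (mat_cre n M) f) vac"
proof
  fix U
  interpret anticommuting "mat_cre n M" "gens n g" by (rule anticommuting_mat_cre)
  show "ext_act n g M f U = app (subst_op f) vac U"
    unfolding ext_act_def subst_op_def app_sum app_lscale sum_ext_apply ext_scale_apply word_def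
    by (intro sum.cong refl) (subst foldr_gen_image, auto simp: finite_subset[OF _ finite_gens])
qed

lemma prod_list_power_single:
  fixes F :: "'a \<Rightarrow> 'b::monoid_mult"
  assumes "distinct vs" "v \<in> set vs"
  shows "prod_list (map (\<lambda>u. F u ^ (if u = v then 1 else 0)) vs) = F v"
proof -
  have *: "prod_list (map (\<lambda>u. F u ^ (if u = v then 1 else 0)) us) = 1" if "v \<notin> set us" for us
    using that by (induction us) auto
  show ?thesis using assms by (induction vs) (auto simp: *[simplified])
qed

lemma commute_power:
  fixes x y :: "'a::monoid_mult"
  assumes "x * y = y * x"
  shows "x ^ k * y = y * x ^ k"
  using assms by (induction k) (simp_all add: mult.assoc[symmetric], metis mult.assoc)

lemma commute_prod_list:
  fixes y :: "'a::monoid_mult"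
  assumes "\<And>u. u \<in> set us \<Longrightarrow> F u * y = y * F u"
  shows "prod_list (map F us) * y = y * prod_list (map F us)"
  using assms
proof (induction us)
  case (Cons u us)
  then have "prod_list (map F us) * y = y * prod_list (map F us)" "F u * y = y * F u" by auto
  then show ?case by simp (metis mult.assoc)
qed simp

text \<open>Operators do not commute in general, so monomials are evaluated as ordered products,
  whose factors must be commuted past each other explicitly.\<close>

lemma prod_list_power_add:
  fixes F :: "'a \<Rightarrow> 'b::monoid_mult"
  assumes "\<And>u v. F u * F v = F v * F u"
  shows "prod_list (map (\<lambda>u. F u ^ (k u + l u)) vs)
    = prod_list (map (\<lambda>u. F u ^ k u) vs) * prod_list (map (\<lambda>u. F u ^ l u) vs)"
proof (induction vs)
  case (Cons v vs)
  have "F u ^ i * F v ^ j = F v ^ j * F u ^ i" for u v i j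
    by (intro commute_power commute_power[symmetric] assms)
  then have "prod_list (map (\<lambda>u. F u ^ k u) vs) * F v ^ l v = F v ^ l v * prod_list (map (\<lambda>u. F u ^ k u) vs)"
    by (intro commute_prod_list) auto
  then have "F v ^ k v * (F v ^ l v * prod_list (map (\<lambda>u. F u ^ k u) vs))
      = F v ^ k v * (prod_list (map (\<lambda>u. F u ^ k u) vs) * F v ^ l v)" by simp
  then show ?case using Cons by (simp add: power_add flip: mult.assoc)
qed simp

section \<open>The homomorphism and the invariance of its image\<close>

context sp_form
begin

text \<open>The values are operators, so multiplicativity is an identity in a ring, free of signs.
  Running through one fixed list of variables gives all monomials the same shape; variables outside
  \<open>Lvars g\<close> are sent to 1.\<close>

definition Phi :: "spoly \<Rightarrow> lop" where
  "Phi = linext lscale (\<lambda>m. prod_list (map (\<lambda>v. om (fst v) (snd v) ^ lookup m v)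
     (sorted_list_of_set (Lvars g))))"

definition phi :: "spoly \<Rightarrow> ext" where
  "phi p = app (Phi p) vac"

lemma Phi_add: "Phi (p + q) = Phi p + Phi q"
  unfolding Phi_def by (rule linext_add[OF module_lscale])

lemma Phi_0 [simp]: "Phi 0 = 0"
  by (simp add: Phi_def)

lemma Phi_single: "Phi (single m c) = c *\<^sub>L prod_list (map (\<lambda>v. om (fst v) (snd v) ^ lookup m v)
     (sorted_list_of_set (Lvars g)))"
  unfolding Phi_def by (rule linext_single[OF module_lscale])

lemma Phi_mult: "Phi (p * q) = Phi p * Phi q"
proof (induction p rule: poly_mapping_induct_add)
  case (single m c)
  show ?case
  proof (induction q rule: poly_mapping_induct_add)
    case (single m' c')
    show ?case
      by (simp add: mult_single Phi_single lookup_add prod_list_power_add om_om mult.commute[of c])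
  qed (simp_all add: Phi_add distrib_left)
qed (simp_all add: Phi_add distrib_right)

lemma Phi_spconst [simp]: "Phi (spconst c) = c *\<^sub>L 1"
proof -
  have "prod_list (map (\<lambda>v. 1) xs) = (1::lop)" for xs :: "(nat \<times> nat) list" by (induction xs) auto
  then show ?thesis by (simp add: spconst_def Phi_single)
qed

lemma Phi_Lvar:
  assumes "i < g" "j < g"
  shows "Phi (Lvar i j) = om i j"
proof -
  have "(min i j, max i j) \<in> set (sorted_list_of_set (Lvars g))"
    using assms unfolding set_sorted_list_of_set[OF finite_Lvars] by (auto simp: Lvars_def)
  from prod_list_power_single[OF _ this, of "\<lambda>v. om (fst v) (snd v)"]
  have "Phi (Lvar i j) = om (min i j) (max i j)"
    by (simp add: Lvar_def Phi_single lookup_single when_def eq_commute flip: One_nat_def)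
  then show ?thesis by (cases "i \<le> j") (simp_all add: min_def max_def om_commute_sym)
qed

lemma phi_add: "phi (p + q) = phi p + phi q"
  by (simp add: phi_def Phi_add app_add)

lemma phi_0 [simp]: "phi 0 = 0"
  by (simp add: phi_def)

lemma phi_sum: "phi (sum f A) = (\<Sum>x\<in>A. phi (f x))"
proof (induction A rule: infinite_finite_induct)
  case (insert x A)
  then show ?case by (metis (no_types, lifting) phi_add sum.insert)
qed (metis phi_0 sum.infinite sum.empty)+

lemma phi_spconst: "phi (spconst c) = ext_const c"
  unfolding phi_def Phi_spconst app_lscale app_1 fin_part_vac
  by (auto simp: fun_eq_iff ext_scale_def vac_def ext_const_def)

lemma phi_mult: "phi (p * q) = app (Phi p) (phi q)"
  by (simp add: phi_def Phi_mult app_mult)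

lemma om_carrier:
  assumes "i < g" "j < g" "f \<in> ext_carrier n g"
  shows "app (om i j) f \<in> ext_carrier n g"
  unfolding om_def up_def app_sum app_mult app_lscale using assms
  by (intro ext_carrier_sum cre_carrier ext_carrier_scale) auto

lemma phi_carrier: "p \<in> sym_alg g \<Longrightarrow> phi p \<in> ext_carrier n g"
proof (induction rule: sym_alg_induct)
  case (const c)
  then show ?case by (auto simp: phi_spconst ext_carrier_def ext_const_def)
next
  case (var k l p)
  then show ?case by (simp add: phi_mult Phi_Lvar om_carrier)
qed (auto simp: phi_add intro: ext_carrier_add)

text \<open>\<open>phi p\<close> is a polynomial in the quadratic elements, so substitution only
  sees the quadratic expressions in \<open>K\<close>. With \<open>K = cre\<close> this gives
  multiplicativity of \<open>phi\<close>, and with \<open>K = mat_cre n M\<close> the invariance of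
  its values.\<close>

lemma subst_op_phi:
  assumes K: "anticommuting K (gens n g)"
    and form: "\<And>i j. i < g \<Longrightarrow> j < g \<Longrightarrow> (\<Sum>a<2*n. K (a,i) * (\<Sum>b<2*n. J a b *\<^sub>L K (b,j))) = om i j"
    and p: "p \<in> sym_alg g"
  shows "ext_op n g K (phi p) = Phi p"
proof -
  interpret anticommuting K "gens n g" by (rule K)
  show ?thesis
    using p
  proof (induction rule: sym_alg_induct)
    case (const c)
    have "ext_const c = ext_scale c vac" by (auto simp: fun_eq_iff ext_scale_def vac_def ext_const_def)
    then show ?case by (simp add: phi_spconst subst_op_scale subst_op_vac)
  next
    case (add p q)
    then show ?case by (simp add: phi_add subst_op_add Phi_add)
  next
    case (var k l p)
    have "subst_op (phi (Lvar k l * p)) = subst_op (\<Sum>a<2*n. app (cre (a,k)) (\<Sum>b<2*n. ext_scale (J a b) (app (cre (b,l)) (phi p))))"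
      using var by (simp add: phi_mult Phi_Lvar om_def up_def app_sum app_mult app_lscale)
    also have "\<dots> = (\<Sum>a<2*n. K (a,k) * (\<Sum>b<2*n. J a b *\<^sub>L (K (b,l) * subst_op (phi p))))"
      using var by (simp add: subst_op_sum subst_op_scale subst_op_cre)
    also have "\<dots> = (\<Sum>a<2*n. K (a,k) * (\<Sum>b<2*n. J a b *\<^sub>L K (b,l))) * subst_op (phi p)"
      by (simp add: sum_distrib_right mult.assoc)
    also have "\<dots> = Phi (Lvar k l * p)"
      using var by (simp add: form Phi_mult Phi_Lvar)
    finally show ?case .
  qed
qed

lemma phi_mult_ext:
  assumes "p \<in> sym_alg g" "q \<in> sym_alg g"
  shows "phi (p * q) = ext_mul (gens n g) (phi p) (phi q)"
proof -
  have "ext_op n g cre (phi p) = Phi p"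
    using assms by (intro subst_op_phi anticommuting_cre) (auto simp: om_def up_def)
  then show ?thesis
    using assms by (simp add: ext_mul_eq_app phi_carrier phi_mult)
qed

text \<open>The coefficients of the transformed quadratic element are the entries of M J
  M^T.\<close>

lemma mat_cre_form:
  assumes M: "\<And>a b. a < 2*n \<Longrightarrow> b < 2*n \<Longrightarrow> (\<Sum>c<2*n. \<Sum>d<2*n. M a c * J c d * M b d) = J a b"
  shows "(\<Sum>a<2*n. mat_cre n M (a,i) * (\<Sum>b<2*n. J a b *\<^sub>L mat_cre n M (b,j))) = om i j"
proof -
  have "(\<Sum>a<2*n. mat_cre n M (a,i) * (\<Sum>b<2*n. J a b *\<^sub>L mat_cre n M (b,j)))
     = (\<Sum>a<2*n. \<Sum>b<2*n. \<Sum>c<2*n. \<Sum>d<2*n. (M c a * J a b * M d b) *\<^sub>L (cre (c,i) * cre (d,j)))"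
  proof -
    have "J a b *\<^sub>L (mat_cre n M (a,i) * mat_cre n M (b,j))
       = (\<Sum>c<2*n. \<Sum>d<2*n. (M c a * J a b * M d b) *\<^sub>L (cre (c,i) * cre (d,j)))" for a b
      by (simp add: mat_cre_def sum_product lscale.scale_sum_right mult_ac)
    then show ?thesis by (simp add: sum_distrib_left)
  qed
  also have "\<dots> = (\<Sum>c<2*n. \<Sum>d<2*n. \<Sum>a<2*n. \<Sum>b<2*n. (M c a * J a b * M d b) *\<^sub>L (cre (c,i) * cre (d,j)))"
    by (rule sum_swap_pairs)
  also have "\<dots> = (\<Sum>c<2*n. \<Sum>d<2*n. J c d *\<^sub>L (cre (c,i) * cre (d,j)))"
    by (intro sum.cong refl) (simp add: lscale.scale_sum_left[symmetric] M)
  finally show ?thesis by (simp add: om_def up_def sum_distrib_left)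
qed

lemma ext_act_phi:
  assumes M: "\<And>a b. a < 2*n \<Longrightarrow> b < 2*n \<Longrightarrow> (\<Sum>c<2*n. \<Sum>d<2*n. M a c * J c d * M b d) = J a b"
    and "p \<in> sym_alg g"
  shows "ext_act n g M (phi p) = phi p"
proof -
  have "ext_op n g (mat_cre n M) (phi p) = Phi p"
    by (rule subst_op_phi[OF anticommuting_mat_cre _ assms(2)]) (rule mat_cre_form[OF M])
  then show ?thesis unfolding ext_act_eq by (simp only: phi_def)
qed

end

section \<open>From the group to the Lie algebra\<close>

lemma bilin_add_left:
  "bilin n Om (\<lambda>b. if b < 2*n then u b + k * v b else 0) w = bilin n Om u w + k * bilin n Om v w"
proof -
  have "bilin n Om (\<lambda>b. if b < 2*n then u b + k * v b else 0) w
    = (\<Sum>a<2*n. \<Sum>b<2*n. u a * Om a b * w b + k * (v a * Om a b * w b))"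
    unfolding bilin_def by (intro sum.cong refl) (auto simp: algebra_simps)
  then show ?thesis by (simp add: bilin_def sum.distrib sum_distrib_left)
qed

lemma bilin_skew:
  assumes "skew_form n Om"
  shows "bilin n Om u v = - bilin n Om v u"
proof -
  have "bilin n Om u v = (\<Sum>b<2*n. \<Sum>a<2*n. u a * Om a b * v b)"
    unfolding bilin_def by (rule sum.swap)
  also have "\<dots> = (\<Sum>b<2*n. \<Sum>a<2*n. - (v b * Om b a * u a))"
    using assms unfolding skew_form_def
    by (intro sum.cong refl) (metis lessThan_iff minus_mult_left minus_mult_right mult.commute mult.assoc)
  finally show ?thesis by (simp add: bilin_def sum_negf)
qed

text \<open>The matrix of u \<mapsto> u + t Om(v,u) v. It is affine in \<open>t\<close>, so its
  derivative is explicit.\<close>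

definition transvection :: "nat \<Rightarrow> (nat \<Rightarrow> nat \<Rightarrow> complex) \<Rightarrow> (nat \<Rightarrow> complex) \<Rightarrow> complex \<Rightarrow> nat \<Rightarrow> nat \<Rightarrow> complex" where
  "transvection n Om v t b a = (if b = a then 1 else 0) + t * (v b * (\<Sum>c<2*n. v c * Om c a))"

lemma mat_app_transvection:
  "mat_app n (transvection n Om v t) u = (\<lambda>b. if b < 2*n then u b + (t * bilin n Om v u) * v b else 0)"
proof
  fix b
  have "(\<Sum>a<2*n. transvection n Om v t b a * u a) = u b + (t * bilin n Om v u) * v b" if "b < 2*n"
  proof -
    have "(\<Sum>a<2*n. transvection n Om v t b a * u a)
      = (\<Sum>a<2*n. (if a = b then u b else 0) + t * v b * (\<Sum>c<2*n. v c * Om c a * u a))"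
      by (intro sum.cong refl) (auto simp: transvection_def algebra_simps sum_distrib_left sum_distrib_right)
    also have "\<dots> = u b + t * v b * (\<Sum>a<2*n. \<Sum>c<2*n. v c * Om c a * u a)"
      using that by (simp add: sum.distrib sum_distrib_left)
    also have "(\<Sum>a<2*n. \<Sum>c<2*n. v c * Om c a * u a) = bilin n Om v u"
      unfolding bilin_def by (rule sum.swap)
    finally show ?thesis by simp
  qed
  then show "mat_app n (transvection n Om v t) u b = (if b < 2*n then u b + (t * bilin n Om v u) * v b else 0)"
    by (simp add: mat_app_def)
qed

text \<open>The two terms linear in \<open>t\<close> cancel by skewness, and the quadratic one
  contains \<open>bilin n Om v v = 0\<close>.\<close>

lemma transvection_Sp:
  assumes "skew_form n Om"
  shows "transvection n Om v t \<in> Sp n Om"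
proof -
  note skew = bilin_skew[OF assms]
  have vv: "bilin n Om v v = 0" using skew[of v v] by simp
  have "bilin n Om (mat_app n (transvection n Om v t) u) (mat_app n (transvection n Om v t) w) = bilin n Om u w" for u w
  proof -
    let ?u = "mat_app n (transvection n Om v t) u" and ?w = "mat_app n (transvection n Om v t) w"
    have r: "bilin n Om x ?w = bilin n Om x w + t * bilin n Om v w * bilin n Om x v" for x
    proof -
      have "bilin n Om x ?w = - bilin n Om ?w x" by (rule skew)
      also have "\<dots> = - bilin n Om w x - t * bilin n Om v w * bilin n Om v x"
        unfolding mat_app_transvection bilin_add_left by simp
      finally show ?thesis using skew[of x w] skew[of x v] by simp
    qed
    have "bilin n Om ?u ?w = bilin n Om u ?w + t * bilin n Om v u * bilin n Om v ?w"
      by (subst (1) mat_app_transvection) (rule bilin_add_left)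
    also have "\<dots> = bilin n Om u w"
      unfolding r using skew[of u v] vv by simp
    finally show ?thesis .
  qed
  then show ?thesis by (simp add: Sp_def)
qed

lemma glV_op_cre:
  assumes "i < g"
  shows "glV_op g b a * cre (x,i) = cre (x,i) * glV_op g b a + (if a = x then cre (b,i) else 0)"
proof -
  have "glV_op g b a * cre (x,i) = cre (x,i) * glV_op g b a + (\<Sum>k<g. if k = i then (if a = x then cre (b,i) else 0) else 0)"
    unfolding glV_op_def sum_distrib_left sum_distrib_right sum.distrib[symmetric]
    by (intro sum.cong) (auto simp: cre_ann_cre)
  then show ?thesis using assms by simp
qed

context sp_form
begin

lemma lowE_cre:
  assumes "i < g" "x < 2*n"
  shows "lowE b c * cre (x,i) = cre (x,i) * lowE b c + Om c x *\<^sub>L cre (b,i)"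
proof -
  have "lowE b c * cre (x,i) = (\<Sum>a<2*n. Om c a *\<^sub>L (cre (x,i) * glV_op g b a + (if a = x then cre (b,i) else 0)))"
    unfolding lowE_def sum_distrib_right by (intro sum.cong) (auto simp: glV_op_cre assms)
  also have "\<dots> = cre (x,i) * lowE b c + (\<Sum>a<2*n. if a = x then Om c x *\<^sub>L cre (b,i) else 0)"
    unfolding lowE_def sum_distrib_left sum.distrib[symmetric]
    by (intro sum.cong) (auto simp: lscale_simps)
  finally show ?thesis using assms by simp
qed

text \<open>The action on the exterior algebra of the endomorphism u \<mapsto> Om(v,u) v, the
  derivative of the transvection. It is quadratic in \<open>v\<close>, and
  \<open>transv_cre v x\<close> is its commutator with \<open>cre x\<close>.\<close>

definition transv_op :: "(nat \<Rightarrow> complex) \<Rightarrow> lop" where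
  "transv_op v = (\<Sum>b<2*n. \<Sum>c<2*n. (v b * v c) *\<^sub>L lowE b c)"

definition transv_cre :: "(nat \<Rightarrow> complex) \<Rightarrow> nat \<times> nat \<Rightarrow> lop" where
  "transv_cre v x = (\<Sum>b<2*n. (v b * (\<Sum>c<2*n. v c * Om c (fst x))) *\<^sub>L cre (b, snd x))"

lemma transv_op_cre:
  assumes "x \<in> gens n g"
  shows "transv_op v * cre x = cre x * transv_op v + transv_cre v x"
proof -
  obtain y i where x: "x = (y,i)" "y < 2*n" "i < g" using assms by (cases x) auto
  have "transv_op v * cre x = (\<Sum>b<2*n. \<Sum>c<2*n. (v b * v c) *\<^sub>L (cre x * lowE b c + Om c y *\<^sub>L cre (b,i)))"
    by (simp add: transv_op_def sum_distrib_right x lowE_cre)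
  also have "\<dots> = cre x * transv_op v + (\<Sum>b<2*n. \<Sum>c<2*n. (v b * (v c * Om c y)) *\<^sub>L cre (b,i))"
    by (simp add: transv_op_def sum_distrib_left sum.distrib lscale_simps mult.assoc)
  also have "(\<Sum>b<2*n. \<Sum>c<2*n. (v b * (v c * Om c y)) *\<^sub>L cre (b,i)) = transv_cre v x"
    by (simp add: transv_cre_def x sum_distrib_left lscale.scale_sum_left)
  finally show ?thesis .
qed

lemma glV_op_vac [simp]: "app (glV_op g' b a) vac = 0"
  by (simp add: glV_op_def app_sum app_mult)

lemma transv_op_vac: "app (transv_op v) vac = 0"
  by (simp add: transv_op_def lowE_def app_sum app_lscale)

lemma mat_cre_transvection:
  assumes "x \<in> gens n g"
  shows "mat_cre n (transvection n Om v t) x = cre x + t *\<^sub>L transv_cre v x"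
proof -
  obtain y i where x: "x = (y,i)" "y < 2*n" "i < g" using assms by (cases x) auto
  have "mat_cre n (transvection n Om v t) x
    = (\<Sum>b<2*n. (if b = y then cre x else 0) + t *\<^sub>L ((v b * (\<Sum>c<2*n. v c * Om c y)) *\<^sub>L cre (b,i)))"
    unfolding mat_cre_def by (intro sum.cong refl) (auto simp: transvection_def x lscale_simps)
  also have "\<dots> = cre x + t *\<^sub>L transv_cre v x"
    unfolding sum.distrib transv_cre_def lscale.scale_sum_right using x by simp
  finally show ?thesis .
qed

lemma cre_deriv:
  assumes "\<And>U. ((\<lambda>t. G t U) has_field_derivative G' U) (at s)"
  shows "((\<lambda>t. app (cre y) (G t) U) has_field_derivative app (cre y) G' U) (at s)"
  unfolding app_cre by (cases "finite U \<and> y \<in> U") (auto intro!: DERIV_cmult assms)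

text \<open>The product rule in \<open>t\<close> and the derivation property of
  \<open>transv_op v\<close> produce the same terms; at the end \<open>transv_op v\<close> reaches
  the vacuum, which it kills.\<close>

lemma word_transvection_deriv:
  assumes "set xs \<subseteq> gens n g"
  shows "((\<lambda>t. app (prod_list (map (mat_cre n (transvection n Om v t)) xs)) vac U) has_field_derivative
     app (transv_op v * prod_list (map cre xs)) vac U) (at 0)"
  using assms
proof (induction xs arbitrary: U)
  case Nil
  then show ?case by (simp add: app_1 transv_op_vac zero_fun_apply)
next
  case (Cons x xs)
  define G where "G = (\<lambda>t. app (prod_list (map (mat_cre n (transvection n Om v t)) xs)) vac)"
  define G' where "G' = app (transv_op v * prod_list (map cre xs)) vac"
  have IH: "((\<lambda>t. G t U) has_field_derivative G' U) (at 0)" for U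
    unfolding G_def G'_def using Cons by simp
  have "map (mat_cre n (transvection n Om v 0)) xs = map cre xs"
    using Cons.prems mat_cre_transvection[of _ v 0] by (auto simp del: split_paired_All)
  then have G0: "G 0 = app (prod_list (map cre xs)) vac" by (simp only: G_def)
  have "((\<lambda>t. app (transv_cre v x) (G t) U) has_field_derivative app (transv_cre v x) G' U) (at 0)"
    unfolding transv_cre_def app_sum app_lscale sum_ext_apply ext_scale_apply
    by (intro DERIV_sum DERIV_cmult cre_deriv IH)
  from DERIV_add[OF cre_deriv[OF IH, where y = x and U = U] DERIV_mult[OF DERIV_ident this]]
  have "((\<lambda>t. app (cre x) (G t) U + t * app (transv_cre v x) (G t) U) has_field_derivative
      app (cre x) G' U + app (transv_cre v x) (G 0) U) (at 0)"
    by simp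
  moreover have "app (prod_list (map (mat_cre n (transvection n Om v t)) (x # xs))) vac U
      = app (cre x) (G t) U + t * app (transv_cre v x) (G t) U" for t
    using Cons.prems
    by (simp add: mat_cre_transvection app_mult app_add app_lscale G_def plus_fun_apply ext_scale_apply)
  moreover have "app (transv_op v * prod_list (map cre (x # xs))) vac U
      = app (cre x) G' U + app (transv_cre v x) (G 0) U"
  proof -
    have "transv_op v * prod_list (map cre (x # xs)) = (transv_op v * cre x) * prod_list (map cre xs)"
      by (simp add: mult.assoc)
    also have "\<dots> = cre x * (transv_op v * prod_list (map cre xs)) + transv_cre v x * prod_list (map cre xs)"
      using Cons.prems by (simp add: transv_op_cre algebra_simps)
    finally show ?thesis by (simp add: app_add app_mult G0 G'_def plus_fun_apply)
  qed
  ultimately show ?case by simp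
qed

text \<open>Differentiating the action of the transvections \<open>1 + t X\<close> at \<open>t = 0\<close> replaces invariance
  under the group by annihilation under its Lie algebra.\<close>
lemma invariants_transv_op:
  assumes skew: "skew_form n Om" and f: "f \<in> invariants n g Om"
  shows "app (transv_op v) f = 0"
proof
  fix U
  interpret C: anticommuting cre "gens n g" by (rule anticommuting_cre) simp
  have fc: "f \<in> ext_carrier n g" using f by (simp add: invariants_def)
  have act: "(\<Sum>S\<in>Pow (gens n g). f S * app (word (mat_cre n (transvection n Om v t)) S) vac U) = f U" for t
  proof -
    interpret anticommuting "mat_cre n (transvection n Om v t)" "gens n g" by (rule anticommuting_mat_cre)
    have "ext_act n g (transvection n Om v t) f = f"
      using f transvection_Sp[OF skew] by (simp add: invariants_def)
    then have "app (subst_op f) vac U = f U" by (simp add: ext_act_eq)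
    then show ?thesis
      unfolding subst_op_def app_sum app_lscale sum_ext_apply ext_scale_apply .
  qed
  have "((\<lambda>t. \<Sum>S\<in>Pow (gens n g). f S * app (word (mat_cre n (transvection n Om v t)) S) vac U)
      has_field_derivative (\<Sum>S\<in>Pow (gens n g). f S * app (transv_op v * word cre S) vac U)) (at 0)"
    unfolding word_def
  proof (intro DERIV_sum DERIV_cmult word_transvection_deriv)
    fix S assume "S \<in> Pow (gens n g)"
    then show "set (sorted_list_of_set S) \<subseteq> gens n g"
      by (auto simp: finite_subset[OF _ finite_gens])
  qed
  then have "(\<Sum>S\<in>Pow (gens n g). f S * app (transv_op v * word cre S) vac U) = 0"
    unfolding act using DERIV_const DERIV_unique by blast
  moreover have "(\<Sum>S\<in>Pow (gens n g). f S * app (transv_op v * word cre S) vac U) = app (transv_op v) (app (C.subst_op f) vac) U"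
    unfolding C.subst_op_def app_sum app_sum_right app_lscale app_scale_right sum_ext_apply ext_scale_apply app_mult ..
  ultimately show "app (transv_op v) f U = 0 U"
    by (simp add: ext_op_cre_vac[OF fc] zero_fun_apply)
qed

text \<open>Annihilation by \<open>sp_op\<close> is governed by commutators, so this space is stable
  under weight projections, contractions and \<open>gl_op\<close>, as the induction
  requires.\<close>

definition lie_invariants :: "ext set" where
  "lie_invariants = {f \<in> ext_carrier n g. \<forall>b<2*n. \<forall>c<2*n. app (sp_op b c) f = 0}"

text \<open>Polarization: the quadratic form v \<mapsto> \<open>transv_op v\<close> f vanishes
  identically. Evaluating it at e_b and at e_b + e_c kills its symmetrized coefficients, which are
  the values of \<open>sp_op b c\<close>.\<close>

lemma invariants_lie_invariants:
  assumes skew: "skew_form n Om" and f: "f \<in> invariants n g Om"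
  shows "f \<in> lie_invariants"
proof -
  define H where "H = (\<lambda>U b c. app (lowE b c) f U)"
  have Q: "(\<Sum>b<2*n. \<Sum>c<2*n. v b * v c * H U b c) = 0" for v U
  proof -
    have "app (transv_op v) f U = (\<Sum>b<2*n. \<Sum>c<2*n. v b * v c * H U b c)"
      by (simp only: transv_op_def app_sum app_lscale sum_ext_apply ext_scale_apply H_def)
    then show ?thesis using invariants_transv_op[OF assms] by (simp add: zero_fun_apply)
  qed
  let ?e = "\<lambda>p x. if x = p then 1 else (0::complex)"
  have e: "(\<Sum>b<2*n. \<Sum>c<2*n. ?e p b * ?e q c * H U b c) = H U p q" if "p < 2*n" "q < 2*n" for p q U
  proof -
    have "(\<Sum>b<2*n. \<Sum>c<2*n. ?e p b * ?e q c * H U b c) = (\<Sum>b<2*n. if b = p then (\<Sum>c<2*n. if c = q then H U p q else 0) else 0)"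
      by (intro sum.cong refl) (auto simp: if_distrib[of "\<lambda>z. z * _"] cong: if_cong)
    then show ?thesis using that by simp
  qed
  have diag: "H U b b = 0" if "b < 2*n" for U b
    using Q[of "?e b" U] e[OF that that] by simp
  have "H U b c + H U c b = 0" if "b < 2*n" "c < 2*n" for U b c
  proof -
    have "(\<Sum>x<2*n. \<Sum>y<2*n. (?e b x + ?e c x) * (?e b y + ?e c y) * H U x y)
       = H U b b + H U b c + H U c b + H U c c"
      unfolding distrib_left distrib_right sum.distrib e[OF that(1) that(1)] e[OF that] e[OF that(2,1)] e[OF that(2,2)]
      by simp
    then show ?thesis using Q[of "\<lambda>x. ?e b x + ?e c x" U] diag that by simp
  qed
  then have "app (sp_op b c) f = 0" if "b < 2*n" "c < 2*n" for b c
    using that by (auto simp: fun_eq_iff sp_op_def app_add plus_fun_apply zero_fun_apply H_def)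
  then show ?thesis using f by (auto simp: lie_invariants_def invariants_def)
qed

end

section \<open>Surjectivity onto the invariants\<close>

lemma of_nat_lop: "(of_nat k :: lop) = of_nat k *\<^sub>L 1"
  by (induction k) (simp_all add: lscale.scale_left_distrib)

lemma of_nat_lop_mult: "of_nat k * F = of_nat k *\<^sub>L (F :: lop)"
  by (simp add: of_nat_lop)

lemma app_of_nat_mult: "app (of_nat k * F) f = ext_scale (of_nat k) (app F f)"
  by (simp add: of_nat_lop_mult app_lscale)

lemma ext_scale_ext_scale: "ext_scale k (ext_scale l f) = ext_scale (k * l) f"
  by (simp add: ext_scale_def mult.assoc)

section \<open>Weights and heights in the exterior algebra\<close>

definition col_wt :: "(nat \<times> nat) set \<Rightarrow> nat \<Rightarrow> nat" where
  "col_wt S i = card {x \<in> S. snd x = i}"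

definition wt_part :: "(nat \<Rightarrow> nat) \<Rightarrow> ext \<Rightarrow> ext" where
  "wt_part w f = (\<lambda>S. if col_wt S = w then f S else 0)"

definition height :: "(nat \<times> nat) set \<Rightarrow> int" where
  "height S = (\<Sum>x\<in>S. int (snd x) + 1)"

text \<open>An upper bound rather than homogeneity, since it survives sums. The bound is strict so
  that 0 bounds only the zero element of the carrier, and integral so that shifts can be
  subtracted.\<close>

definition height_lt :: "int \<Rightarrow> ext \<Rightarrow> bool" where
  "height_lt N f \<longleftrightarrow> (\<forall>S. finite S \<longrightarrow> f S \<noteq> 0 \<longrightarrow> height S < N)"

lemma height_lt_mono: "height_lt N f \<Longrightarrow> N \<le> N' \<Longrightarrow> height_lt N' f"
  by (fastforce simp: height_lt_def)

lemma height_lt_0 [simp]: "height_lt N 0"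
  by (simp add: height_lt_def zero_fun_apply)

lemma height_lt_add: "height_lt N f \<Longrightarrow> height_lt N h \<Longrightarrow> height_lt N (f + h)"
  unfolding height_lt_def plus_fun_apply by (metis add.right_neutral)

lemma height_lt_sum: "(\<And>x. x \<in> A \<Longrightarrow> height_lt N (f x)) \<Longrightarrow> height_lt N (sum f A)"
proof (induction A rule: infinite_finite_induct)
  case (insert x A)
  then show ?case by (metis height_lt_add insertI1 insertI2 sum.insert)
qed (metis height_lt_0 sum.infinite sum.empty)+

lemma height_lt_scale: "height_lt N f \<Longrightarrow> height_lt N (ext_scale k f)"
  by (auto simp: height_lt_def ext_scale_def)

lemma height_lt_cre:
  assumes "height_lt N f"
  shows "height_lt (N + int (snd x) + 1) (app (cre x) f)"
  unfolding height_lt_def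
proof (intro allI impI)
  fix S assume S: "finite S" "app (cre x) f S \<noteq> 0"
  then have x: "x \<in> S" "f (S - {x}) \<noteq> 0" by (auto simp: app_cre split: if_splits)
  then have "height (S - {x}) < N"
    using assms S(1) unfolding height_lt_def by blast
  moreover have "height S = int (snd x) + 1 + height (S - {x})"
    unfolding height_def by (rule sum.remove[OF S(1) x(1)])
  ultimately show "height S < N + int (snd x) + 1" by simp
qed

lemma height_lt_ann:
  assumes "height_lt N f"
  shows "height_lt (N - int (snd x) - 1) (app (ann x) f)"
  unfolding height_lt_def
proof (intro allI impI)
  fix S assume S: "finite S" "app (ann x) f S \<noteq> 0"
  then have x: "x \<notin> S" "f (insert x S) \<noteq> 0" by (auto simp: app_ann split: if_splits)
  then have "height (insert x S) < N"
    using assms S(1) unfolding height_lt_def by blast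
  moreover have "height (insert x S) = int (snd x) + 1 + height S"
    unfolding height_def by (rule sum.insert[OF S(1) x(1)])
  ultimately show "height S < N - int (snd x) - 1" by simp
qed

lemma height_lt_gl_op:
  assumes "height_lt N f"
  shows "height_lt (N + int i - int j) (app (gl_op n i j) f)"
  unfolding gl_op_def app_sum app_mult
proof (intro height_lt_sum)
  fix a
  show "height_lt (N + int i - int j) (app (cre (a,i)) (app (ann (a,j)) f))"
    using height_lt_cre[OF height_lt_ann[OF assms, of "(a,j)"], of "(a,i)"]
    by (rule height_lt_mono) simp
qed

lemma col_wt_move:
  assumes "finite U" "x \<in> U" "y \<notin> U - {x}" "snd x = snd y"
  shows "col_wt (insert y (U - {x})) = col_wt U"
proof
  fix i
  show "col_wt (insert y (U - {x})) i = col_wt U i"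
  proof (cases "i = snd x")
    case True
    have "{z \<in> insert y (U - {x}). snd z = i} = insert y ({z \<in> U. snd z = i} - {x})"
      using assms True by auto
    then show ?thesis using assms True
      by (simp add: col_wt_def card_Suc_Diff1 del: card_Diff_insert)
  next
    case False
    then have "{z \<in> insert y (U - {x}). snd z = i} = {z \<in> U. snd z = i}"
      using assms by auto
    then show ?thesis by (simp add: col_wt_def)
  qed
qed

text \<open>Exchanging two generators with the same W-index does not change the number of generators
  in any column. So operators on the V-factor respect gl(W)-weights.\<close>

lemma wt_part_cre_ann:
  assumes "snd x = snd y"
  shows "app (cre x * ann y) (wt_part w f) = wt_part w (app (cre x * ann y) f)"
proof
  fix U
  show "app (cre x * ann y) (wt_part w f) U = wt_part w (app (cre x * ann y) f) U"
    using col_wt_move[of U x y] assms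
    by (auto simp: app_mult app_cre app_ann wt_part_def)
qed

lemma wt_part_0: "wt_part w 0 = 0"
  and wt_part_add: "wt_part w (f + h) = wt_part w f + wt_part w h"
  and wt_part_scale: "wt_part w (ext_scale k f) = ext_scale k (wt_part w f)"
  by (auto simp: wt_part_def fun_eq_iff zero_fun_apply plus_fun_apply ext_scale_def)

lemma wt_part_sum: "wt_part w (sum f A) = (\<Sum>x\<in>A. wt_part w (f x))" for f :: "'a \<Rightarrow> ext"
proof (induction A rule: infinite_finite_induct)
  case (insert x A)
  then show ?case by (metis (no_types, lifting) wt_part_add sum.insert)
qed (metis wt_part_0 sum.infinite sum.empty)+

lemma wt_part_glV_op: "app (glV_op g b a) (wt_part w f) = wt_part w (app (glV_op g b a) f)"
  unfolding glV_op_def app_sum wt_part_sum by (intro sum.cong refl wt_part_cre_ann) simp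

lemma wt_part_carrier: "f \<in> ext_carrier n g \<Longrightarrow> wt_part w f \<in> ext_carrier n g"
  by (auto simp: ext_carrier_def wt_part_def)

lemma wt_part_height_lt: "height_lt N f \<Longrightarrow> height_lt N (wt_part w f)"
  by (auto simp: height_lt_def wt_part_def)

lemma sum_wt_parts:
  assumes "f \<in> ext_carrier n g"
  shows "(\<Sum>w\<in>col_wt ` Pow (gens n g). wt_part w f) = f"
proof
  fix S
  have "(\<Sum>w\<in>col_wt ` Pow (gens n g). wt_part w f) S = (\<Sum>w\<in>col_wt ` Pow (gens n g). if w = col_wt S then f S else 0)"
    unfolding sum_ext_apply by (intro sum.cong) (auto simp: wt_part_def)
  also have "\<dots> = f S"
    using ext_carrierD[OF assms, of S] by auto
  finally show "(\<Sum>w\<in>col_wt ` Pow (gens n g). wt_part w f) S = f S" .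
qed

text \<open>\<open>cre (a,i) * ann (a,i)\<close> tests whether \<open>(a,i)\<close> lies in the set,
  so the sum over \<open>a\<close> counts column \<open>i\<close>.\<close>

lemma gl_op_diag:
  assumes "f \<in> ext_carrier n g" "i < g"
  shows "app (gl_op n i i) (wt_part w f) = ext_scale (of_nat (w i)) (wt_part w f)"
proof
  fix U
  show "app (gl_op n i i) (wt_part w f) U = ext_scale (of_nat (w i)) (wt_part w f) U"
  proof (cases "wt_part w f U = 0")
    case True
    have "app (cre (a,i) * ann (a,i)) (wt_part w f) U = 0" for a
      using True by (auto simp: app_mult app_cre app_ann insert_absorb)
    then show ?thesis using True by (simp add: gl_op_def app_sum sum_ext_apply ext_scale_apply)
  next
    case False
    then have U: "U \<subseteq> gens n g" "col_wt U = w"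
      using ext_carrierD[OF assms(1), of U] by (auto simp: wt_part_def split: if_splits)
    have fin: "finite U" using U by (auto intro: finite_subset[OF _ finite_gens])
    have "app (cre (a,i) * ann (a,i)) (wt_part w f) U = (if (a,i) \<in> U then wt_part w f U else 0)" for a
      using fin by (auto simp: app_mult app_cre app_ann insert_absorb sgn_at_remove)
    then have "app (gl_op n i i) (wt_part w f) U = (\<Sum>a<2*n. if (a,i) \<in> U then wt_part w f U else 0)"
      by (simp add: gl_op_def app_sum sum_ext_apply)
    also have "\<dots> = of_nat (card {a \<in> {..<2*n}. (a,i) \<in> U}) * wt_part w f U"
      by (subst sum.inter_filter[symmetric]) auto
    also have "card {a \<in> {..<2*n}. (a,i) \<in> U} = col_wt U i"
    proof -
      have "{x \<in> U. snd x = i} = (\<lambda>a. (a,i)) ` {a \<in> {..<2*n}. (a,i) \<in> U}"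
        using U(1) by force
      then show ?thesis by (simp add: col_wt_def card_image inj_on_def)
    qed
    finally show ?thesis by (simp add: U ext_scale_apply)
  qed
qed

lemma col_wt_le:
  assumes "S \<subseteq> gens n g"
  shows "col_wt S i \<le> 2*n"
proof -
  have "{x \<in> S. snd x = i} \<subseteq> (\<lambda>a. (a,i)) ` {..<2*n}" using assms by force
  from card_mono[OF _ this] have "col_wt S i \<le> card ((\<lambda>a. (a,i)) ` {..<2*n})"
    by (simp add: col_wt_def)
  also have "\<dots> \<le> card {..<2*n}" by (rule card_image_le) simp
  finally show ?thesis by simp
qed

text \<open>The eigenvalue of the Casimir operator on highest weight vectors of weight \<open>w\<close>. The truncated
  subtraction is exact if \<open>w i \<le> 2n\<close>.\<close>
definition casimir_val :: "nat \<Rightarrow> nat \<Rightarrow> (nat \<Rightarrow> nat) \<Rightarrow> nat" where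
  "casimir_val n g w = (\<Sum>i<g. w i * (2*n + 2*i + 2 - w i))"

lemma casimir_val_pos:
  assumes "\<And>i. i < g \<Longrightarrow> w i \<le> 2*n" "i < g" "w i \<noteq> 0"
  shows "casimir_val n g w \<noteq> 0"
proof
  assume "casimir_val n g w = 0"
  then have "w i * (2*n + 2*i + 2 - w i) = 0" using assms(2) by (simp add: casimir_val_def)
  then show False using assms(1)[OF assms(2)] assms(3) by simp
qed

section \<open>The Casimir identity on weight vectors and surjectivity\<close>

context sp_form
begin

text \<open>Both the commutator with \<open>gl_op\<close> and \<open>gl_der\<close> obey the Leibniz
  rule, and they agree on variables by \<open>gl_op_om\<close>. Since \<open>gl_op\<close> kills the
  vacuum, \<open>phi\<close> intertwines the two actions of gl(W).\<close>

lemma gl_op_Phi: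
  assumes "p \<in> sym_alg g" "i < g" "j < g"
  shows "gl_op n i j * Phi p = Phi p * gl_op n i j + Phi (gl_der i j p)"
  using assms(1)
proof (induction rule: sym_alg_induct)
  case (var k l p)
  have "gl_op n i j * (om k l * Phi p) = om k l * Phi p * gl_op n i j
      + (((if k = j then om i l else 0) + (if l = j then om k i else 0)) * Phi p + om k l * Phi (gl_der i j p))"
    by (rule derivation_mult[OF gl_op_om var.IH])
  moreover have "Phi (gl_der i j (Lvar k l)) = (if k = j then om i l else 0) + (if l = j then om k i else 0)"
    using var assms by (simp add: gl_der_Lvar Phi_add Phi_Lvar)
  ultimately show ?case using var
    by (simp add: gl_der_mult Phi_add Phi_mult Phi_Lvar)
qed (simp_all add: gl_der_add Phi_add algebra_simps)

lemma gl_op_vac: "app (gl_op n i j) vac = 0"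
  by (simp add: gl_op_def app_sum app_mult)

lemma gl_op_phi:
  assumes "p \<in> sym_alg g" "i < g" "j < g"
  shows "app (gl_op n i j) (phi p) = phi (gl_der i j p)"
proof -
  have "app (gl_op n i j * Phi p) vac = app (Phi p * gl_op n i j + Phi (gl_der i j p)) vac"
    by (simp only: gl_op_Phi[OF assms])
  then show ?thesis by (simp add: app_add app_mult phi_def gl_op_vac)
qed

lemma wt_part_lie_invariants:
  assumes "f \<in> lie_invariants"
  shows "wt_part w f \<in> lie_invariants"
proof -
  have "app (sp_op b c) (wt_part w f) = wt_part w (app (sp_op b c) f)" for b c
    by (simp add: sp_op_def lowE_def app_add app_sum app_lscale wt_part_glV_op wt_part_sum
        wt_part_scale wt_part_add)
  then show ?thesis using assms by (simp add: lie_invariants_def wt_part_carrier wt_part_0)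
qed

lemma gl_op_lie_invariants:
  assumes "f \<in> lie_invariants" "i < g" "j < g"
  shows "app (gl_op n i j) f \<in> lie_invariants"
proof -
  have "app (sp_op b c) (app (gl_op n i j) f) = 0" if "b < 2*n" "c < 2*n" for b c
  proof -
    have "app (sp_op b c * gl_op n i j) f = app (gl_op n i j * sp_op b c) f"
      using sp_op_gl_op assms that by simp
    then show ?thesis using assms(1) that by (simp add: app_mult lie_invariants_def)
  qed
  moreover have "app (gl_op n i j) f \<in> ext_carrier n g"
    unfolding gl_op_def app_sum app_mult using assms
    by (intro ext_carrier_sum cre_carrier ann_carrier) (auto simp: lie_invariants_def)
  ultimately show ?thesis by (simp add: lie_invariants_def)
qed

lemma dl_lie_invariants:
  assumes "f \<in> lie_invariants" "i < g" "j < g"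
  shows "app (dl i j) f \<in> lie_invariants"
proof -
  have "app (sp_op b c) (app (dl i j) f) = 0" if "b < 2*n" "c < 2*n" for b c
  proof -
    have "app (sp_op b c * dl i j) f = app (dl i j * sp_op b c) f"
      using sp_op_dl assms that by simp
    then show ?thesis using assms(1) that by (simp add: app_mult lie_invariants_def)
  qed
  moreover have "app (dl i j) f \<in> ext_carrier n g"
    unfolding dl_def low_def app_sum app_mult app_lscale using assms
    by (intro ext_carrier_sum ann_carrier ext_carrier_scale) (auto simp: lie_invariants_def)
  ultimately show ?thesis by (simp add: lie_invariants_def)
qed

lemma height_lt_dl:
  assumes "height_lt N f"
  shows "height_lt (N - int i - int j - 2) (app (dl i j) f)"
  unfolding dl_def low_def app_sum app_mult app_lscale
proof (intro height_lt_sum)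
  fix a
  have "height_lt (N - int j - 1) (\<Sum>b<2*n. ext_scale (Om a b) (app (ann (b,j)) f))"
    using height_lt_ann[OF assms] by (intro height_lt_sum height_lt_scale) (metis snd_conv)
  from height_lt_ann[OF this, of "(a,i)"]
  show "height_lt (N - int i - int j - 2) (app (ann (a,i)) (\<Sum>b<2*n. ext_scale (Om a b) (app (ann (b,j)) f)))"
    by (rule height_lt_mono) simp
qed

text \<open>The reordering subtracts g - 2i - 1 from the coefficient 2n+g+1 of
  \<open>gl_op n i i\<close>, leaving 2n+2i+2.\<close>

lemma om_dl_reordered:
  "(\<Sum>i<g. \<Sum>j<g. om i j * dl i j) =
     (\<Sum>i<g. of_nat (2*n + 2*i + 2) * gl_op n i i - gl_op n i i * gl_op n i i)
     - 2 * (\<Sum>i<g. \<Sum>j\<in>{i<..<g}. gl_op n j i * gl_op n i j)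
     - (\<Sum>b<2*n. \<Sum>a<2*n. glV_op g b a * (\<Sum>d<2*n. J b d *\<^sub>L sp_op d a))"
proof -
  let ?h = "\<lambda>i. gl_op n i i" and ?G = "\<lambda>i j. gl_op n j i * gl_op n i j"
  have "(\<Sum>i<g. \<Sum>j<g. ?G i j) + (\<Sum>i<g. of_nat (2*i+1) * ?h i)
    = (\<Sum>i<g. ?G i i) + 2 * (\<Sum>i<g. \<Sum>j\<in>{i<..<g}. ?G i j) + of_nat g * (\<Sum>i<g. ?h i)"
    by (rule sum_commutator_reorder) (rule gl_op_commutator)
  then have "(\<Sum>i<g. \<Sum>j<g. ?G i j) = (\<Sum>i<g. ?G i i) + 2 * (\<Sum>i<g. \<Sum>j\<in>{i<..<g}. ?G i j)
     + of_nat g * (\<Sum>i<g. ?h i) - (\<Sum>i<g. of_nat (2*i+1) * ?h i)"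
    by (simp add: eq_diff_eq)
  moreover have "of_nat (2*n + g + 1) * (\<Sum>i<g. ?h i) = (\<Sum>i<g. of_nat (2*n + 2*i + 2) * ?h i)
     + of_nat g * (\<Sum>i<g. ?h i) - (\<Sum>i<g. of_nat (2*i+1) * ?h i)"
    unfolding sum_distrib_left sum.distrib[symmetric] sum_subtractf[symmetric]
    by (intro sum.cong refl) (simp add: algebra_simps)
  ultimately show ?thesis
    unfolding om_dl_casimir by (simp only: sum_subtractf) simp
qed

text \<open>On \<open>lie_invariants\<close> the \<open>sp_op\<close> sum vanishes and the diagonal
  operators act by scalars. What remains expresses a multiple of the weight part through vectors of
  smaller height.\<close>

lemma casimir_wt_part:
  assumes f: "f \<in> lie_invariants" and w: "\<And>i. i < g \<Longrightarrow> w i \<le> 2*n"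
  shows "ext_scale (of_nat (casimir_val n g w)) (wt_part w f) =
     (\<Sum>i<g. \<Sum>j<g. app (om i j) (app (dl i j) (wt_part w f)))
     + ext_scale 2 (\<Sum>i<g. \<Sum>j\<in>{i<..<g}. app (gl_op n j i) (app (gl_op n i j) (wt_part w f)))"
proof -
  let ?f = "wt_part w f"
  have fc: "f \<in> ext_carrier n g" using f by (simp add: lie_invariants_def)
  have sp: "app (sp_op b c) ?f = 0" if "b < 2*n" "c < 2*n" for b c
    using wt_part_lie_invariants[OF f] that by (simp add: lie_invariants_def)
  have sp0: "app (\<Sum>b<2*n. \<Sum>a<2*n. glV_op g b a * (\<Sum>d<2*n. J b d *\<^sub>L sp_op d a)) ?f = 0"
    by (simp add: app_sum app_mult app_lscale sp)
  have diag: "app (\<Sum>i<g. of_nat (2*n + 2*i + 2) * gl_op n i i - gl_op n i i * gl_op n i i) ?f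
     = ext_scale (of_nat (casimir_val n g w)) ?f"
  proof
    fix U
    have "app (of_nat (2*n + 2*i + 2) * gl_op n i i - gl_op n i i * gl_op n i i) ?f U
      = of_nat (w i * (2*n + 2*i + 2 - w i)) * ?f U" if "i < g" for i
    proof -
      have e: "app (of_nat (2*n + 2*i + 2) * gl_op n i i - gl_op n i i * gl_op n i i) ?f
        = ext_scale (of_nat (2*n + 2*i + 2)) (ext_scale (of_nat (w i)) ?f) - ext_scale (of_nat (w i)) (ext_scale (of_nat (w i)) ?f)"
        unfolding app_diff app_of_nat_mult by (simp only: app_mult gl_op_diag[OF fc that] app_scale_right)
      have "of_nat (2*n + 2*i + 2 - w i) = (of_nat (2*n + 2*i + 2) - of_nat (w i) :: complex)"
        using w[OF that] by (intro of_nat_diff) simp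
      then have "of_nat (w i * (2*n + 2*i + 2 - w i)) * ?f U
        = of_nat (2*n + 2*i + 2) * (of_nat (w i) * ?f U) - of_nat (w i) * (of_nat (w i) * ?f U)"
        by (simp only: of_nat_mult) (simp only: left_diff_distrib right_diff_distrib mult_ac)
      then show ?thesis
        unfolding e by (simp only: fun_diff_def ext_scale_apply)
    qed
    then show "app (\<Sum>i<g. of_nat (2*n + 2*i + 2) * gl_op n i i - gl_op n i i * gl_op n i i) ?f U
     = ext_scale (of_nat (casimir_val n g w)) ?f U"
      by (simp add: app_sum sum_ext_apply ext_scale_apply casimir_val_def sum_distrib_right)
  qed
  have two: "app (2 * F) h = ext_scale 2 (app F h)" for F h
    using app_of_nat_mult[of 2 F h] by simp
  have "app (\<Sum>i<g. \<Sum>j<g. om i j * dl i j) ?f = ext_scale (of_nat (casimir_val n g w)) ?f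
    - ext_scale 2 (\<Sum>i<g. \<Sum>j\<in>{i<..<g}. app (gl_op n j i) (app (gl_op n i j) ?f))"
    unfolding om_dl_reordered app_diff diag sp0 two by (simp add: app_sum app_mult)
  then show ?thesis by (simp add: app_sum app_mult)
qed

lemma phi_image_add: "f \<in> phi ` sym_alg g \<Longrightarrow> h \<in> phi ` sym_alg g \<Longrightarrow> f + h \<in> phi ` sym_alg g"
proof -
  assume "f \<in> phi ` sym_alg g" "h \<in> phi ` sym_alg g"
  then obtain p q where "p \<in> sym_alg g" "q \<in> sym_alg g" "f = phi p" "h = phi q" by blast
  then have "f + h = phi (p + q)" "p + q \<in> sym_alg g" by (simp_all only: phi_add sym_alg_add)
  then show ?thesis by (rule image_eqI)
qed

lemma phi_image_0: "0 \<in> phi ` sym_alg g"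
  by (rule image_eqI[where x = 0]) simp_all

lemma phi_image_sum: "(\<And>x. x \<in> A \<Longrightarrow> f x \<in> phi ` sym_alg g) \<Longrightarrow> sum f A \<in> phi ` sym_alg g"
proof (induction A rule: infinite_finite_induct)
  case (insert x A)
  then show ?case by (metis phi_image_add insertI1 insertI2 sum.insert)
qed (metis phi_image_0 sum.infinite sum.empty)+

lemma phi_scale: "phi (spconst c * p) = ext_scale c (phi p)"
  by (simp add: phi_def Phi_mult app_lscale app_1)

lemma phi_image_scale: "f \<in> phi ` sym_alg g \<Longrightarrow> ext_scale c f \<in> phi ` sym_alg g"
  using phi_scale[of c, symmetric] by (auto intro!: imageI sym_alg_mult)

theorem lie_invariants_subset_phi:
  assumes "f \<in> lie_invariants"
  shows "f \<in> phi ` sym_alg g"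
proof -
  have "\<forall>f\<in>lie_invariants. height_lt (int N) f \<longrightarrow> f \<in> phi ` sym_alg g" for N
  proof (induction N)
    case 0
    show ?case
    proof (intro ballI impI)
      fix f assume f: "f \<in> lie_invariants" "height_lt (int 0) f"
      have "f S = 0" for S
      proof (rule ccontr)
        assume nz: "f S \<noteq> 0"
        have fin: "finite S"
          using f(1) ext_carrierD[of f n g S] nz unfolding lie_invariants_def
          by (blast intro: finite_subset[OF _ finite_gens])
        have "height S < int 0" using f(2) fin nz unfolding height_lt_def by blast
        moreover have "height S \<ge> 0" unfolding height_def by (intro sum_nonneg) simp
        ultimately show False by simp
      qed
      then have "f = 0" by (intro ext) (simp only: zero_fun_apply)
      then show "f \<in> phi ` sym_alg g" by (simp only: phi_image_0)
    qed
  next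
    case (Suc N)
    show ?case
    proof (intro ballI impI)
      fix f assume f: "f \<in> lie_invariants" "height_lt (int (Suc N)) f"
      have fc: "f \<in> ext_carrier n g" using f by (simp add: lie_invariants_def)
      have "wt_part w f \<in> phi ` sym_alg g" if "w \<in> col_wt ` Pow (gens n g)" for w
      proof -
        \<comment> \<open>Only weights of actual sets of generators occur, and a column has 2n
          elements; this bound makes the Casimir value positive.\<close>
        obtain S where S: "S \<subseteq> gens n g" "w = col_wt S" using \<open>w \<in> _\<close> by auto
        have w: "w i \<le> 2*n" for i using col_wt_le[OF S(1)] S(2) by simp
        let ?f = "wt_part w f"
        note inv = wt_part_lie_invariants[OF f(1), of w] and ht = wt_part_height_lt[OF f(2), of w]
        show ?thesis
        proof (cases "\<exists>i<g. w i \<noteq> 0")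
          case True
          then have nz: "casimir_val n g w \<noteq> 0" using casimir_val_pos w by blast
          have "app (om i j) (app (dl i j) ?f) \<in> phi ` sym_alg g" if ij: "i < g" "j < g" for i j
          proof -
            have "height_lt (int N) (app (dl i j) ?f)"
              using height_lt_dl[OF ht, of i j] by (rule height_lt_mono) simp
            then obtain p where p: "p \<in> sym_alg g" "app (dl i j) ?f = phi p"
              using Suc.IH dl_lie_invariants[OF inv ij] by blast
            then have "app (om i j) (app (dl i j) ?f) = phi (Lvar i j * p)"
              using ij by (simp add: phi_mult Phi_Lvar)
            then show ?thesis using p(1) ij by (auto intro!: imageI sym_alg_mult)
          qed
          moreover have "app (gl_op n j i) (app (gl_op n i j) ?f) \<in> phi ` sym_alg g" if ij: "i < j" "j < g" for i j
          proof -
            have "height_lt (int N) (app (gl_op n i j) ?f)"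
              using height_lt_gl_op[OF ht, of i j n] by (rule height_lt_mono) (use ij in simp)
            then obtain p where p: "p \<in> sym_alg g" "app (gl_op n i j) ?f = phi p"
              using Suc.IH gl_op_lie_invariants[OF inv, of i j] ij by (metis imageE less_trans)
            then have "app (gl_op n j i) (app (gl_op n i j) ?f) = phi (gl_der j i p)"
              using ij by (simp add: gl_op_phi)
            then show ?thesis using p(1) ij by (auto intro!: imageI gl_der_sym_alg)
          qed
          ultimately have "(\<Sum>i<g. \<Sum>j<g. app (om i j) (app (dl i j) ?f)) \<in> phi ` sym_alg g"
            and "(\<Sum>i<g. \<Sum>j\<in>{i<..<g}. app (gl_op n j i) (app (gl_op n i j) ?f)) \<in> phi ` sym_alg g"
            by (auto intro!: phi_image_sum)
          then have "ext_scale (of_nat (casimir_val n g w)) ?f \<in> phi ` sym_alg g"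
            unfolding casimir_wt_part[OF f(1) w] by (rule phi_image_add[OF _ phi_image_scale])
          from phi_image_scale[OF this, of "inverse (of_nat (casimir_val n g w))"]
          show ?thesis using nz by (simp add: ext_scale_ext_scale)
        next
          case False
          \<comment> \<open>The Casimir value is 0 for weight zero, so this case is settled
            directly: only the empty set has all its columns empty.\<close>
          have "?f = ext_const (?f {})"
          proof
            fix T
            have "?f T = 0" if "T \<noteq> {}"
            proof (rule ccontr)
              assume nz: "?f T \<noteq> 0"
              then have T: "T \<subseteq> gens n g" "col_wt T = w"
                using ext_carrierD[OF fc, of T] by (auto simp: wt_part_def split: if_splits)
              from that obtain x where x: "x \<in> T" by auto
              then have "snd x < g" using T(1) by (cases x) auto
              then have "col_wt T (snd x) = 0" using False T(2) by auto
              moreover have "finite {y \<in> T. snd y = snd x}" using T(1) by (auto intro: finite_subset[OF _ finite_gens])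
              ultimately have "{y \<in> T. snd y = snd x} = {}" by (simp only: col_wt_def card_0_eq)
              then show False using x by blast
            qed
            then show "?f T = ext_const (?f {}) T" by (auto simp: ext_const_def)
          qed
          then have "?f = phi (spconst (?f {}))" by (simp add: phi_spconst)
          then show ?thesis by (metis imageI sym_alg_spconst)
        qed
      qed
      then have "(\<Sum>w\<in>col_wt ` Pow (gens n g). wt_part w f) \<in> phi ` sym_alg g"
        by (rule phi_image_sum)
      then show "f \<in> phi ` sym_alg g" by (simp add: sum_wt_parts[OF fc])
    qed
  qed
  \<comment> \<open>The full set of generators has the largest height, which supplies the starting
    bound.\<close>
  moreover have "height_lt (height (gens n g) + 1) f"
    unfolding height_lt_def
  proof (intro allI impI)
    fix S assume "finite S" "f S \<noteq> 0"
    then have "S \<subseteq> gens n g" using assms by (auto simp: lie_invariants_def dest: ext_carrierD)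
    then have "height S \<le> height (gens n g)"
      unfolding height_def by (intro sum_mono2) auto
    then show "height S < height (gens n g) + 1" by simp
  qed
  then have "height_lt (int (nat (height (gens n g) + 1))) f"
    by (rule height_lt_mono) simp
  ultimately show ?thesis using assms by blast
qed

end

section \<open>Hafnians\<close>

text \<open>The pairings of \<open>Pk\<close>, on any set of positions: the recursion deletes an
  arbitrary pair, after which the positions no longer form an initial segment.\<close>

definition matchings :: "nat set \<Rightarrow> nat set set set" where
  "matchings A = {M. \<Union>M = A \<and> (\<forall>p\<in>M. card p = 2) \<and> (\<forall>p\<in>M. \<forall>q\<in>M. p \<noteq> q \<longrightarrow> p \<inter> q = {})}"

text \<open>The hafnian of the symmetric matrix with entries
  \<open>Lvar (x a) (x b)\<close>.\<close>

definition haf :: "nat set \<Rightarrow> (nat \<Rightarrow> nat) \<Rightarrow> spoly" where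
  "haf A x = (\<Sum>M\<in>matchings A. \<Prod>p\<in>M. Lvar (x (Min p)) (x (Max p)))"

lemma Pk_eq_haf: "Pk k xs = haf {0..<2*k} (\<lambda>i. xs ! i)"
  by (simp add: Pk_def haf_def pairings_def matchings_def)

lemma finite_matchings: "finite A \<Longrightarrow> finite (matchings A)"
  by (rule finite_subset[of _ "Pow (Pow A)"]) (auto simp: matchings_def)

lemma matchings_finite: "finite A \<Longrightarrow> M \<in> matchings A \<Longrightarrow> finite M"
  by (rule finite_UnionD) (auto simp: matchings_def)

lemma matchings_empty: "matchings {} = {{}}"
  unfolding matchings_def by (auto simp: Union_empty_conv) (metis card.empty zero_neq_numeral)

lemma haf_empty [simp]: "haf {} x = 1"
  by (simp add: haf_def matchings_empty)

lemma matchings_expand: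
  assumes "a \<in> A"
  shows "matchings A = (\<Union>b\<in>A - {a}. insert {a,b} ` matchings (A - {a,b}))"
proof (intro equalityI subsetI)
  fix M assume M: "M \<in> matchings A"
  then obtain p where p: "p \<in> M" "a \<in> p" "card p = 2" using assms by (auto simp: matchings_def)
  then obtain b where b: "p = {a,b}" "a \<noteq> b" by (metis card_2_iff doubleton_eq_iff insertE singletonD)
  have disj: "q \<inter> p = {}" if "q \<in> M" "q \<noteq> p" for q
    using M p(1) that unfolding matchings_def by blast
  have "\<Union>(M - {p}) = A - p"
  proof -
    have "\<Union>M = A" using M by (simp add: matchings_def)
    then show ?thesis using disj p(1) by blast
  qed
  then have "M - {p} \<in> matchings (A - {a,b})"
    using M b(1) unfolding matchings_def by simp
  moreover have "M = insert p (M - {p})" using p(1) by blast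
  moreover have "b \<in> A - {a}" using M p(1) b unfolding matchings_def by blast
  ultimately show "M \<in> (\<Union>b\<in>A - {a}. insert {a,b} ` matchings (A - {a,b}))"
    using b(1) by blast
next
  fix M assume "M \<in> (\<Union>b\<in>A - {a}. insert {a,b} ` matchings (A - {a,b}))"
  then obtain b M' where b: "b \<in> A" "b \<noteq> a" and M': "M' \<in> matchings (A - {a,b})" "M = insert {a,b} M'"
    by auto
  have sub: "q \<subseteq> A - {a,b}" if "q \<in> M'" for q using M'(1) that unfolding matchings_def by blast
  have "\<Union>M = A" using M' b assms unfolding matchings_def by auto
  moreover have "\<forall>p\<in>M. card p = 2" using M' b unfolding matchings_def by auto
  moreover have "p \<inter> q = {}" if "p \<in> M" "q \<in> M" "p \<noteq> q" for p q
  proof -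
    have "p \<inter> q = {}" if "p \<in> M'" "q \<in> M'" using M'(1) that \<open>p \<noteq> q\<close> unfolding matchings_def by blast
    then show ?thesis using that M'(2) sub[of p] sub[of q] by blast
  qed
  ultimately show "M \<in> matchings A" unfolding matchings_def by blast
qed

text \<open>Matchings are sorted by the partner \<open>b\<close> of a chosen position
  \<open>a\<close>. This row expansion replaces direct work with matchings in the inductions
  below.\<close>

lemma haf_expand:
  assumes "finite A" "a \<in> A"
  shows "haf A x = (\<Sum>b\<in>A - {a}. Lvar (x a) (x b) * haf (A - {a,b}) x)"
proof -
  let ?w = "\<lambda>p. Lvar (x (Min p)) (x (Max p))"
  have notin: "{a,c} \<notin> M" if "M \<in> matchings (A - {a,b})" for M b c
    using that unfolding matchings_def by blast
  have "haf A x = (\<Sum>b\<in>A - {a}. \<Sum>M\<in>insert {a,b} ` matchings (A - {a,b}). prod ?w M)"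
    unfolding haf_def matchings_expand[OF assms(2)]
  proof (rule sum.UNION_disjoint)
    show "\<forall>b\<in>A - {a}. \<forall>c\<in>A - {a}. b \<noteq> c \<longrightarrow>
      insert {a,b} ` matchings (A - {a,b}) \<inter> insert {a,c} ` matchings (A - {a,c}) = {}"
    proof (intro ballI impI, rule ccontr)
      fix b c assume bc: "b \<in> A - {a}" "c \<in> A - {a}" "b \<noteq> c"
        and "insert {a,b} ` matchings (A - {a,b}) \<inter> insert {a,c} ` matchings (A - {a,c}) \<noteq> {}"
      then obtain M M' where "M \<in> matchings (A - {a,b})" and eq: "insert {a,b} M = insert {a,c} M'" by blast
      have "{a,c} \<in> insert {a,b} M" unfolding eq by simp
      then have "{a,c} = {a,b} \<or> {a,c} \<in> M" by simp
      then show False using notin[OF \<open>M \<in> _\<close>] bc by (auto simp: doubleton_eq_iff)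
    qed
  qed (use assms finite_matchings in auto)
  also have "\<dots> = (\<Sum>b\<in>A - {a}. \<Sum>M\<in>matchings (A - {a,b}). prod ?w (insert {a,b} M))"
  proof (rule sum.cong[OF refl])
    fix b
    have "inj_on (insert {a,b}) (matchings (A - {a,b}))"
    proof (rule inj_onI)
      fix M M' assume "M \<in> matchings (A - {a,b})" "M' \<in> matchings (A - {a,b})" "insert {a,b} M = insert {a,b} M'"
      then show "M = M'" using notin by (metis insert_ident)
    qed
    then show "(\<Sum>M\<in>insert {a,b} ` matchings (A - {a,b}). prod ?w M) = (\<Sum>M\<in>matchings (A - {a,b}). prod ?w (insert {a,b} M))"
      by (simp add: sum.reindex)
  qed
  also have "\<dots> = (\<Sum>b\<in>A - {a}. Lvar (x a) (x b) * haf (A - {a,b}) x)"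
  proof (rule sum.cong[OF refl])
    fix b assume b: "b \<in> A - {a}"
    have w: "?w {a,b} = Lvar (x a) (x b)"
      by (cases "a \<le> b") (simp_all add: min_def max_def Lvar_commute)
    have "prod ?w (insert {a,b} M) = Lvar (x a) (x b) * prod ?w M" if "M \<in> matchings (A - {a,b})" for M
    proof -
      have "finite M" using that assms(1) by (intro matchings_finite[of "A - {a,b}"]) auto
      then show ?thesis using notin[OF that, of b] w by simp
    qed
    then show "(\<Sum>M\<in>matchings (A - {a,b}). prod ?w (insert {a,b} M)) = Lvar (x a) (x b) * haf (A - {a,b}) x"
      unfolding haf_def sum_distrib_left by (rule sum.cong[OF refl])
  qed
  finally show ?thesis .
qed

lemma haf_cong:
  assumes "\<And>a. a \<in> A \<Longrightarrow> x a = y a"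
  shows "haf A x = haf A y"
  unfolding haf_def
proof (intro sum.cong prod.cong refl)
  fix M p assume "M \<in> matchings A" "p \<in> M"
  then have p: "p \<subseteq> A" "card p = 2" unfolding matchings_def by auto
  then have "finite p" "p \<noteq> {}" by (auto intro: card_ge_0_finite)
  then have "Min p \<in> A" "Max p \<in> A" using p(1) Min_in[of p] Max_in[of p] by blast+
  then show "Lvar (x (Min p)) (x (Max p)) = Lvar (y (Min p)) (y (Max p))" using assms by simp
qed

text \<open>The order of positions enters only through \<open>Min\<close> and \<open>Max\<close>,
  and \<open>Lvar\<close> is symmetric; so hafnians are invariant under relabelling.\<close>

lemma haf_reindex:
  assumes "finite A" "bij_betw s A B"
  shows "haf A (\<lambda>a. y (s a)) = haf B y"
  using assms
proof (induction "card A" arbitrary: A B rule: less_induct)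
  case less
  show ?case
  proof (cases "A = {}")
    case False
    then obtain a where a: "a \<in> A" by auto
    have B: "finite B" "s a \<in> B" using less.prems a bij_betw_finite bij_betw_apply by auto
    have inj: "inj_on s A" and img: "s ` A = B" using less.prems by (auto simp: bij_betw_def)
    have IH: "haf (A - {a,b}) (\<lambda>a. y (s a)) = haf (B - {s a, s b}) y" if "b \<in> A - {a}" for b
    proof (rule less.hyps)
      show "card (A - {a,b}) < card A" using a less.prems(1) by (intro psubset_card_mono) auto
      show "bij_betw s (A - {a,b}) (B - {s a, s b})"
        unfolding bij_betw_def using inj img a that
        by (auto simp: inj_on_def)
    qed (use less.prems in auto)
    have bij: "bij_betw s (A - {a}) (B - {s a})"
      unfolding bij_betw_def using inj img a by (auto simp: inj_on_def)
    have "haf A (\<lambda>a. y (s a)) = (\<Sum>b\<in>A - {a}. Lvar (y (s a)) (y (s b)) * haf (B - {s a, s b}) y)"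
      unfolding haf_expand[OF less.prems(1) a] by (intro sum.cong refl) (simp add: IH)
    also have "\<dots> = (\<Sum>b\<in>B - {s a}. Lvar (y (s a)) (y b) * haf (B - {s a, b}) y)"
      by (rule sum.reindex_bij_betw[OF bij])
    also have "\<dots> = haf B y" by (rule haf_expand[OF B, symmetric])
    finally show ?thesis .
  qed (use less.prems in \<open>auto simp: bij_betw_def\<close>)
qed

text \<open>Equivariance of the embedding under gl(W): a derivation replaces the index
  \<open>i\<close> by \<open>j\<close> at one position at a time.\<close>

lemma haf_gl_der:
  assumes "finite A"
  shows "gl_der j i (haf A x) = (\<Sum>l\<in>A. if x l = i then haf A (x(l := j)) else 0)"
  using assms
proof (induction "card A" arbitrary: A rule: less_induct)
  case less
  show ?case
  proof (cases "A = {}")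
    case False
    then obtain a where a: "a \<in> A" by auto
    let ?A = "A - {a}"
    \<comment> \<open>The term in which \<open>a\<close> is paired with \<open>b\<close> and
      position \<open>l\<close> is replaced. For \<open>l = b\<close> it stems from differentiating
      the factor \<open>Lvar (x a) (x b)\<close>, otherwise from the smaller hafnian.\<close>
    define T where "T = (\<lambda>l b. if x l = i then Lvar (x a) ((x(l := j)) b) * haf (A - {a,b}) (x(l := j)) else 0)"
    have IH: "gl_der j i (haf (A - {a,b}) x) = (\<Sum>l\<in>A - {a,b}. if x l = i then haf (A - {a,b}) (x(l := j)) else 0)"
      for b using a less.prems by (intro less.hyps psubset_card_mono) auto
    have rest: "(if x l = i then haf A (x(l := j)) else 0) = (\<Sum>b\<in>?A. T l b)" if "l \<in> ?A" for l
      using that by (simp add: T_def haf_expand[OF less.prems a])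
    have first: "haf A (x(a := j)) = (\<Sum>b\<in>?A. Lvar j (x b) * haf (A - {a,b}) x)"
      unfolding haf_expand[OF less.prems a]
      by (intro sum.cong refl arg_cong2[of _ _ _ _ times] haf_cong) auto
    have diag: "T b b = (if x b = i then Lvar (x a) j * haf (A - {a,b}) x else 0)" for b
    proof -
      have "haf (A - {a,b}) (x(b := j)) = haf (A - {a,b}) x" by (rule haf_cong) auto
      then show ?thesis by (simp add: T_def)
    qed
    have off: "T l b = Lvar (x a) (x b) * (if x l = i then haf (A - {a,b}) (x(l := j)) else 0)" if "l \<in> A - {a,b}" for l b
      using that by (auto simp: T_def)
    have "gl_der j i (haf A x) = (\<Sum>b\<in>?A. gl_der j i (Lvar (x a) (x b)) * haf (A - {a,b}) x
       + Lvar (x a) (x b) * gl_der j i (haf (A - {a,b}) x))"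
      unfolding haf_expand[OF less.prems a] gl_der_sum gl_der_mult ..
    also have "\<dots> = (\<Sum>b\<in>?A. (if x a = i then Lvar j (x b) * haf (A - {a,b}) x else 0)
       + (T b b + (\<Sum>l\<in>?A - {b}. T l b)))"
    proof (rule sum.cong[OF refl])
      fix b
      have eq: "?A - {b} = A - {a,b}" by auto
      have "(\<Sum>l\<in>?A - {b}. T l b) = Lvar (x a) (x b) * gl_der j i (haf (A - {a,b}) x)"
        unfolding eq IH sum_distrib_left by (rule sum.cong[OF refl off])
      then show "gl_der j i (Lvar (x a) (x b)) * haf (A - {a,b}) x
       + Lvar (x a) (x b) * gl_der j i (haf (A - {a,b}) x) = (if x a = i then Lvar j (x b) * haf (A - {a,b}) x else 0)
       + (T b b + (\<Sum>l\<in>?A - {b}. T l b))"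
        unfolding gl_der_Lvar diag by (simp add: distrib_right)
    qed
    also have "\<dots> = (if x a = i then haf A (x(a := j)) else 0) + (\<Sum>b\<in>?A. \<Sum>l\<in>?A. T l b)"
    proof -
      have "T b b + (\<Sum>l\<in>?A - {b}. T l b) = (\<Sum>l\<in>?A. T l b)" if "b \<in> ?A" for b
        by (rule sum.remove[symmetric]) (use that less.prems in auto)
      then show ?thesis unfolding first by (simp add: sum.distrib)
    qed
    also have "(\<Sum>b\<in>?A. \<Sum>l\<in>?A. T l b) = (\<Sum>l\<in>?A. \<Sum>b\<in>?A. T l b)" by (rule sum.swap)
    also have "\<dots> = (\<Sum>l\<in>?A. if x l = i then haf A (x(l := j)) else 0)"
      by (rule sum.cong[OF refl rest[symmetric]])
    finally show ?thesis
      unfolding sum.remove[OF less.prems a] .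
  qed simp
qed

text \<open>All matchings contribute the same monomial, and there are (2k-1)!! of them.\<close>

lemma haf_const:
  assumes "finite A" "card A = 2*k"
  shows "haf A (\<lambda>_. t) = of_nat (\<Prod>i<k. 2*i+1) * Lvar t t ^ k"
  using assms
proof (induction k arbitrary: A)
  case (Suc k)
  then obtain a where a: "a \<in> A" by fastforce
  have "haf (A - {a,b}) (\<lambda>_. t) = of_nat (\<Prod>i<k. 2*i+1) * Lvar t t ^ k" if "b \<in> A - {a}" for b
    using Suc.prems that a by (intro Suc.IH) (auto simp: card_Diff_subset)
  then have "haf A (\<lambda>_. t) = of_nat (card (A - {a})) * (Lvar t t * (of_nat (\<Prod>i<k. 2*i+1) * Lvar t t ^ k))"
    unfolding haf_expand[OF Suc.prems(1) a] by simp
  moreover have "card (A - {a}) = 2*k+1" using Suc.prems a by simp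
  ultimately show ?case
    by (simp only: prod.lessThan_Suc of_nat_mult power_Suc mult_ac)
qed simp

lemma haf_sym_alg:
  assumes "finite A" "\<And>a. a \<in> A \<Longrightarrow> x a < g"
  shows "haf A x \<in> sym_alg g"
  unfolding haf_def
proof (intro sym_alg_sum sym_alg_prod)
  fix M p assume "M \<in> matchings A" "p \<in> M"
  then have p: "p \<subseteq> A" "card p = 2" unfolding matchings_def by auto
  then have "finite p" "p \<noteq> {}" by (auto intro: card_ge_0_finite)
  then have "Min p \<in> A" "Max p \<in> A" using p(1) Min_in[of p] Max_in[of p] by blast+
  then show "Lvar (x (Min p)) (x (Max p)) \<in> sym_alg g" using assms(2) by simp
qed

section \<open>The ideal\<close>

lemma ideal_gen_0: "0 \<in> ideal_gen R G"
  unfolding ideal_gen_def by (rule CollectI, rule exI[of _ 0]) auto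

lemma ideal_gen_snoc:
  assumes "p \<in> ideal_gen R G" "a \<in> R" "q \<in> G"
  shows "p + a * q \<in> ideal_gen R G"
proof -
  obtain m :: nat and b r where p: "p = (\<Sum>i<m. b i * r i)" "\<forall>i<m. b i \<in> R \<and> r i \<in> G"
    using assms(1) unfolding ideal_gen_def by blast
  have "p + a * q = (\<Sum>i<Suc m. (b(m := a)) i * (r(m := q)) i)"
    unfolding p(1) by simp
  moreover have "\<forall>i<Suc m. (b(m := a)) i \<in> R \<and> (r(m := q)) i \<in> G"
    using p(2) assms by (auto simp: less_Suc_eq)
  ultimately show ?thesis unfolding ideal_gen_def by blast
qed

lemma ideal_gen_induct [consumes 1, case_names zero snoc]:
  assumes "p \<in> ideal_gen R G" "P 0"
    and "\<And>p a q. p \<in> ideal_gen R G \<Longrightarrow> P p \<Longrightarrow> a \<in> R \<Longrightarrow> q \<in> G \<Longrightarrow> P (p + a * q)"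
  shows "P p"
proof -
  obtain m :: nat and b r where p: "p = (\<Sum>i<m. b i * r i)" "\<forall>i<m. b i \<in> R \<and> r i \<in> G"
    using assms(1) unfolding ideal_gen_def by blast
  have "P (\<Sum>i<k. b i * r i) \<and> (\<Sum>i<k. b i * r i) \<in> ideal_gen R G" if "k \<le> m" for k
    using that
  proof (induction k)
    case 0
    then show ?case using assms(2) ideal_gen_0 by simp
  next
    case (Suc k)
    then have "b k \<in> R" "r k \<in> G" using p(2) by auto
    then show ?case using Suc assms(3) ideal_gen_snoc by simp
  qed
  then show ?thesis using p(1) by blast
qed

lemma ideal_gen_add:
  assumes "p \<in> ideal_gen R G" "q \<in> ideal_gen R G"
  shows "p + q \<in> ideal_gen R G"
  using assms(2)
proof (induction rule: ideal_gen_induct)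
  case (snoc r a q)
  then show ?case using ideal_gen_snoc[of "p + r" R G a q] by (simp add: add.assoc)
qed (use assms in simp)

lemma P_ideal_0: "0 \<in> P_ideal n g"
  unfolding P_ideal_def by (rule ideal_gen_0)

lemma P_ideal_add: "p \<in> P_ideal n g \<Longrightarrow> q \<in> P_ideal n g \<Longrightarrow> p + q \<in> P_ideal n g"
  unfolding P_ideal_def by (rule ideal_gen_add)

lemma P_ideal_mult:
  assumes "a \<in> sym_alg g" "p \<in> P_ideal n g"
  shows "a * p \<in> P_ideal n g"
  using assms(2) unfolding P_ideal_def
proof (induction rule: ideal_gen_induct)
  case (snoc p b q)
  then have "a * p + (a * b) * q \<in> ideal_gen (sym_alg g) (Pk (n+1) ` {xs. length xs = 2*n+2 \<and> set xs \<subseteq> {..<g}})"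
    using assms(1) by (intro ideal_gen_snoc sym_alg_mult) auto
  then show ?case by (simp add: algebra_simps)
qed (simp add: ideal_gen_0)

lemma P_ideal_sum: "(\<And>x. x \<in> A \<Longrightarrow> f x \<in> P_ideal n g) \<Longrightarrow> sum f A \<in> P_ideal n g"
  by (induction A rule: infinite_finite_induct) (auto intro: P_ideal_0 P_ideal_add)

lemma P_ideal_diff:
  assumes "p \<in> P_ideal n g" "q \<in> P_ideal n g"
  shows "p - q \<in> P_ideal n g"
proof -
  have "- 1 \<in> sym_alg g" using sym_alg_uminus[OF sym_alg_1] .
  from P_ideal_add[OF assms(1) P_ideal_mult[OF this assms(2)]] show ?thesis by simp
qed

text \<open>Nonzero constants are units in the coefficient field; here characteristic zero pays
  off.\<close>

lemma P_ideal_spconst_cancel: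
  assumes "spconst c * p \<in> P_ideal n g" "c \<noteq> 0"
  shows "p \<in> P_ideal n g"
proof -
  have "spconst (inverse c) * (spconst c * p) \<in> P_ideal n g"
    by (rule P_ideal_mult[OF sym_alg_spconst assms(1)])
  moreover have "spconst (inverse c) * (spconst c * p) = p"
    using assms(2) by (simp flip: mult.assoc spconst_mult)
  ultimately show ?thesis by simp
qed

lemma haf_P_ideal:
  assumes "\<And>a. a < 2*n+2 \<Longrightarrow> x a < g"
  shows "haf {0..<2*n+2} x \<in> P_ideal n g"
proof -
  let ?xs = "map x [0..<2*n+2]"
  have "Pk (n+1) ?xs = haf {0..<2*n+2} x"
    unfolding Pk_eq_haf by (auto intro!: haf_cong simp del: upt_Suc)
  moreover have "0 + 1 * Pk (n+1) ?xs \<in> P_ideal n g"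
  proof -
    have "?xs \<in> {xs. length xs = 2*n+2 \<and> set xs \<subseteq> {..<g}}"
      using assms by (auto simp del: upt_Suc)
    then show ?thesis
      unfolding P_ideal_def by (intro ideal_gen_snoc ideal_gen_0 sym_alg_1 imageI)
  qed
  ultimately show ?thesis by simp
qed

lemma P_ideal_induct [consumes 1, case_names zero add]:
  assumes "p \<in> P_ideal n g" "P 0"
    and "\<And>p a x. p \<in> P_ideal n g \<Longrightarrow> P p \<Longrightarrow> a \<in> sym_alg g \<Longrightarrow> (\<And>l. l < 2*n+2 \<Longrightarrow> x l < g)
      \<Longrightarrow> P (p + a * haf {0..<2*n+2} x)"
  shows "P p"
  using assms(1) unfolding P_ideal_def
proof (induction rule: ideal_gen_induct)
  case (snoc p a q)
  then obtain xs where xs: "length xs = 2*n+2" "set xs \<subseteq> {..<g}" "q = Pk (n+1) xs" by auto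
  then have q: "q = haf {0..<2*n+2} (\<lambda>i. xs ! i)" by (simp add: Pk_eq_haf)
  have "xs ! l < g" if "l < 2*n+2" for l using xs that by (metis lessThan_iff nth_mem subsetD)
  then show ?case unfolding q using snoc by (intro assms(3)) (auto simp: P_ideal_def)
qed (rule assms(2))

text \<open>By \<open>haf_gl_der\<close> a derivation sends each generator to a sum of generators,
  so the ideal is stable under gl(W).\<close>

lemma P_ideal_gl_der:
  assumes "p \<in> P_ideal n g" "i < g"
  shows "gl_der i j p \<in> P_ideal n g"
  using assms(1)
proof (induction rule: P_ideal_induct)
  case (add p a x)
  have "haf {0..<2*n+2} (x(l := i)) \<in> P_ideal n g" for l
    using add.hyps(3) assms(2) by (intro haf_P_ideal) auto
  then have "gl_der i j (haf {0..<2*n+2} x) \<in> P_ideal n g"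
    unfolding haf_gl_der[OF finite_atLeastLessThan]
    by (intro P_ideal_sum) (simp add: P_ideal_0 del: fun_upd_apply)
  moreover have "haf {0..<2*n+2} x \<in> P_ideal n g"
    using add.hyps(3) by (intro haf_P_ideal) auto
  ultimately show ?case
    unfolding gl_der_add gl_der_mult using add assms(2)
    by (intro P_ideal_add P_ideal_mult) (auto simp: mult.commute[of "gl_der i j a"]  intro: gl_der_sym_alg P_ideal_mult)
qed (simp add: P_ideal_0)

section \<open>Monomials in which one index occurs often\<close>

definition mono_wt :: "nat \<Rightarrow> ((nat \<times> nat) \<Rightarrow>\<^sub>0 nat) \<Rightarrow> nat \<Rightarrow> nat" where
  "mono_wt g m i = (\<Sum>v\<in>Lvars g. lookup m v * (of_bool (fst v = i) + of_bool (snd v = i)))"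

lemma mono_wt_0 [simp]: "mono_wt g 0 i = 0"
  by (simp add: mono_wt_def)

lemma mono_wt_add: "mono_wt g (m + m') i = mono_wt g m i + mono_wt g m' i"
  by (simp add: mono_wt_def lookup_add algebra_simps sum.distrib)

lemma mono_wt_single:
  assumes "k \<le> l" "l < g"
  shows "mono_wt g (single (k,l) c) i = c * (of_bool (k = i) + of_bool (l = i))"
proof -
  have "mono_wt g (single (k,l) c) i = (\<Sum>v\<in>Lvars g. if v = (k,l) then c * (of_bool (k = i) + of_bool (l = i)) else 0)"
    unfolding mono_wt_def by (intro sum.cong) (auto simp: lookup_single when_def)
  moreover have "(k,l) \<in> Lvars g" using assms by (simp add: Lvars_def)
  ultimately show ?thesis by simp
qed

text \<open>A filtration with two parameters, the exponent of L_tt and the weight in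
  \<open>t\<close>. Both add up under multiplication.\<close>

definition heavy :: "nat \<Rightarrow> nat \<Rightarrow> nat \<Rightarrow> nat \<Rightarrow> spoly set" where
  "heavy g t b s = {p \<in> sym_alg g. \<forall>m\<in>keys p. b \<le> lookup m (t,t) \<and> s \<le> mono_wt g m t}"

lemma heavy_mono: "p \<in> heavy g t b s \<Longrightarrow> b' \<le> b \<Longrightarrow> s' \<le> s \<Longrightarrow> p \<in> heavy g t b' s'"
  by (fastforce simp: heavy_def)

lemma heavy_0: "0 \<in> heavy g t b s"
  by (simp add: heavy_def)

lemma heavy_add: "p \<in> heavy g t b s \<Longrightarrow> q \<in> heavy g t b s \<Longrightarrow> p + q \<in> heavy g t b s"
  unfolding heavy_def using keys_add[of p q] by (auto intro: sym_alg_add)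

lemma heavy_mult:
  assumes "p \<in> heavy g t b s" "q \<in> heavy g t b' s'"
  shows "p * q \<in> heavy g t (b + b') (s + s')"
proof -
  have "b + b' \<le> lookup m (t,t) \<and> s + s' \<le> mono_wt g m t" if "m \<in> keys (p * q)" for m
  proof -
    obtain m1 m2 where "m = m1 + m2" "m1 \<in> keys p" "m2 \<in> keys q"
      using keys_mult[of p q] \<open>m \<in> _\<close> by blast
    then show ?thesis using assms unfolding heavy_def by (auto simp: lookup_add mono_wt_add intro: add_mono)
  qed
  then show ?thesis using assms by (auto simp: heavy_def intro: sym_alg_mult)
qed

lemma heavy_sym_alg: "p \<in> sym_alg g \<Longrightarrow> p \<in> heavy g t 0 0"
  by (simp add: heavy_def)

lemma heavy_mono_iff:
  "mono m \<in> heavy g t b s \<longleftrightarrow> keys m \<subseteq> Lvars g \<and> b \<le> lookup m (t,t) \<and> s \<le> mono_wt g m t"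
  by (simp add: heavy_def mono_sym_alg_iff)

lemma heavy_spconst_mult: "p \<in> heavy g t b s \<Longrightarrow> spconst c * p \<in> heavy g t b s"
  using heavy_mult[OF heavy_sym_alg[OF sym_alg_spconst], of p g t b s c] by simp

lemma Lvar_heavy:
  assumes "k < g" "l < g"
  shows "Lvar k l \<in> heavy g t (of_bool (k = t \<and> l = t)) (of_bool (k = t) + of_bool (l = t))"
  unfolding Lvar_eq_mono heavy_mono_iff
  using assms by (auto simp: Lvars_def mono_wt_single lookup_single when_def min_def max_def)

text \<open>Each term of the derivative turns one index \<open>t\<close> into \<open>j\<close>: it
  loses at most one factor L_tt and exactly one unit of \<open>t\<close>-weight.\<close>

lemma gl_der_heavy:
  assumes p: "p \<in> heavy g t b s" and j: "j < g" "j \<noteq> t"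
  shows "gl_der j t p \<in> heavy g t (b - 1) (s - 1)"
proof -
  have mon: "gl_der j t (mono m) \<in> heavy g t (lookup m (t,t) - 1) (mono_wt g m t - 1)"
    if "keys m \<subseteq> Lvars g" for m
    using that
  proof (induction m rule: sym_alg_mono_induct)
    case one
    then show ?case by (simp add: heavy_0)
  next
    case (var k l m)
    let ?m = "single (k,l) 1 + m"
    have kl: "k < g" "l < g" using var by auto
    have lk: "lookup ?m (t,t) = of_bool (k = t \<and> l = t) + lookup m (t,t)"
      by (auto simp: lookup_add lookup_single when_def)
    have wt: "mono_wt g ?m t = of_bool (k = t) + of_bool (l = t) + mono_wt g m t"
      using var by (simp add: mono_wt_add mono_wt_single)
    have m: "mono m \<in> heavy g t (lookup m (t,t)) (mono_wt g m t)"
      using var by (simp add: heavy_mono_iff)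
    have "Lvar k l * gl_der j t (mono m) \<in> heavy g t (lookup ?m (t,t) - 1) (mono_wt g ?m t - 1)"
      unfolding lk wt by (rule heavy_mono[OF heavy_mult[OF Lvar_heavy[OF kl] var.IH]]) auto
    moreover have "gl_der j t (Lvar k l) * mono m \<in> heavy g t (lookup ?m (t,t) - 1) (mono_wt g ?m t - 1)"
    proof (cases "k = t \<or> l = t")
      \<comment> \<open>The variable has positive \<open>t\<close>-weight, so the truncated
        subtraction is charged to it and \<open>mono m\<close> keeps its bounds.\<close>
      case True
      have 1: "(if k = t then Lvar j l else 0) \<in> heavy g t 0 (of_bool (k = t) + of_bool (l = t) - 1)"
        using heavy_mono[OF Lvar_heavy[OF j(1) kl(2), of t], of 0] j by (auto simp: heavy_0)
      have 2: "(if l = t then Lvar k j else 0) \<in> heavy g t 0 (of_bool (k = t) + of_bool (l = t) - 1)"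
        using heavy_mono[OF Lvar_heavy[OF kl(1) j(1), of t], of 0] j by (auto simp: heavy_0)
      show ?thesis
        unfolding gl_der_Lvar lk wt
        by (rule heavy_mono[OF heavy_mult[OF heavy_add[OF 1 2] m]]) (use True in auto)
    next
      case False
      then show ?thesis by (simp add: gl_der_Lvar heavy_0)
    qed
    ultimately show ?case
      unfolding mono_var_add[OF var(1)] gl_der_mult by (rule heavy_add[rotated])
  qed
  show ?thesis
  proof (induction p rule: poly_mapping_induct_add)
    case zero
    show ?case by (simp add: heavy_0)
  next
    case (single m c)
    then have "keys m \<subseteq> Lvars g" "b \<le> lookup m (t,t)" "s \<le> mono_wt g m t"
      using p by (auto simp: heavy_def sym_alg_def)
    then have "gl_der j t (mono m) \<in> heavy g t (b - 1) (s - 1)"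
      by (intro heavy_mono[OF mon]) auto
    then show ?case
      unfolding single_eq_spconst[of m c] gl_der_spconst_mult by (rule heavy_spconst_mult)
  next
    case (add p q)
    then show ?case unfolding gl_der_add by (intro heavy_add)
  qed
qed

text \<open>The generator with all indices equal to \<open>t\<close> is (2n+1)!! times this
  power.\<close>

lemma Lvar_power_P_ideal:
  assumes "t < g"
  shows "Lvar t t ^ (n+1) \<in> P_ideal n g"
proof (rule P_ideal_spconst_cancel)
  have "haf {0..<2*n+2} (\<lambda>_. t) = of_nat (\<Prod>i<n+1. 2*i+1) * Lvar t t ^ (n+1)"
    by (rule haf_const) simp_all
  then show "spconst (of_nat (\<Prod>i<n+1. 2*i+1)) * Lvar t t ^ (n+1) \<in> P_ideal n g"
    unfolding spconst_of_nat using haf_P_ideal[of n "\<lambda>_. t" g] assms by metis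
  show "(of_nat (\<Prod>i<n+1. 2*i+1) :: complex) \<noteq> 0"
    unfolding of_nat_eq_0_iff by simp
qed

lemma prod_list_Lvar_heavy:
  assumes "t < g" "set js \<subseteq> {..<g} - {t}"
  shows "prod_list (map (Lvar t) js) \<in> heavy g t 0 (length js)"
  using assms(2)
proof (induction js)
  case Nil
  then show ?case by (simp add: heavy_sym_alg)
next
  case (Cons j js)
  then have "Lvar t j \<in> heavy g t 0 1"
    using heavy_mono[OF Lvar_heavy[OF assms(1), of j t]] by auto
  from heavy_mult[OF this Cons.IH] Cons.prems show ?case by simp
qed

lemma Lvar_power_heavy:
  assumes "t < g"
  shows "Lvar t t ^ k \<in> heavy g t k (2*k)"
proof (induction k)
  case 0
  then show ?case by (simp add: heavy_sym_alg)
next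
  case (Suc k)
  from heavy_mult[OF Lvar_heavy[OF assms assms, of t] this] show ?case by simp
qed

text \<open>Applying derivations \<open>e\<^sub>t \<mapsto> e\<^sub>j\<close> to \<open>L\<^sub>t\<^sub>t ^ (n+1)\<close> trades factors \<open>L\<^sub>t\<^sub>t\<close> for factors \<open>L\<^sub>t\<^sub>j\<close>.\<close>
lemma leading_P_ideal:
  assumes "t < g" "set js \<subseteq> {..<g} - {t}" "length js \<le> n + 1"
  shows "\<exists>z \<in> heavy g t (n + 2 - length js) (2*n + 2 - length js).
    Lvar t t ^ (n + 1 - length js) * prod_list (map (Lvar t) js) + z \<in> P_ideal n g"
  using assms(2,3)
proof (induction js)
  case Nil
  show ?case using Lvar_power_P_ideal[OF assms(1), of n] heavy_0 by (intro bexI[of _ 0]) simp_all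
next
  case (Cons j js)
  define k where "k = n - length js"
  have k: "n + 1 - length js = Suc k" "n + 1 - length (j # js) = k" "n + 2 - length js = k + 2"
    "n + 2 - length (j # js) = k + 1" "2*n + 2 - length js = 2*k + 2 + length js"
    "2*n + 2 - length (j # js) = 2*k + 1 + length js"
    using Cons.prems by (auto simp: k_def)
  have j: "j < g" "j \<noteq> t" using Cons.prems by auto
  let ?J = "prod_list (map (Lvar t) js)"
  obtain z where z: "z \<in> heavy g t (k + 2) (2*k + 2 + length js)" "Lvar t t ^ Suc k * ?J + z \<in> P_ideal n g"
    using Cons unfolding k by auto
  \<comment> \<open>Differentiating L_tt^(k+1) gives the new leading term with coefficient 2(k+1).
    The terms collected in \<open>y\<close> all retain at least k+1 factors L_tt.\<close>
  define y where "y = Lvar t t ^ Suc k * gl_der j t ?J + gl_der j t z"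
  have "?J \<in> heavy g t 0 (length js)" using prod_list_Lvar_heavy[OF assms(1)] Cons.prems by simp
  from heavy_mult[OF Lvar_power_heavy[OF assms(1), of "Suc k"] gl_der_heavy[OF this j]]
  have "Lvar t t ^ Suc k * gl_der j t ?J \<in> heavy g t (k + 1) (2*k + 1 + length js)"
    by (rule heavy_mono) auto
  moreover have "gl_der j t z \<in> heavy g t (k + 1) (2*k + 1 + length js)"
    by (rule heavy_mono[OF gl_der_heavy[OF z(1) j]]) auto
  ultimately have y: "y \<in> heavy g t (k + 1) (2*k + 1 + length js)"
    unfolding y_def by (rule heavy_add)
  have c: "spconst (of_nat (2 * Suc k)) = 2 * of_nat (Suc k)"
    unfolding spconst_of_nat by (simp only: of_nat_mult of_nat_numeral)
  have d: "gl_der j t (Lvar t t) = 2 * Lvar t j"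
    unfolding gl_der_Lvar by (simp add: Lvar_commute)
  have "gl_der j t (Lvar t t ^ Suc k * ?J + z)
     = spconst (of_nat (2 * Suc k)) * (Lvar t t ^ k * prod_list (map (Lvar t) (j # js))) + y"
    unfolding gl_der_add gl_der_mult[of _ _ "_ ^ _"] gl_der_power y_def c d by (simp add: algebra_simps)
  moreover have "gl_der j t (Lvar t t ^ Suc k * ?J + z) \<in> P_ideal n g"
    by (rule P_ideal_gl_der[OF z(2) j(1)])
  moreover have inv: "spconst (of_nat (2 * Suc k)) * (spconst (inverse (of_nat (2 * Suc k))) * y) = y"
    by (simp only: mult.assoc[symmetric] spconst_mult[symmetric]) (simp del: of_nat_Suc of_nat_mult)
  ultimately have "spconst (of_nat (2 * Suc k)) * (Lvar t t ^ k * prod_list (map (Lvar t) (j # js))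
     + spconst (inverse (of_nat (2 * Suc k))) * y) \<in> P_ideal n g"
    by (simp only: distrib_left inv)
  then have "Lvar t t ^ k * prod_list (map (Lvar t) (j # js)) + spconst (inverse (of_nat (2 * Suc k))) * y \<in> P_ideal n g"
    by (rule P_ideal_spconst_cancel) (simp del: of_nat_Suc of_nat_mult)
  then show ?case unfolding k using heavy_spconst_mult[OF y] by blast
qed

text \<open>L_tt accounts for two units of \<open>t\<close>-weight per factor; any excess must come
  from mixed variables L_tj, each of which supplies one unit.\<close>

lemma extract_factors:
  assumes "t < g" "keys m \<subseteq> Lvars g" "k + 2 * lookup m (t,t) \<le> mono_wt g m t"
  shows "\<exists>js m'. length js = k \<and> set js \<subseteq> {..<g} - {t} \<and> keys m' \<subseteq> Lvars g \<and>
    mono m = prod_list (map (Lvar t) js) * mono m' \<and>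
    lookup m' (t,t) = lookup m (t,t) \<and> mono_wt g m t = k + mono_wt g m' t"
  using assms(2,3)
proof (induction k arbitrary: m)
  case 0
  then show ?case by (intro exI[of _ "[]"] exI[of _ m]) auto
next
  case (Suc k)
  have "\<exists>v\<in>keys m. v \<noteq> (t,t) \<and> (fst v = t \<or> snd v = t)"
  proof (rule ccontr)
    assume neg: "\<not> ?thesis"
    have "mono_wt g m t = (\<Sum>v\<in>Lvars g. if v = (t,t) then 2 * lookup m (t,t) else 0)"
      unfolding mono_wt_def
    proof (rule sum.cong[OF refl])
      fix v
      show "lookup m v * (of_bool (fst v = t) + of_bool (snd v = t))
        = (if v = (t,t) then 2 * lookup m (t,t) else 0)"
        using neg by (cases "v \<in> keys m") (auto simp: in_keys_iff)
    qed
    also have "\<dots> = 2 * lookup m (t,t)"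
    proof -
      have "(t,t) \<in> Lvars g" using assms(1) by (simp add: Lvars_def)
      then show ?thesis by simp
    qed
    finally show False using Suc.prems by simp
  qed
  then obtain a b where v: "(a,b) \<in> keys m" "(a,b) \<noteq> (t,t)" "a = t \<or> b = t"
    by (metis prod.collapse)
  then have ab: "a \<le> b" "b < g" using Suc.prems(1) by (auto simp: Lvars_def)
  define j where "j = (if a = t then b else a)"
  have j: "j < g" "j \<noteq> t" "Lvar a b = Lvar t j" using v ab by (auto simp: j_def Lvar_commute)
  define m1 where "m1 = m - single (a,b) 1"
  have m: "m = single (a,b) 1 + m1"
    using v unfolding m1_def
    by (intro poly_mapping_eqI) (auto simp: lookup_add lookup_minus lookup_single when_def in_keys_iff)
  have k1: "keys m1 \<subseteq> Lvars g"
    using Suc.prems(1) by (auto simp: m1_def in_keys_iff lookup_minus)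
  have lk: "lookup m (t,t) = lookup m1 (t,t)"
    unfolding m using v by (auto simp: lookup_add lookup_single when_def)
  have wt: "mono_wt g m t = 1 + mono_wt g m1 t"
    unfolding m mono_wt_add mono_wt_single[OF ab] using v by auto
  obtain js m' where js: "length js = k" "set js \<subseteq> {..<g} - {t}" "keys m' \<subseteq> Lvars g"
    "mono m1 = prod_list (map (Lvar t) js) * mono m'"
    "lookup m' (t,t) = lookup m1 (t,t)" "mono_wt g m1 t = k + mono_wt g m' t"
    using Suc.IH[OF k1] Suc.prems(2) lk wt by auto
  have "mono m = Lvar t j * mono m1"
    unfolding m mono_var_add[OF ab(1)] j(3) ..
  then show ?case
    using js j lk wt by (intro exI[of _ "j # js"] exI[of _ m']) (auto simp: mult.assoc)
qed

lemma mono_split_power: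
  assumes "keys m \<subseteq> Lvars g" "b \<le> lookup m (t,t)" "t < g"
  obtains m' where "keys m' \<subseteq> Lvars g" "mono m = Lvar t t ^ b * mono m'"
    "mono_wt g m t = 2*b + mono_wt g m' t"
proof -
  define m' where "m' = m - single (t,t) b"
  have m: "m = single (t,t) b + m'"
    using assms(2) unfolding m'_def
    by (intro poly_mapping_eqI) (auto simp: lookup_add lookup_minus lookup_single when_def)
  have "mono (single (t,t) b) = Lvar t t ^ b"
  proof (induction b)
    case (Suc b)
    have "single (t,t) (Suc b) = single (t,t) 1 + single (t,t) b"
      by (simp add: single_add[symmetric])
    then show ?case using Suc mono_var_add[of t t "single (t,t) b"] by simp
  qed simp
  then have "mono m = Lvar t t ^ b * mono m'"
    unfolding m by (metis mult_single mult_1)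
  moreover have "mono_wt g m t = 2*b + mono_wt g m' t"
    unfolding m mono_wt_add using assms(3) by (simp add: mono_wt_single)
  moreover have "keys m' \<subseteq> Lvars g"
    using assms(1) by (auto simp: m'_def in_keys_iff lookup_minus)
  ultimately show thesis using that by blast
qed

text \<open>Downward induction on \<open>b\<close>, with \<open>d\<close> measuring the distance to
  n+1, where L_tt^(n+1) divides every monomial. Below that, a monomial with exactly \<open>b\<close>
  factors L_tt is rewritten modulo the ideal so that each new term has one more such factor and
  still has \<open>t\<close>-weight above 2n.\<close>

lemma heavy_P_ideal:
  assumes t: "t < g"
  shows "heavy g t b (2*n+1) \<subseteq> P_ideal n g"
proof -
  have "\<forall>b. n + 1 \<le> b + d \<longrightarrow> heavy g t b (2*n+1) \<subseteq> P_ideal n g" for d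
  proof (induction d)
    case 0
    show ?case
    proof (intro allI impI subsetI)
      fix b p assume b: "n + 1 \<le> b + 0" and p: "p \<in> heavy g t b (2*n+1)"
      have "single m (lookup p m) \<in> P_ideal n g" if "m \<in> keys p" for m
      proof -
        have m: "keys m \<subseteq> Lvars g" "n + 1 \<le> lookup m (t,t)"
          using p that b by (auto simp: heavy_def sym_alg_def)
        from mono_split_power[OF m t] obtain m' where "keys m' \<subseteq> Lvars g"
          "mono m = Lvar t t ^ (n+1) * mono m'" by blast
        then have "mono m \<in> P_ideal n g"
          using P_ideal_mult[OF _ Lvar_power_P_ideal[OF t], of "mono m'" n]
          by (simp add: mono_sym_alg_iff mult.commute)
        then show ?thesis
          unfolding single_eq_spconst[of m "lookup p m"]
          by (intro P_ideal_mult) auto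
      qed
      then show "p \<in> P_ideal n g"
        by (subst poly_mapping_expand) (rule P_ideal_sum)
    qed
  next
    case (Suc d)
    show ?case
    proof (intro allI impI subsetI)
      fix b p assume b: "n + 1 \<le> b + Suc d" and p: "p \<in> heavy g t b (2*n+1)"
      have up: "heavy g t (b+1) (2*n+1) \<subseteq> P_ideal n g" using spec[OF Suc.IH, of "b+1"] b by simp
      have "single m (lookup p m) \<in> P_ideal n g" if "m \<in> keys p" for m
      proof -
        have m: "keys m \<subseteq> Lvars g" "b \<le> lookup m (t,t)" "2*n+1 \<le> mono_wt g m t"
          using p that by (auto simp: heavy_def sym_alg_def)
        have "mono m \<in> P_ideal n g"
        proof (cases "b = lookup m (t,t) \<and> b \<le> n")
          case False
          show ?thesis
          proof (cases "b \<le> n")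
            case True
            then have "mono m \<in> heavy g t (b+1) (2*n+1)" using False m by (auto simp: heavy_mono_iff)
            then show ?thesis using up by blast
          next
            case False
            then have "mono m \<in> heavy g t b (2*n+1)" using m by (auto simp: heavy_mono_iff)
            then show ?thesis using spec[OF Suc.IH, of b] False by auto
          qed
        next
          case True
          \<comment> \<open>The relation to be used has degree n+1: \<open>b\<close> factors L_tt
            and \<open>k\<close> mixed ones. Enough mixed factors exist because (2n+1) - 2b \<ge>
            n+1-b for b \<le> n.\<close>
          define k where "k = n + 1 - b"
          have "k + 2 * lookup m (t,t) \<le> mono_wt g m t"
            using True m(3) by (auto simp: k_def)
          from extract_factors[OF t m(1) this] obtain js m1 where js: "length js = k" "set js \<subseteq> {..<g} - {t}"
            "keys m1 \<subseteq> Lvars g" "mono m = prod_list (map (Lvar t) js) * mono m1"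
            "lookup m1 (t,t) = b" "mono_wt g m t = k + mono_wt g m1 t"
            using True by auto
          from mono_split_power[OF js(3), of b t] js(5) t obtain m2 where m2: "keys m2 \<subseteq> Lvars g"
            "mono m1 = Lvar t t ^ b * mono m2" "mono_wt g m1 t = 2*b + mono_wt g m2 t" by auto
          have eqs: "n + 2 - length js = b + 1" "2*n + 2 - length js = n + 1 + b" "n + 1 - length js = b" "length js \<le> n + 1"
            using True js(1) by (auto simp: k_def)
          from leading_P_ideal[OF t js(2) eqs(4), unfolded eqs]
          obtain z where z: "z \<in> heavy g t (b+1) (n + 1 + b)"
            "Lvar t t ^ b * prod_list (map (Lvar t) js) + z \<in> P_ideal n g" by blast
          have "mono m2 \<in> heavy g t 0 (mono_wt g m2 t)" using m2(1) by (simp add: heavy_mono_iff)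
          \<comment> \<open>The weights add up to at least (n+1+b) + (n-b) = 2n+1, so the threshold
            is preserved.\<close>
          from heavy_mult[OF z(1) this] have "z * mono m2 \<in> heavy g t (b+1) (2*n+1)"
            by (rule heavy_mono) (use m(3) js(6) m2(3) True in \<open>auto simp: k_def\<close>)
          then have "z * mono m2 \<in> P_ideal n g" using up by blast
          moreover have "mono m2 * (Lvar t t ^ b * prod_list (map (Lvar t) js) + z) \<in> P_ideal n g"
            using z(2) m2(1) by (intro P_ideal_mult) (auto simp: mono_sym_alg_iff)
          ultimately have "mono m2 * (Lvar t t ^ b * prod_list (map (Lvar t) js) + z) - z * mono m2 \<in> P_ideal n g"
            by (intro P_ideal_diff)
          moreover have "mono m2 * (Lvar t t ^ b * prod_list (map (Lvar t) js) + z) - z * mono m2 = mono m"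
            unfolding js(4) m2(2) by (simp add: algebra_simps)
          ultimately show ?thesis by simp
        qed
        then show ?thesis
          unfolding single_eq_spconst[of m "lookup p m"]
          by (intro P_ideal_mult) auto
      qed
      then show "p \<in> P_ideal n g"
        by (subst poly_mapping_expand) (rule P_ideal_sum)
    qed
  qed
  from spec[OF this[of "n+1"], of b] show ?thesis by simp
qed

text \<open>The polynomial counterpart of \<open>height\<close>: L_kl contributes (k+1) +
  (l+1).\<close>

definition mono_height :: "nat \<Rightarrow> ((nat \<times> nat) \<Rightarrow>\<^sub>0 nat) \<Rightarrow> int" where
  "mono_height g m = (\<Sum>v\<in>Lvars g. int (lookup m v) * (int (fst v) + int (snd v) + 2))"

lemma mono_height_0 [simp]: "mono_height g 0 = 0"
  by (simp add: mono_height_def)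

lemma mono_height_nonneg: "mono_height g m \<ge> 0"
  unfolding mono_height_def by (intro sum_nonneg) auto

lemma mono_height_add: "mono_height g (m + m') = mono_height g m + mono_height g m'"
  by (simp add: mono_height_def lookup_add algebra_simps sum.distrib)

lemma mono_height_single:
  assumes "k \<le> l" "l < g"
  shows "mono_height g (single (k,l) 1) = int k + int l + 2"
proof -
  have "mono_height g (single (k,l) 1) = (\<Sum>v\<in>Lvars g. if v = (k,l) then int k + int l + 2 else 0)"
    unfolding mono_height_def by (intro sum.cong) (auto simp: lookup_single when_def)
  moreover have "(k,l) \<in> Lvars g" using assms by (simp add: Lvars_def)
  ultimately show ?thesis by simp
qed

definition poly_height_lt :: "nat \<Rightarrow> int \<Rightarrow> spoly \<Rightarrow> bool" where
  "poly_height_lt g N p \<longleftrightarrow> (\<forall>m\<in>keys p. mono_height g m < N)"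

lemma poly_height_lt_mono: "poly_height_lt g N p \<Longrightarrow> N \<le> N' \<Longrightarrow> poly_height_lt g N' p"
  by (fastforce simp: poly_height_lt_def)

lemma poly_height_lt_0 [simp]: "poly_height_lt g N 0"
  by (simp add: poly_height_lt_def)

lemma poly_height_lt_add: "poly_height_lt g N p \<Longrightarrow> poly_height_lt g N q \<Longrightarrow> poly_height_lt g N (p + q)"
  using keys_add[of p q] by (auto simp: poly_height_lt_def)

lemma poly_height_lt_mult:
  assumes "poly_height_lt g N p" "\<forall>m\<in>keys q. mono_height g m \<le> K"
  shows "poly_height_lt g (N + K) (p * q)"
  unfolding poly_height_lt_def
proof
  fix m assume "m \<in> keys (p * q)"
  then obtain m1 m2 where "m = m1 + m2" "m1 \<in> keys p" "m2 \<in> keys q"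
    using keys_mult[of p q] by blast
  then show "mono_height g m < N + K"
    using assms by (auto simp: poly_height_lt_def mono_height_add intro: add_less_le_mono)
qed

lemma poly_height_lt_spconst_mult: "poly_height_lt g N p \<Longrightarrow> poly_height_lt g N (spconst c * p)"
  using poly_height_lt_mult[of g N p "spconst c" 0] by (auto simp: spconst_def mult.commute)

lemma poly_height_lt_Lvar_mult:
  assumes "poly_height_lt g N p" "k < g" "l < g"
  shows "poly_height_lt g (N + int k + int l + 2) (Lvar k l * p)"
proof -
  have "\<forall>m\<in>keys (Lvar k l). mono_height g m \<le> int k + int l + 2"
    unfolding Lvar_eq_mono using mono_height_single[of "min k l" "max k l" g] assms
    by (auto simp: min_def max_def)
  from poly_height_lt_mult[OF assms(1) this] show ?thesis by (simp add: mult.commute add.assoc)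
qed

lemma poly_height_lt_uminus: "poly_height_lt g N p \<Longrightarrow> poly_height_lt g N (- p)"
  by (simp add: poly_height_lt_def)

lemma poly_height_lt_diff: "poly_height_lt g N p \<Longrightarrow> poly_height_lt g N q \<Longrightarrow> poly_height_lt g N (p - q)"
  using poly_height_lt_add[of g N p "- q"] poly_height_lt_uminus[of g N q] by simp

lemma poly_height_lt_gl_der:
  assumes p: "p \<in> sym_alg g" "poly_height_lt g N p" and ij: "i < g" "j < g"
  shows "poly_height_lt g (N + int i - int j) (gl_der i j p)"
proof -
  have mon: "poly_height_lt g (mono_height g m + 1 + int i - int j) (gl_der i j (mono m))"
    if "keys m \<subseteq> Lvars g" for m
    using that
  proof (induction m rule: sym_alg_mono_induct)
    case one
    then show ?case by simp
  next
    case (var k l m)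
    have kl: "k < g" "l < g" using var by auto
    have h: "mono_height g (single (k,l) 1 + m) = int k + int l + 2 + mono_height g m"
      using var by (simp only: mono_height_add mono_height_single)
    have m: "poly_height_lt g (mono_height g m + 1) (mono m)" by (simp add: poly_height_lt_def)
    have "poly_height_lt g (int k + int l + 2 + mono_height g m + 1 + int i - int j) (Lvar k l * gl_der i j (mono m))"
      by (rule poly_height_lt_mono[OF poly_height_lt_Lvar_mult[OF var.IH kl]]) simp
    moreover have "poly_height_lt g (int k + int l + 2 + mono_height g m + 1 + int i - int j) (gl_der i j (Lvar k l) * mono m)"
      unfolding gl_der_Lvar distrib_right
      using poly_height_lt_mono[OF poly_height_lt_Lvar_mult[OF m ij(1) kl(2)]]
        poly_height_lt_mono[OF poly_height_lt_Lvar_mult[OF m kl(1) ij(1)]]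
      by (intro poly_height_lt_add) auto
    ultimately show ?case
      unfolding h mono_var_add[OF var(1)] gl_der_mult by (intro poly_height_lt_add)
  qed
  show ?thesis
  proof (induction p rule: poly_mapping_induct_add)
    case (single m c)
    then have "keys m \<subseteq> Lvars g" "mono_height g m < N"
      using p by (auto simp: poly_height_lt_def sym_alg_def)
    then have "poly_height_lt g (N + int i - int j) (gl_der i j (mono m))"
      by (intro poly_height_lt_mono[OF mon]) auto
    then show ?case
      unfolding single_eq_spconst[of m c] gl_der_spconst_mult by (rule poly_height_lt_spconst_mult)
  qed (simp_all add: gl_der_add poly_height_lt_add)
qed

definition mono_wt_part :: "nat \<Rightarrow> (nat \<Rightarrow> nat) \<Rightarrow> spoly \<Rightarrow> spoly" where
  "mono_wt_part g w p = (\<Sum>m\<in>{m\<in>keys p. mono_wt g m = w}. single m (lookup p m))"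

lemma lookup_mono_wt_part:
  "lookup (mono_wt_part g w p) m = (if mono_wt g m = w then lookup p m else 0)"
proof -
  have "lookup (mono_wt_part g w p) m =
    (\<Sum>m'\<in>{m'\<in>keys p. mono_wt g m' = w}. if m' = m then lookup p m else 0)"
    unfolding mono_wt_part_def lookup_sum by (intro sum.cong) (auto simp: lookup_single when_def)
  then show ?thesis by (auto simp: in_keys_iff)
qed

lemma keys_mono_wt_part: "keys (mono_wt_part g w p) = {m\<in>keys p. mono_wt g m = w}"
  by (auto simp: in_keys_iff lookup_mono_wt_part split: if_splits)

lemma mono_wt_part_sym_alg: "p \<in> sym_alg g \<Longrightarrow> mono_wt_part g w p \<in> sym_alg g"
  by (auto simp: sym_alg_def keys_mono_wt_part)

lemma mono_wt_part_height_lt: "poly_height_lt g N p \<Longrightarrow> poly_height_lt g N (mono_wt_part g w p)"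
  by (auto simp: poly_height_lt_def keys_mono_wt_part)

lemma sum_mono_wt_parts: "(\<Sum>w\<in>mono_wt g ` keys p. mono_wt_part g w p) = p"
proof (rule poly_mapping_eqI)
  fix m
  have "lookup (\<Sum>w\<in>mono_wt g ` keys p. mono_wt_part g w p) m
    = (\<Sum>w\<in>mono_wt g ` keys p. if w = mono_wt g m then lookup p m else 0)"
    unfolding lookup_sum by (intro sum.cong) (auto simp: lookup_mono_wt_part)
  then show "lookup (\<Sum>w\<in>mono_wt g ` keys p. mono_wt_part g w p) m = lookup p m"
    by (auto simp: in_keys_iff)
qed

lemma gl_der_diag_mono:
  assumes "keys m \<subseteq> Lvars g"
  shows "gl_der i i (mono m) = of_nat (mono_wt g m i) * mono m"
  using assms
proof (induction m rule: sym_alg_mono_induct)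
  case (var k l m)
  have "mono_wt g (single (k,l) 1 + m) i = of_bool (k = i) + of_bool (l = i) + mono_wt g m i"
    using var by (simp add: mono_wt_add mono_wt_single)
  moreover have "gl_der i i (Lvar k l) = of_nat (of_bool (k = i) + of_bool (l = i)) * Lvar k l"
    by (auto simp: gl_der_Lvar)
  ultimately show ?case
    unfolding mono_var_add[OF var(1)] gl_der_mult var.IH by (simp add: algebra_simps)
qed simp

lemma gl_der_diag:
  assumes "p \<in> sym_alg g"
  shows "gl_der i i (mono_wt_part g w p) = of_nat (w i) * mono_wt_part g w p"
proof -
  have "gl_der i i (single m (lookup p m)) = of_nat (w i) * single m (lookup p m)"
    if "m \<in> keys p" "mono_wt g m = w" for m
  proof -
    have "gl_der i i (mono m) = of_nat (w i) * mono m"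
      using gl_der_diag_mono[of m g i] assms that by (auto simp: sym_alg_def)
    then show ?thesis
      unfolding single_eq_spconst[of m "lookup p m"] gl_der_spconst_mult by (simp only: mult.left_commute)
  qed
  then show ?thesis
    unfolding mono_wt_part_def gl_der_sum sum_distrib_left by (intro sum.cong) auto
qed

section \<open>The Casimir operator on polynomials\<close>

definition gl_casimir :: "nat \<Rightarrow> nat \<Rightarrow> spoly \<Rightarrow> spoly" where
  "gl_casimir n g p = of_nat (2*n + g + 1) * (\<Sum>i<g. gl_der i i p) - (\<Sum>i<g. \<Sum>j<g. gl_der j i (gl_der i j p))"

text \<open>The computation of \<open>om_dl_reordered\<close> with derivations for operators. The
  bound on \<open>w\<close> makes the natural subtraction in \<open>casimir_val\<close>
  exact.\<close>

lemma gl_casimir_mono_wt_part: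
  assumes p: "p \<in> sym_alg g" and w: "\<And>i. i < g \<Longrightarrow> w i \<le> 2*n"
  shows "gl_casimir n g (mono_wt_part g w p) = of_nat (casimir_val n g w) * mono_wt_part g w p
    - 2 * (\<Sum>i<g. \<Sum>j\<in>{i<..<g}. gl_der j i (gl_der i j (mono_wt_part g w p)))"
proof -
  let ?p = "mono_wt_part g w p"
  let ?h = "\<lambda>i. gl_der i i ?p" and ?G = "\<lambda>i j. gl_der j i (gl_der i j ?p)"
  have ps: "?p \<in> sym_alg g" by (rule mono_wt_part_sym_alg[OF p])
  have h: "?h i = of_nat (w i) * ?p" for i by (rule gl_der_diag[OF p])
  have hh: "?G i i = of_nat (w i) * (of_nat (w i) * ?p)" for i
    using gl_der_spconst_mult[of i i "of_nat (w i)" ?p] by (simp add: h spconst_of_nat)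
  have "(\<Sum>i<g. \<Sum>j<g. ?G i j) + (\<Sum>i<g. of_nat (2*i+1) * ?h i)
    = (\<Sum>i<g. ?G i i) + 2 * (\<Sum>i<g. \<Sum>j\<in>{i<..<g}. ?G i j) + of_nat g * (\<Sum>i<g. ?h i)"
    by (rule sum_commutator_reorder) (rule gl_der_commutator[OF ps])
  then have G: "(\<Sum>i<g. \<Sum>j<g. ?G i j) = (\<Sum>i<g. ?G i i) + 2 * (\<Sum>i<g. \<Sum>j\<in>{i<..<g}. ?G i j)
     + of_nat g * (\<Sum>i<g. ?h i) - (\<Sum>i<g. of_nat (2*i+1) * ?h i)"
    by (simp add: eq_diff_eq)
  have H: "of_nat (2*n + g + 1) * (\<Sum>i<g. ?h i) = (\<Sum>i<g. of_nat (2*n + 2*i + 2) * ?h i)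
     + of_nat g * (\<Sum>i<g. ?h i) - (\<Sum>i<g. of_nat (2*i+1) * ?h i)"
    unfolding sum_distrib_left sum.distrib[symmetric] sum_subtractf[symmetric]
    by (intro sum.cong refl) (simp add: algebra_simps)
  have "of_nat (2*n + 2*i + 2) * ?h i - ?G i i = of_nat (w i * (2*n + 2*i + 2 - w i)) * ?p" if "i < g" for i
  proof -
    have "(of_nat (2*n + 2*i + 2 - w i) :: spoly) = of_nat (2*n + 2*i + 2) - of_nat (w i)"
      using w[OF that] by (intro of_nat_diff) simp
    then show ?thesis
      unfolding hh unfolding h by (simp only: of_nat_mult left_diff_distrib right_diff_distrib mult_ac)
  qed
  then have C: "(\<Sum>i<g. of_nat (2*n + 2*i + 2) * ?h i - ?G i i) = of_nat (casimir_val n g w) * ?p"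
    unfolding casimir_val_def of_nat_sum sum_distrib_right by (intro sum.cong) auto
  show ?thesis
    unfolding gl_casimir_def G H C[symmetric] sum_subtractf by (simp add: algebra_simps)
qed

section \<open>The kernel\<close>

definition has_wt :: "(nat \<Rightarrow> nat) \<Rightarrow> ext \<Rightarrow> bool" where
  "has_wt w f \<longleftrightarrow> (\<forall>S. f S \<noteq> 0 \<longrightarrow> col_wt S = w)"

lemma has_wt_0: "has_wt w 0"
  by (simp add: has_wt_def zero_fun_apply)

lemma has_wt_add: "has_wt w f \<Longrightarrow> has_wt w h \<Longrightarrow> has_wt w (f + h)"
  unfolding has_wt_def plus_fun_apply by (metis add.right_neutral)

lemma has_wt_sum: "(\<And>x. x \<in> A \<Longrightarrow> has_wt w (f x)) \<Longrightarrow> has_wt w (sum f A)"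
proof (induction A rule: infinite_finite_induct)
  case (insert x A)
  then show ?case by (metis has_wt_add insertI1 insertI2 sum.insert)
qed (metis has_wt_0 sum.infinite sum.empty)+

lemma has_wt_scale: "has_wt w f \<Longrightarrow> has_wt w (ext_scale k f)"
  by (simp add: has_wt_def ext_scale_def)

lemma has_wt_cre:
  assumes "has_wt w f"
  shows "has_wt (\<lambda>i. w i + of_bool (i = snd x)) (app (cre x) f)"
  unfolding has_wt_def
proof (intro allI impI)
  fix S assume "app (cre x) f S \<noteq> 0"
  then have S: "finite S" "x \<in> S" "f (S - {x}) \<noteq> 0" by (auto simp: app_cre split: if_splits)
  then have w: "col_wt (S - {x}) = w" using assms by (simp add: has_wt_def)
  show "col_wt S = (\<lambda>i. w i + of_bool (i = snd x))"
  proof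
    fix i
    have "{y \<in> S. snd y = i} = (if i = snd x then insert x {y \<in> S - {x}. snd y = i} else {y \<in> S - {x}. snd y = i})"
      using S(2) by auto
    then have "col_wt S i = col_wt (S - {x}) i + of_bool (i = snd x)"
      using S(1) by (simp add: col_wt_def)
    then show "col_wt S i = w i + of_bool (i = snd x)" by (simp add: w)
  qed
qed

context sp_form
begin

lemma has_wt_om:
  assumes "has_wt w f"
  shows "has_wt (\<lambda>i. w i + of_bool (i = k) + of_bool (i = l)) (app (om k l) f)"
proof -
  have "has_wt (\<lambda>i. w i + of_bool (i = l)) (app (up l a) f)" for a
    unfolding up_def app_sum app_lscale using has_wt_cre[OF assms]
    by (intro has_wt_sum has_wt_scale) (metis snd_conv)
  from has_wt_cre[OF this]
  have "has_wt (\<lambda>i. w i + of_bool (i = l) + of_bool (i = k)) (app (om k l) f)"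
    unfolding om_def app_sum app_mult by (intro has_wt_sum) (metis snd_conv)
  then show ?thesis by (simp add: add_ac)
qed

lemma phi_1: "phi 1 = vac"
  using phi_spconst[of 1] by (simp add: vac_def)

lemma has_wt_phi_mono:
  assumes "keys m \<subseteq> Lvars g"
  shows "has_wt (mono_wt g m) (phi (mono m))"
  using assms
proof (induction m rule: sym_alg_mono_induct)
  case one
  have "has_wt (\<lambda>i. 0) vac"
    by (auto simp: has_wt_def vac_def ext_const_def col_wt_def fun_eq_iff)
  moreover have "mono_wt g 0 = (\<lambda>i. 0)" by (simp add: fun_eq_iff)
  ultimately show ?case by (simp add: phi_1)
next
  case (var k l m)
  have "mono_wt g (single (k,l) 1 + m) = (\<lambda>i. mono_wt g m i + of_bool (i = k) + of_bool (i = l))"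
    using var by (auto simp only: fun_eq_iff mono_wt_add mono_wt_single) auto
  then show ?case
    unfolding mono_var_add[OF var(1)] phi_mult using has_wt_om[OF var.IH, of k l] var
    by (simp only: Phi_Lvar[OF le_less_trans[OF var(1,2)] var(2)])
qed

text \<open>Monomials map to vectors of the same weight. Hence weight parts of a kernel element are
  again in the kernel, which reduces the kernel to weight vectors.\<close>

lemma phi_mono_wt_part:
  assumes "p \<in> sym_alg g"
  shows "phi (mono_wt_part g w p) = wt_part w (phi p)"
proof -
  let ?t = "\<lambda>m. single m (lookup p m)"
  have t: "wt_part w (phi (?t m)) = (if mono_wt g m = w then phi (?t m) else 0)"
    if "m \<in> keys p" for m
  proof -
    have "has_wt (mono_wt g m) (phi (?t m))"
      unfolding single_eq_spconst[of m "lookup p m"] phi_scale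
      using assms that by (intro has_wt_scale has_wt_phi_mono) (auto simp: sym_alg_def)
    then show ?thesis
      by (auto simp: wt_part_def has_wt_def fun_eq_iff zero_fun_apply)
  qed
  have "wt_part w (phi p) = wt_part w (phi (\<Sum>m\<in>keys p. ?t m))"
    using poly_mapping_expand[of p] by simp
  also have "\<dots> = (\<Sum>m\<in>keys p. if mono_wt g m = w then phi (?t m) else 0)"
    unfolding phi_sum wt_part_sum by (intro sum.cong refl t)
  also have "\<dots> = phi (mono_wt_part g w p)"
    unfolding mono_wt_part_def phi_sum by (rule sum.inter_filter[symmetric]) simp
  finally show ?thesis by simp
qed

lemma phi_diff: "phi (p - q) = phi p - phi q"
  by (metis add_diff_cancel_right' diff_add_cancel phi_add)

text \<open>The term contributed to the contraction \<open>\<partial>\<^sub>i\<^sub>j (L\<^sub>k\<^sub>l p)\<close> by the commutator of \<open>\<partial>\<^sub>i\<^sub>j\<close> and \<open>L\<^sub>k\<^sub>l\<close>.\<close>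
definition contr_comm :: "nat \<Rightarrow> nat \<Rightarrow> nat \<Rightarrow> nat \<Rightarrow> spoly \<Rightarrow> spoly" where
  "contr_comm i j k l p =
    - (if i = k then gl_der l j p else 0) - (if i = l then gl_der k j p else 0)
    + (if j = k then (if i = l then of_nat (2*n) * p else 0) - gl_der l i p else 0)
    + (if j = l then (if i = k then of_nat (2*n) * p else 0) - gl_der k i p else 0)"

lemma phi_of_nat_mult: "phi (of_nat k * p) = ext_scale (of_nat k) (phi p)"
  using phi_scale[of "of_nat k" p] by (simp add: spconst_of_nat)

text \<open>\<open>dl_om\<close> read through \<open>phi\<close>, with each \<open>gl_op\<close>
  turned into \<open>gl_der\<close>. It is the recursion by which contractions are lifted to
  polynomials.\<close>

lemma dl_phi_Lvar:
  assumes "p \<in> sym_alg g" "i < g" "j < g" "k < g" "l < g"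
  shows "app (dl i j) (phi (Lvar k l * p)) = app (om k l) (app (dl i j) (phi p)) + phi (contr_comm i j k l p)"
proof -
  let ?F = "- (if i = k then gl_op n l j else 0) - (if i = l then gl_op n k j else 0)
    + (if j = k then (if i = l then of_nat (2*n) else 0) - gl_op n l i else 0)
    + (if j = l then (if i = k then of_nat (2*n) else 0) - gl_op n k i else 0)"
  have "app (dl i j) (phi (Lvar k l * p)) = app (dl i j * om k l) (phi p)"
    using assms by (simp add: phi_mult Phi_Lvar app_mult)
  also have "dl i j * om k l = om k l * dl i j + ?F"
    unfolding dl_om by (simp only: add_diff_eq diff_conv_add_uminus add.assoc)
  also have "app (om k l * dl i j + ?F) (phi p) = app (om k l) (app (dl i j) (phi p)) + app ?F (phi p)"
    by (simp only: app_add app_mult)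
  also have "app ?F (phi p) = phi (contr_comm i j k l p)"
  proof -
    have c: "app (of_nat (2*n)) (phi p) = phi (of_nat (2*n) * p)"
      using app_of_nat_mult[of "2*n" 1 "phi p"] fin_part_carrier[OF phi_carrier[OF assms(1)]]
      by (simp only: mult_1_right app_1 phi_of_nat_mult)
    have ifp: "app (if P then F else 0) (phi p) = (if P then app F (phi p) else 0)"
      and ifq: "phi (if P then q else 0) = (if P then phi q else 0)" for P F q by auto
    have neg: "phi (- q) = - phi q" for q using phi_diff[of 0 q] by simp
    show ?thesis
      unfolding contr_comm_def app_add app_diff app_uminus ifp ifq phi_add phi_diff neg c
      using assms by (simp only: gl_op_phi)
  qed
  finally show ?thesis .
qed

end

lemma sum_gl_der_Lvar:
  fixes F :: "nat \<Rightarrow> nat \<Rightarrow> spoly"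
  assumes "k < g" "l < g"
  shows "(\<Sum>i<g. \<Sum>j<g. gl_der i j (Lvar k l) * F i j) = (\<Sum>i<g. Lvar i l * F i k + Lvar k i * F i l)"
proof (rule sum.cong[OF refl])
  fix i
  have "(\<Sum>j<g. gl_der i j (Lvar k l) * F i j) = (\<Sum>j<g. (if j = k then Lvar i l * F i k else 0) + (if j = l then Lvar k i * F i l else 0))"
    by (rule sum.cong[OF refl]) (auto simp: gl_der_Lvar distrib_right)
  then show "(\<Sum>j<g. gl_der i j (Lvar k l) * F i j) = Lvar i l * F i k + Lvar k i * F i l"
    using assms by (simp add: sum.distrib)
qed

text \<open>A second-order operator commutes with multiplication up to first-order and scalar terms.
  The scalar is 2(2n+g+1) - (2g+2) = 4n.\<close>

lemma gl_casimir_Lvar_mult: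
  assumes "k < g" "l < g"
  shows "gl_casimir n g (Lvar k l * p) = Lvar k l * gl_casimir n g p + of_nat (4*n) * (Lvar k l * p)
    - 2 * (\<Sum>i<g. Lvar i l * gl_der k i p + Lvar k i * gl_der l i p)"
proof -
  let ?L = "Lvar k l"
  let ?X = "\<Sum>i<g. Lvar i l * gl_der k i p + Lvar k i * gl_der l i p"
  have d: "gl_der j i (gl_der i j (?L * p)) = gl_der j i (gl_der i j ?L) * p + gl_der i j ?L * gl_der j i p
     + gl_der j i ?L * gl_der i j p + ?L * gl_der j i (gl_der i j p)" for i j
    by (simp add: gl_der_mult gl_der_add algebra_simps)
  have tr: "(\<Sum>i<g. gl_der i i (?L * p)) = 2 * (?L * p) + ?L * (\<Sum>i<g. gl_der i i p)"
  proof -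
    have "(\<Sum>i<g. gl_der i i ?L) = (\<Sum>i<g. (if i = k then ?L else 0) + (if i = l then ?L else 0))"
      by (rule sum.cong[OF refl]) (auto simp: gl_der_Lvar)
    also have "\<dots> = 2 * ?L" using assms by (simp add: sum.distrib)
    finally have "(\<Sum>i<g. gl_der i i ?L * p) = 2 * ?L * p" by (simp flip: sum_distrib_right)
    then show ?thesis by (simp add: gl_der_mult sum.distrib sum_distrib_left mult.assoc)
  qed
  have cas: "(\<Sum>i<g. \<Sum>j<g. gl_der j i (gl_der i j ?L)) = of_nat (2*g + 2) * ?L"
  proof -
    have "(\<Sum>i<g. \<Sum>j<g. gl_der j i (gl_der i j ?L)) = (\<Sum>i<g. \<Sum>j<g.
       (if j = k then ?L + (if i = l then ?L else 0) else 0) + (if j = l then ?L + (if i = k then ?L else 0) else 0))"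
      by (intro sum.cong[OF refl]) (auto simp: gl_der_Lvar gl_der_add Lvar_commute)
    also have "\<dots> = (\<Sum>i<g. (?L + (if i = l then ?L else 0)) + (?L + (if i = k then ?L else 0)))"
      using assms by (simp add: sum.distrib)
    also have "\<dots> = of_nat (2*g + 2) * ?L"
      using assms by (simp add: sum.distrib algebra_simps)
    finally show ?thesis .
  qed
  have x1: "(\<Sum>i<g. \<Sum>j<g. gl_der i j ?L * gl_der j i p) = ?X"
    by (rule sum_gl_der_Lvar[OF assms])
  have x2: "(\<Sum>i<g. \<Sum>j<g. gl_der j i ?L * gl_der i j p) = ?X"
    by (subst sum.swap) (rule x1)
  have "(\<Sum>i<g. \<Sum>j<g. gl_der j i (gl_der i j (?L * p))) = of_nat (2*g + 2) * ?L * p + 2 * ?X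
    + ?L * (\<Sum>i<g. \<Sum>j<g. gl_der j i (gl_der i j p))"
    unfolding d sum.distrib x1 x2 sum_distrib_right[symmetric] sum_distrib_left[symmetric] cas
    by (simp add: sum.distrib)
  then show ?thesis
    unfolding gl_casimir_def tr by (simp add: algebra_simps)
qed

context sp_form
begin

text \<open>The correction terms are those of \<open>gl_casimir_Lvar_mult\<close>, so the Casimir
  identity propagates when a variable is multiplied on.\<close>

lemma sum_Lvar_contr_comm:
  assumes "k < g" "l < g"
  shows "(\<Sum>i<g. \<Sum>j<g. Lvar i j * contr_comm i j k l p) = of_nat (4*n) * (Lvar k l * p)
    - 2 * (\<Sum>i<g. Lvar i l * gl_der k i p + Lvar k i * gl_der l i p)"
proof -
  have e: "Lvar i j * contr_comm i j k l p =
      (if j = k then (if i = l then Lvar k l * (of_nat (2*n) * p) else 0) - Lvar k i * gl_der l i p else 0)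
    + (if j = l then (if i = k then Lvar k l * (of_nat (2*n) * p) else 0) - Lvar i l * gl_der k i p else 0)
    - ((if i = k then Lvar k j * gl_der l j p else 0) + (if i = l then Lvar j l * gl_der k j p else 0))" for i j
    unfolding contr_comm_def by (auto simp: algebra_simps Lvar_commute)
  have s1: "(\<Sum>i<g. \<Sum>j<g. if j = k then (if i = l then Lvar k l * (of_nat (2*n) * p) else 0) - Lvar k i * gl_der l i p else 0)
    = Lvar k l * (of_nat (2*n) * p) - (\<Sum>i<g. Lvar k i * gl_der l i p)"
    using assms by (simp add: sum_subtractf)
  have s2: "(\<Sum>i<g. \<Sum>j<g. if j = l then (if i = k then Lvar k l * (of_nat (2*n) * p) else 0) - Lvar i l * gl_der k i p else 0)
    = Lvar k l * (of_nat (2*n) * p) - (\<Sum>i<g. Lvar i l * gl_der k i p)"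
    using assms by (simp add: sum_subtractf)
  have s3: "(\<Sum>i<g. \<Sum>j<g. if i = k then Lvar k j * gl_der l j p else 0) = (\<Sum>j<g. Lvar k j * gl_der l j p)"
    by (subst sum.swap) (use assms in simp)
  have s4: "(\<Sum>i<g. \<Sum>j<g. if i = l then Lvar j l * gl_der k j p else 0) = (\<Sum>j<g. Lvar j l * gl_der k j p)"
    by (subst sum.swap) (use assms in simp)
  have "(\<Sum>i<g. \<Sum>j<g. Lvar i j * contr_comm i j k l p) =
     (Lvar k l * (of_nat (2*n) * p) - (\<Sum>i<g. Lvar k i * gl_der l i p))
     + (Lvar k l * (of_nat (2*n) * p) - (\<Sum>i<g. Lvar i l * gl_der k i p))
     - ((\<Sum>j<g. Lvar k j * gl_der l j p) + (\<Sum>j<g. Lvar j l * gl_der k j p))"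
    unfolding e sum_subtractf[of "\<lambda>i. (if _ = k then _ i else 0) + _ i"] sum.distrib sum_subtractf
    by (simp only: s1[unfolded sum_subtractf] s2[unfolded sum_subtractf] s3 s4 sum.distrib sum_subtractf)
  then show ?thesis by (simp add: sum.distrib algebra_simps)
qed

lemma contr_comm_sym_alg:
  assumes "p \<in> sym_alg g" "i < g" "j < g" "k < g" "l < g"
  shows "contr_comm i j k l p \<in> sym_alg g"
  unfolding contr_comm_def using assms
  by (intro sym_alg_add sym_alg_diff sym_alg_uminus)
    (auto simp del: of_nat_mult intro!: sym_alg_diff gl_der_sym_alg sym_alg_mult sym_alg_uminus)

text \<open>In each branch the index equalities cancel against the stated shift, leaving the shift
  of the derivation that occurs there.\<close>

lemma contr_comm_height_lt:
  assumes p: "p \<in> sym_alg g" "poly_height_lt g N p" and ij: "i < g" "j < g" "k < g" "l < g"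
  shows "poly_height_lt g (N + int k + int l - int i - int j) (contr_comm i j k l p)"
proof -
  have d: "poly_height_lt g (N + int a - int b) (gl_der a b p)" if "a < g" "b < g" for a b
    by (rule poly_height_lt_gl_der[OF p that])
  have c: "poly_height_lt g N (of_nat (2*n) * p)"
    using poly_height_lt_spconst_mult[OF p(2), of "of_nat (2*n)"] by (simp only: spconst_of_nat)
  show ?thesis
    unfolding contr_comm_def
    by (intro poly_height_lt_add poly_height_lt_diff poly_height_lt_uminus)
      (use poly_height_lt_mono[OF d] poly_height_lt_mono[OF c] ij in
        \<open>auto intro!: poly_height_lt_diff poly_height_lt_uminus\<close>)
qed

text \<open>The contractions \<open>\<partial>\<^sub>i\<^sub>j\<close> lift to polynomials, compatibly with the Casimir identity.\<close>
lemma contraction_lift: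
  assumes p: "p \<in> sym_alg g" "poly_height_lt g N p"
  shows "\<exists>q. (\<forall>i<g. \<forall>j<g. q i j \<in> sym_alg g \<and> phi (q i j) = app (dl i j) (phi p) \<and>
      poly_height_lt g (N - int i - int j - 2) (q i j)) \<and>
    (\<Sum>i<g. \<Sum>j<g. Lvar i j * q i j) = gl_casimir n g p"
proof -
  let ?R = "\<lambda>N p q. (\<forall>i<g. \<forall>j<g. q i j \<in> sym_alg g \<and> phi (q i j) = app (dl i j) (phi p) \<and>
      poly_height_lt g (N - int i - int j - 2) (q i j)) \<and>
    (\<Sum>i<g. \<Sum>j<g. Lvar i j * q i j) = gl_casimir n g p"
  have mon: "\<exists>q. ?R (mono_height g m + 1) (mono m) q" if "keys m \<subseteq> Lvars g" for m
    using that
  proof (induction m rule: sym_alg_mono_induct)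
    case one
    have "app (dl i j) vac = 0" for i j
      by (simp add: dl_def low_def app_sum app_mult app_lscale)
    then have "?R (mono_height g 0 + 1) (mono 0) (\<lambda>i j. 0)"
      by (simp add: gl_casimir_def phi_1)
    then show ?case by (rule exI[of _ "\<lambda>i j. 0"])
  next
    case (var k l m)
    have kl: "k < g" "l < g" using var by auto
    have m: "mono m \<in> sym_alg g" "poly_height_lt g (mono_height g m + 1) (mono m)"
      using var(3) by (simp_all add: mono_sym_alg_iff poly_height_lt_def)
    have h: "mono_height g (single (k,l) 1 + m) = int k + int l + 2 + mono_height g m"
      using var by (simp only: mono_height_add mono_height_single)
    obtain q where q: "?R (mono_height g m + 1) (mono m) q" using var.IH by blast
    \<comment> \<open>The Leibniz rule for the lift: multiply the old contraction by the variable
      and add the commutator term.\<close>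
    define q' where "q' = (\<lambda>i j. Lvar k l * q i j + contr_comm i j k l (mono m))"
    have "q' i j \<in> sym_alg g \<and> phi (q' i j) = app (dl i j) (phi (Lvar k l * mono m)) \<and>
      poly_height_lt g (int k + int l + 2 + mono_height g m + 1 - int i - int j - 2) (q' i j)"
      if ij: "i < g" "j < g" for i j
    proof (intro conjI)
      have qij: "q i j \<in> sym_alg g" "phi (q i j) = app (dl i j) (phi (mono m))"
        "poly_height_lt g (mono_height g m + 1 - int i - int j - 2) (q i j)" using q ij by auto
      show "q' i j \<in> sym_alg g"
        unfolding q'_def using qij(1) kl by (intro sym_alg_add sym_alg_mult contr_comm_sym_alg m ij) auto
      show "phi (q' i j) = app (dl i j) (phi (Lvar k l * mono m))"
        unfolding q'_def phi_add dl_phi_Lvar[OF m(1) ij kl]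
        by (simp only: phi_mult Phi_Lvar[OF kl] qij(2))
      have "poly_height_lt g (int k + int l + 2 + mono_height g m + 1 - int i - int j - 2) (Lvar k l * q i j)"
        by (rule poly_height_lt_mono[OF poly_height_lt_Lvar_mult[OF qij(3) kl]]) simp
      moreover have "poly_height_lt g (int k + int l + 2 + mono_height g m + 1 - int i - int j - 2) (contr_comm i j k l (mono m))"
        by (rule poly_height_lt_mono[OF contr_comm_height_lt[OF m ij kl]]) simp
      ultimately show "poly_height_lt g (int k + int l + 2 + mono_height g m + 1 - int i - int j - 2) (q' i j)"
        unfolding q'_def by (rule poly_height_lt_add)
    qed
    moreover have "(\<Sum>i<g. \<Sum>j<g. Lvar i j * q' i j) = gl_casimir n g (Lvar k l * mono m)"
    proof -
      have "(\<Sum>i<g. \<Sum>j<g. Lvar i j * q' i j) = Lvar k l * (\<Sum>i<g. \<Sum>j<g. Lvar i j * q i j)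
        + (\<Sum>i<g. \<Sum>j<g. Lvar i j * contr_comm i j k l (mono m))"
        unfolding q'_def distrib_left sum.distrib sum_distrib_left by (simp only: mult.left_commute)
      also have "(\<Sum>i<g. \<Sum>j<g. Lvar i j * q i j) = gl_casimir n g (mono m)" using q by blast
      finally show ?thesis unfolding sum_Lvar_contr_comm[OF kl] gl_casimir_Lvar_mult[OF kl] by simp
    qed
    ultimately have "?R (mono_height g (single (k,l) 1 + m) + 1) (mono (single (k,l) 1 + m)) q'"
      unfolding h mono_var_add[OF var(1)] by blast
    then show ?case by (rule exI[of _ q'])
  qed
  show ?thesis
  proof (induction p rule: poly_mapping_induct_add)
    case zero
    show ?case by (rule exI[of _ "\<lambda>i j. 0"]) (simp add: gl_casimir_def)
  next
    case (single m c)
    then have m: "keys m \<subseteq> Lvars g" "mono_height g m + 1 \<le> N"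
      using p by (auto simp: poly_height_lt_def sym_alg_def)
    obtain q where q: "?R (mono_height g m + 1) (mono m) q" using mon[OF m(1)] by blast
    define q' where "q' = (\<lambda>i j. spconst c * q i j)"
    have "q' i j \<in> sym_alg g \<and> phi (q' i j) = app (dl i j) (phi (spconst c * mono m)) \<and>
      poly_height_lt g (N - int i - int j - 2) (q' i j)" if ij: "i < g" "j < g" for i j
    proof -
      have qij: "q i j \<in> sym_alg g" "phi (q i j) = app (dl i j) (phi (mono m))"
        "poly_height_lt g (mono_height g m + 1 - int i - int j - 2) (q i j)" using q ij by auto
      have "poly_height_lt g (N - int i - int j - 2) (q i j)"
        by (rule poly_height_lt_mono[OF qij(3)]) (use m(2) in simp)
      then show ?thesis unfolding q'_def phi_scale app_scale_right
        using qij(1,2) by (simp add: sym_alg_mult poly_height_lt_spconst_mult)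
    qed
    moreover have "(\<Sum>i<g. \<Sum>j<g. Lvar i j * q' i j) = gl_casimir n g (spconst c * mono m)"
    proof -
      have "(\<Sum>i<g. \<Sum>j<g. Lvar i j * q' i j) = spconst c * (\<Sum>i<g. \<Sum>j<g. Lvar i j * q i j)"
        unfolding q'_def sum_distrib_left by (simp only: mult.left_commute)
      also have "(\<Sum>i<g. \<Sum>j<g. Lvar i j * q i j) = gl_casimir n g (mono m)" using q by blast
      finally show ?thesis
        by (simp only: gl_casimir_def gl_der_spconst_mult sum_distrib_left right_diff_distrib mult.left_commute)
    qed
    ultimately have "?R N (single m c) q'"
      unfolding single_eq_spconst[of m c] by blast
    then show ?case by (rule exI[of _ q'])
  next
    case (add p1 p2)
    obtain q1 where q1: "?R N p1 q1" using add(1) by blast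
    obtain q2 where q2: "?R N p2 q2" using add(2) by blast
    have "(\<Sum>i<g. \<Sum>j<g. Lvar i j * (q1 i j + q2 i j)) = gl_casimir n g p1 + gl_casimir n g p2"
      using q1 q2 by (simp add: distrib_left sum.distrib)
    also have "\<dots> = gl_casimir n g (p1 + p2)"
      by (simp add: gl_casimir_def gl_der_add sum.distrib algebra_simps)
    finally have "?R N (p1 + p2) (\<lambda>i j. q1 i j + q2 i j)"
      using q1 q2 by (simp add: sym_alg_add phi_add app_add_right poly_height_lt_add)
    then show ?case by (rule exI[of _ "\<lambda>i j. q1 i j + q2 i j"])
  qed
qed

theorem phi_kernel_subset:
  assumes "p \<in> sym_alg g" "phi p = 0"
  shows "p \<in> P_ideal n g"
proof -
  have "\<forall>p\<in>sym_alg g. poly_height_lt g (int N) p \<longrightarrow> phi p = 0 \<longrightarrow> p \<in> P_ideal n g" for N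
  proof (induction N)
    case 0
    show ?case
    proof (intro ballI impI)
      fix p assume p: "poly_height_lt g (int 0) p"
      have "m \<notin> keys p" for m
        using p mono_height_nonneg[of g m] by (auto simp: poly_height_lt_def)
      then have "keys p = {}" by blast
      then show "p \<in> P_ideal n g" by (simp add: P_ideal_0)
    qed
  next
    case (Suc N)
    show ?case
    proof (intro ballI impI)
      fix p assume p: "p \<in> sym_alg g" "poly_height_lt g (int (Suc N)) p" "phi p = 0"
      have "mono_wt_part g w p \<in> P_ideal n g" if "w \<in> mono_wt g ` keys p" for w
      proof (cases "\<exists>i<g. w i > 2*n")
        case True
        \<comment> \<open>For such weights the Casimir value can vanish, so membership is obtained
          monomial by monomial.\<close>
        then obtain t where t: "t < g" "w t > 2*n" by blast
        have "mono_wt_part g w p \<in> heavy g t 0 (2*n+1)"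
          using mono_wt_part_sym_alg[OF p(1)] t by (auto simp: heavy_def keys_mono_wt_part)
        then show ?thesis using heavy_P_ideal[OF t(1)] by blast
      next
        case False
        then have w: "w i \<le> 2*n" if "i < g" for i using that by (meson not_le)
        let ?p = "mono_wt_part g w p"
        have ps: "?p \<in> sym_alg g" by (rule mono_wt_part_sym_alg[OF p(1)])
        have ph: "poly_height_lt g (int (Suc N)) ?p" by (rule mono_wt_part_height_lt[OF p(2)])
        have p0: "phi ?p = 0" unfolding phi_mono_wt_part[OF p(1)] p(3) by (rule wt_part_0)
        show ?thesis
        proof (cases "\<exists>i<g. w i \<noteq> 0")
          case True
          then have nz: "casimir_val n g w \<noteq> 0" using casimir_val_pos w by blast
          obtain q where q: "\<forall>i<g. \<forall>j<g. q i j \<in> sym_alg g \<and> phi (q i j) = app (dl i j) (phi ?p) \<and>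
              poly_height_lt g (int (Suc N) - int i - int j - 2) (q i j)"
            "(\<Sum>i<g. \<Sum>j<g. Lvar i j * q i j) = gl_casimir n g ?p"
            using contraction_lift[OF ps ph] by blast
          \<comment> \<open>Lifted contractions of a kernel element lie in the kernel again and have
            smaller height, so the induction hypothesis applies.\<close>
          have "q i j \<in> P_ideal n g" if "i < g" "j < g" for i j
          proof -
            have "phi (q i j) = 0" using q(1) that p0 by simp
            moreover have "poly_height_lt g (int N) (q i j)"
              using poly_height_lt_mono[of g "int (Suc N) - int i - int j - 2" "q i j" "int N"] q(1) that by simp
            ultimately show ?thesis using Suc.IH q(1) that by blast
          qed
          then have cas: "gl_casimir n g ?p \<in> P_ideal n g"
            unfolding q(2)[symmetric] by (intro P_ideal_sum P_ideal_mult) auto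
          have "gl_der j i (gl_der i j ?p) \<in> P_ideal n g" if ij: "i < j" "j < g" for i j
          proof (rule P_ideal_gl_der[OF _ ij(2)])
            have i: "i < g" using ij by simp
            have "phi (gl_der i j ?p) = 0" using gl_op_phi[OF ps i ij(2)] p0 by simp
            moreover have "poly_height_lt g (int N) (gl_der i j ?p)"
              by (rule poly_height_lt_mono[OF poly_height_lt_gl_der[OF ps ph i ij(2)]]) (use ij in simp)
            ultimately show "gl_der i j ?p \<in> P_ideal n g" using Suc.IH gl_der_sym_alg[OF ps i] by blast
          qed
          then have "(\<Sum>i<g. \<Sum>j\<in>{i<..<g}. gl_der j i (gl_der i j ?p)) \<in> P_ideal n g"
            by (intro P_ideal_sum) auto
          then have "of_nat 2 * (\<Sum>i<g. \<Sum>j\<in>{i<..<g}. gl_der j i (gl_der i j ?p)) \<in> P_ideal n g"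
            by (rule P_ideal_mult[OF sym_alg_of_nat])
          from P_ideal_add[OF cas this]
          have "spconst (of_nat (casimir_val n g w)) * ?p \<in> P_ideal n g"
            using gl_casimir_mono_wt_part[OF p(1) w] by (simp add: spconst_of_nat)
          then show ?thesis by (rule P_ideal_spconst_cancel) (use nz in simp)
        next
          case False
          \<comment> \<open>Weight zero leaves only the constant monomial, and \<open>phi\<close> is
            injective on constants.\<close>
          have key0: "m = 0" if m: "m \<in> keys ?p" for m
          proof (rule poly_mapping_eqI)
            fix v
            show "lookup m v = lookup 0 v"
            proof (rule ccontr)
              assume "lookup m v \<noteq> lookup 0 v"
              then have v: "v \<in> keys m" by (simp add: in_keys_iff)
              then have vL: "v \<in> Lvars g" using ps m by (auto simp: sym_alg_def)
              then have "fst v < g" by (auto simp: Lvars_def)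
              then have "mono_wt g m (fst v) = 0" using False m by (auto simp: keys_mono_wt_part)
              then have "lookup m v * (of_bool (fst v = fst v) + of_bool (snd v = fst v)) = (0::nat)"
                unfolding mono_wt_def using vL by (subst (asm) sum_eq_0_iff) auto
              then show False using v by (simp add: in_keys_iff)
            qed
          qed
          have const: "?p = spconst (lookup ?p 0)"
          proof (rule poly_mapping_eqI)
            fix m
            show "lookup ?p m = lookup (spconst (lookup ?p 0)) m"
              using key0[of m] by (cases "m = 0") (auto simp: spconst_def lookup_single when_def in_keys_iff)
          qed
          then have "phi ?p = ext_const (lookup ?p 0)" by (metis phi_spconst)
          then have "ext_const (lookup ?p 0) {} = 0" by (simp only: p0 zero_fun_apply)
          then have "?p = 0" using const by (simp add: ext_const_def)
          then show ?thesis by (simp add: P_ideal_0)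
        qed
      qed
      then have "(\<Sum>w\<in>mono_wt g ` keys p. mono_wt_part g w p) \<in> P_ideal n g"
        by (rule P_ideal_sum)
      then show "p \<in> P_ideal n g" by (simp only: sum_mono_wt_parts)
    qed
  qed
  \<comment> \<open>Heights are nonnegative, so their sum over all monomials bounds each of
    them.\<close>
  moreover have "poly_height_lt g (int (nat (\<Sum>m\<in>keys p. mono_height g m) + 1)) p"
    unfolding poly_height_lt_def
  proof
    fix m assume "m \<in> keys p"
    then have "mono_height g m \<le> (\<Sum>m\<in>keys p. mono_height g m)"
      by (rule member_le_sum) (auto simp: mono_height_nonneg)
    then show "mono_height g m < int (nat (\<Sum>m\<in>keys p. mono_height g m) + 1)" by simp
  qed
  ultimately show ?thesis using assms by blast
qed

text \<open>For a constant index function the image has weight \<open>2n+2\<close> in one index, hence vanishes;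
  the general case follows by applying the derivations \<open>e\<^sub>t \<mapsto> e\<^sub>j\<close>.\<close>
lemma phi_haf:
  assumes "finite A" "card A = 2*n+2" "\<And>a. a \<in> A \<Longrightarrow> x a < g"
  shows "phi (haf A x) = 0"
proof -
  obtain a0 where a0: "a0 \<in> A" using assms(1,2) by fastforce
  define t where "t = x a0"
  have t: "t < g" using assms(3) a0 by (simp add: t_def)
  show ?thesis
    using assms(3)
  proof (induction "card {a \<in> A. x a \<noteq> t}" arbitrary: x rule: less_induct)
    case less
    show ?case
    proof (cases "\<exists>a\<in>A. x a \<noteq> t")
      case False
      then have "haf A x = haf A (\<lambda>_. t)" by (intro haf_cong) auto
      also have "\<dots> = of_nat (\<Prod>i<n+1. 2*i+1) * Lvar t t ^ (n+1)"
        using assms by (intro haf_const) auto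
      finally have eq: "haf A x = of_nat (\<Prod>i<n+1. 2*i+1) * Lvar t t ^ (n+1)" .
      have "has_wt (\<lambda>i. if i = t then 2*k else 0) (phi (Lvar t t ^ k))" for k
      proof (induction k)
        case 0
        have "has_wt (\<lambda>i. 0) vac"
          by (auto simp: has_wt_def vac_def ext_const_def col_wt_def fun_eq_iff)
        then show ?case by (simp add: phi_1 if_distrib[of "\<lambda>x. x"] cong: if_cong)
      next
        case (Suc k)
        have "(\<lambda>i. (if i = t then 2*k else 0) + of_bool (i = t) + of_bool (i = t)) = (\<lambda>i. if i = t then 2 * Suc k else 0)"
          by (auto simp: fun_eq_iff)
        with has_wt_om[OF Suc, of t t] show ?case
          by (simp only: power_Suc phi_mult Phi_Lvar[OF t t])
      qed
      from this[of "n+1"] have wt: "has_wt (\<lambda>i. if i = t then 2*(n+1) else 0) (phi (Lvar t t ^ (n+1)))" .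
      \<comment> \<open>The weight 2n+2 in column \<open>t\<close> exceeds the 2n generators
        available there.\<close>
      have "phi (Lvar t t ^ (n+1)) = 0"
      proof (rule ext, rule ccontr)
        fix S assume "phi (Lvar t t ^ (n+1)) S \<noteq> 0 S"
        then have nz: "phi (Lvar t t ^ (n+1)) S \<noteq> 0" by (simp only: zero_fun_apply not_False_eq_True)
        have "phi (Lvar t t ^ (n+1)) \<in> ext_carrier n g"
          using t by (intro phi_carrier sym_alg_power) simp
        from ext_carrierD[OF this nz] have "col_wt S t \<le> 2*n" by (rule col_wt_le)
        moreover have "col_wt S t = 2*(n+1)" using wt nz by (simp add: has_wt_def)
        ultimately show False by simp
      qed
      then show ?thesis unfolding eq phi_of_nat_mult by simp
    next
      case True
      then obtain a where a: "a \<in> A" "x a \<noteq> t" by blast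
      \<comment> \<open>One index fewer differs from \<open>t\<close>. Turning some \<open>t\<close>
        in \<open>y\<close> back into \<open>x a\<close> yields a rearrangement of \<open>x\<close>,
        so a derivation of the hafnian of \<open>y\<close> recovers that of
        \<open>x\<close>.\<close>
      define y where "y = x(a := t)"
      have ylt: "y b < g" if "b \<in> A" for b using less.prems that t by (simp add: y_def)
      have "{b \<in> A. y b \<noteq> t} \<subset> {b \<in> A. x b \<noteq> t}" using a by (auto simp: y_def)
      then have "card {b \<in> A. y b \<noteq> t} < card {b \<in> A. x b \<noteq> t}"
        using assms(1) by (intro psubset_card_mono) auto
      then have y0: "phi (haf A y) = 0" using less.hyps ylt by blast
      \<comment> \<open>Exchanging the positions \<open>a\<close> and \<open>l\<close> identifies
        the two index functions.\<close>
      have swap: "haf A (y(l := x a)) = haf A x" if l: "l \<in> A" "y l = t" for l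
      proof -
        let ?s = "\<lambda>b. if b = a then l else if b = l then a else b"
        have bij: "bij_betw ?s A A"
          by (rule bij_betw_byWitness[where f' = ?s]) (use a l in auto)
        have "haf A (\<lambda>b. x (?s b)) = haf A x" by (rule haf_reindex[OF assms(1) bij])
        moreover have "haf A (\<lambda>b. x (?s b)) = haf A (y(l := x a))"
          by (rule haf_cong) (use l in \<open>auto simp: y_def\<close>)
        ultimately show ?thesis by simp
      qed
      have "gl_der (x a) t (haf A y) = (\<Sum>l\<in>A. if y l = t then haf A x else 0)"
        unfolding haf_gl_der[OF assms(1)] by (rule sum.cong[OF refl]) (simp add: swap del: fun_upd_apply)
      also have "\<dots> = of_nat (card {l \<in> A. y l = t}) * haf A x"
        using assms(1) by (subst sum.inter_filter[symmetric]) auto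
      finally have "ext_scale (of_nat (card {l \<in> A. y l = t})) (phi (haf A x)) = phi (gl_der (x a) t (haf A y))"
        by (simp only: phi_of_nat_mult)
      also have "\<dots> = app (gl_op n (x a) t) (phi (haf A y))"
        by (rule gl_op_phi[symmetric]) (use haf_sym_alg[OF assms(1)] ylt less.prems a t in auto)
      finally have z: "ext_scale (of_nat (card {l \<in> A. y l = t})) (phi (haf A x)) = 0"
        by (simp add: y0)
      \<comment> \<open>The multiplicity is nonzero because position \<open>a\<close> itself is
        counted, so it can be divided out.\<close>
      have "a \<in> {l \<in> A. y l = t}" using a by (simp add: y_def)
      then have c: "card {l \<in> A. y l = t} \<noteq> 0" using assms(1) by auto
      have "phi (haf A x) = ext_scale (inverse (of_nat (card {l \<in> A. y l = t})))
          (ext_scale (of_nat (card {l \<in> A. y l = t})) (phi (haf A x)))"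
        using c by (simp add: ext_scale_ext_scale)
      then show ?thesis unfolding z by simp
    qed
  qed
qed

lemma phi_P_ideal:
  assumes "p \<in> P_ideal n g"
  shows "phi p = 0"
  using assms
proof (induction rule: P_ideal_induct)
  case (add p a x)
  have "phi (haf {0..<2*n+2} x) = 0"
    by (rule phi_haf) (use add.hyps(3) in auto)
  then show ?case using add.IH by (simp add: phi_add phi_mult)
qed simp

end

theorem theorem2:
  fixes n g :: nat and Om :: "nat \<Rightarrow> nat \<Rightarrow> complex"
  assumes "skew_form n Om" and "nondeg_form n Om"
  shows "\<exists>\<phi> :: spoly \<Rightarrow> ext.
    (\<forall>p\<in>sym_alg g. \<phi> p \<in> invariants n g Om) \<and>
    (\<forall>f\<in>invariants n g Om. \<exists>p\<in>sym_alg g. \<phi> p = f) \<and>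
    (\<forall>p\<in>sym_alg g. \<forall>q\<in>sym_alg g.
        \<phi> (p + q) = ext_add (\<phi> p) (\<phi> q) \<and>
        \<phi> (p * q) = ext_mul (gens n g) (\<phi> p) (\<phi> q)) \<and>
    (\<forall>c. \<phi> (spconst c) = ext_const c) \<and>
    (\<forall>p\<in>sym_alg g. \<phi> p = ext_zero \<longleftrightarrow> p \<in> P_ideal n g)"
proof -
  obtain J where J:
    "\<And>a c. a < 2*n \<Longrightarrow> c < 2*n \<Longrightarrow> (\<Sum>b<2*n. J a b * Om b c) = (if a = c then 1 else 0)"
    "\<And>a c. a < 2*n \<Longrightarrow> c < 2*n \<Longrightarrow> (\<Sum>b<2*n. Om a b * J b c) = (if a = c then 1 else 0)"
    "\<And>a b. a < 2*n \<Longrightarrow> b < 2*n \<Longrightarrow> J a b = - J b a"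
    using skew_nondeg_inverse[OF assms] by blast
  have Om: "Om a b = - Om b a" if "a < 2*n" "b < 2*n" for a b
    using assms(1) that unfolding skew_form_def by blast
  interpret sp_form n g Om J
    by (rule sp_form.intro[OF Om J(3) J(1) J(2)])
  have zero: "ext_zero = 0"
    by (simp add: ext_zero_def zero_fun_def)
  have inv: "phi p \<in> invariants n g Om" if "p \<in> sym_alg g" for p
  proof -
    have "ext_act n g M (phi p) = phi p" if M: "M \<in> Sp n Om" for M
      by (rule ext_act_phi[OF _ \<open>p \<in> sym_alg g\<close>]) (rule Sp_preserves_inverse_form[OF M J(1,2)])
    then show ?thesis
      using phi_carrier[OF that] by (simp add: invariants_def)
  qed
  have surj: "\<exists>p\<in>sym_alg g. phi p = f" if "f \<in> invariants n g Om" for f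
    using lie_invariants_subset_phi[OF invariants_lie_invariants[OF assms(1) that]] by blast
  have hom: "phi (p + q) = ext_add (phi p) (phi q)" for p q
    by (simp only: phi_add ext_add_def plus_fun_def)
  have ker: "phi p = ext_zero \<longleftrightarrow> p \<in> P_ideal n g" if "p \<in> sym_alg g" for p
    unfolding zero using phi_kernel_subset[OF that] phi_P_ideal by blast
  show ?thesis
    using inv surj hom phi_mult_ext phi_spconst ker by (intro exI[of _ phi]) blast
qed

end
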